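(* Let $\Gamma$ be a discrete group acting on a unital C$^*$-algebra $\mathcal A$ through an action $\alpha$. If the action $\alpha$ is amenable, then the reduced crossed product $\mathcal A\rtimes_r\Gamma$ is $\mathcal A$-$\Gamma$-nuclear as an $\mathcal A$-$\Gamma$-comodule.
   Context: Abbreviations: c.p. = completely positive, c.c.p. = contractive completely positive. $\otimes$ is the minimal tensor product. Setting. $\Gamma$ is a discrete group with identity $e$, acting by automorphisms $\alpha_s$ ($s\in\Gamma$) on a unital C$^*$-algebra $\mathcal A$. In the reduced crossed product $\mathcal A\rtimes_r\Gamma$ we identify $\mathcal A$ and $\Gamma$ with their canonical images, so $sas^{-1}=\alpha_s(a)$ and the elements $as$ ($a\in\mathcal A$, $s\in\Gamma$) are total. $\lambda$ is the left regular representation of $\Gamma$, generating $C^*_r(\Gamma)$. Amenable action. $\alpha$ is amenable if there is a net $(T_i)$ of finitely supported functions $T_i:\Gamma\to Z(\mathcal A)^+$ (positive elements of the center) with $\sum_{s\in\Gamma}T_i(s)^2=1$ for all $i$ and, for each $t\in\Gamma$, $\sum_{s\in\Gamma}\big(T_i(s)-\alpha_t(T_i(t^{-1}s))\big)^*\big(T_i(s)-\alpha_t(T_i(t^{-1}s))\big)\to0$ in norm. Notation. $\Gamma^\infty=\bigcup_{n\ge1}\Gamma^n$ (union of all finite Cartesian powers). For $t=(t_1,\dots,t_\ell)\in\Gamma^\infty$ put $\bar t=t_1\cdots t_\ell\in\Gamma$. For finite $F\subseteq\Gamma^\infty$, $\mathbb M_F(\mathcal A)$ is the C$^*$-algebra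 of $F\times F$ matrices over $\mathcal A$, spanned by $a\otimes e_{s,t}$ ($a\in\mathcal A$, $s,t\in F$). Module structures and coactions. $\mathcal A\rtimes_r\Gamma$ is a right $\mathcal A$-module by right multiplication and has the coaction $\delta(as)=as\otimes\lambda_s\in(\mathcal A\rtimes_r\Gamma)\otimes C^*_r(\Gamma)$. $\mathbb M_F(\mathcal A)$ is a right $\mathcal A$-module by $(a\otimes e_{s,t})\cdot b=a\alpha_{\bar t^{-1}}(b)\otimes e_{s,t}$ and has the coaction $\delta_F(a\otimes e_{s,t})=(a\otimes\lambda_{\bar s\bar t^{-1}})\otimes e_{s,t}$, where $\mathbb M_F(\mathcal A)\otimes C^*_r(\Gamma)$ is identified with $\mathbb M_F(\mathcal A\otimes C^*_r(\Gamma))$. $\mathcal A$ has the trivial coaction $a\mapsto a\otimes\lambda_e$. $\mathcal A$-admissible maps. For operator systems $\mathcal B,\mathcal D$ with right $\mathcal A$-module structures, the class of $\mathcal A$-admissible c.p. maps is determined by the rules: (1) every c.p. $\mathcal A$-module map is $\mathcal A$-admissible; (2) if $\varphi:\mathcal B\to\mathcal D$ is $\mathcal A$-admissible, so are $x\mapsto\varphi(bxb^* )$ and $x\mapsto d\varphi(x)d^*$ for $b\in\mathcal B$, $d\in\mathcal D$ (whenever these expressions make sense in $\mathcal B$, resp. $\mathcal D$); (3) maps $x\mapsto\rho(x)d$ with $\rho$ a positive functional on $\mathcal B$ and $d\in\mathcal D^+$ are $\mathcal A$-admissible; (4) compositions, positive multiples and finite sums of $\mathcal A$-admissible maps are $\mathcal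 A$-admissible. $\Gamma$-cofamilies. Let $\mathcal B,\mathcal D$ be operator systems with coactions $\delta_{\mathcal B}:\mathcal B\to\mathcal B\otimes C^*_r(\Gamma)$, $\delta_{\mathcal D}:\mathcal D\to\mathcal D\otimes C^*_r(\Gamma)$. A $\Gamma$-cofamily of operator subsystems of $\mathcal B$ is a family $\{\mathcal B_i\}_{i\in I}$ with a map $\delta:I\to I$ such that $\delta_{\mathcal B}(\mathcal B_i)\subseteq\mathcal B_{\delta(i)}\otimes C^*_r(\Gamma)$. A $\Gamma$-cofamily of maps on it is a family of c.p. maps $\psi_i:\mathcal B_i\to\mathcal D$ with $(\psi_{\delta(i)}\otimes\mathrm{id})(\delta_{\mathcal B}(b))=\delta_{\mathcal D}(\psi_i(b))$ for $i\in I$, $b\in\mathcal B_i$. (In particular a single c.p. $\Gamma$-comap $\psi:\mathcal B\to\mathcal D$, i.e. $(\psi\otimes\mathrm{id})\delta_{\mathcal B}=\delta_{\mathcal D}\psi$, is a $\Gamma$-cofamily.) Coadmissible maps. The class of $\Gamma$-coadmissible families of c.p. maps is determined by the rules: (i) every $\Gamma$-cofamily of maps is $\Gamma$-coadmissible; (ii) a $\Gamma$-coadmissible family $\{\psi_i:\mathcal B_i\to\mathcal D\}_{i\in I}$ stays $\Gamma$-coadmissible if one adds to it a c.p. map of one of the forms $x\mapsto\psi_i(bxb^* )$ or $x\mapsto d\psi_i(x)d^*$ ($b\in\mathcal B$, $d\in\mathcal D$, whenever these make sense), a finite sum of maps in the family, or $x\mapsto(\mathrm{id}\otimes\varphi)\delta_{\mathcal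 D}(\psi_i(x))$ or $x\mapsto\psi_{\delta(i)}\big((\mathrm{id}\otimes\varphi)\delta_{\mathcal B}(x)\big)$ with $\varphi\in C^*_r(\Gamma)^*$; (iii) for $\Gamma$-coadmissible families $\{\phi_i:\mathcal B_i\to\mathcal D\}$ and $\{\psi_j:\mathcal D_j\to\mathcal C\}$, the family of all compositions $\psi_j\circ\phi_i$ with $\phi_i(\mathcal B_i)\subseteq\mathcal D_j$ is $\Gamma$-coadmissible; (iv) unions of two $\Gamma$-coadmissible families are $\Gamma$-coadmissible. A family is coadmissible if it is $\Gamma$-coadmissible and all its members are $\mathcal A$-admissible; a single map is coadmissible if it belongs to a coadmissible family. Nuclearity. $\mathcal B=\mathcal A\rtimes_r\Gamma$ is $\mathcal A$-$\Gamma$-nuclear as an $\mathcal A$-$\Gamma$-comodule if for every $\varepsilon>0$ and finite $S\subseteq\mathcal B$ there are a finite $F\subseteq\Gamma^\infty$ and coadmissible c.c.p. maps $\varphi_F:\mathcal B\to\mathbb M_F(\mathcal A)$ and $\psi_F:\mathbb M_F(\mathcal A)\to\mathcal B$ with $\|\psi_F\varphi_F(b)-b\|\le\varepsilon$ for all $b\in S$. *)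

theory Defs
  imports
    "HOL-Analysis.Analysis"
    "HOL-Library.FuncSet"
    "HOL-Library.Function_Algebras"
begin

section \<open>Unital C*-algebras, actions, amenability\<close>

class scaleC =
  fixes scaleC :: "complex \<Rightarrow> 'a \<Rightarrow> 'a" (infixr "*\<^sub>C" 75)

text \<open>The unit is nonzero, since \<^class>\<open>real_normed_algebra_1\<close> has \<open>norm 1 = 1\<close>.\<close>

class unital_cstar_algebra = real_normed_algebra_1 + banach + scaleC +
  fixes star :: "'a \<Rightarrow> 'a"
  assumes scaleC_add_right: "c *\<^sub>C (x + y) = c *\<^sub>C x + c *\<^sub>C y"
    and scaleC_add_left: "(c + d) *\<^sub>C x = c *\<^sub>C x + d *\<^sub>C x"
    and scaleC_scaleC: "c *\<^sub>C (d *\<^sub>C x) = (c * d) *\<^sub>C x"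
    and scaleR_scaleC: "r *\<^sub>R x = complex_of_real r *\<^sub>C x"
    and mult_scaleC_left: "(c *\<^sub>C x) * y = c *\<^sub>C (x * y)"
    and mult_scaleC_right: "x * (c *\<^sub>C y) = c *\<^sub>C (x * y)"
    and norm_scaleC: "norm (c *\<^sub>C x) = cmod c * norm x"
    and star_add: "star (x + y) = star x + star y"
    and star_scaleC: "star (c *\<^sub>C x) = cnj c *\<^sub>C star x"
    and star_mult: "star (x * y) = star y * star x"
    and star_star: "star (star x) = x"
    and cstar_identity: "norm (star x * x) = (norm x)\<^sup>2"

definition star_automorphism :: "('a::unital_cstar_algebra \<Rightarrow> 'a) \<Rightarrow> bool" where
  "star_automorphism f \<longleftrightarrow> bij f \<and>
     (\<forall>x y. f (x + y) = f x + f y) \<and> (\<forall>c x. f (c *\<^sub>C x) = c *\<^sub>C f x) \<and>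
     (\<forall>x y. f (x * y) = f x * f y) \<and> (\<forall>x. f (star x) = star (f x))"

text \<open>A discrete group is a type of class \<^class>\<open>group_add\<close>: the (not necessarily commutative)
  group law is written \<open>+\<close>, the identity \<open>0\<close>, and \<open>-t + s\<close>, \<open>s - t\<close> stand for
  $t^{-1}s$, $st^{-1}$.\<close>

definition cstar_action :: "('g::group_add \<Rightarrow> 'a::unital_cstar_algebra \<Rightarrow> 'a) \<Rightarrow> bool" where
  "cstar_action \<alpha> \<longleftrightarrow> (\<forall>s. star_automorphism (\<alpha> s)) \<and> \<alpha> 0 = id \<and> (\<forall>s t. \<alpha> (s + t) = \<alpha> s \<circ> \<alpha> t)"

definition central_positive :: "'a::unital_cstar_algebra set" where
  "central_positive = {z. (\<forall>a. z * a = a * z) \<and> (\<exists>b. z = star b * b)}"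

text \<open>The net is represented by its filter of tails on the space of functions \<open>\<Gamma> \<Rightarrow> A\<close>.\<close>

definition amenable_action :: "('g::group_add \<Rightarrow> 'a::unital_cstar_algebra \<Rightarrow> 'a) \<Rightarrow> bool" where
  "amenable_action \<alpha> \<longleftrightarrow> (\<exists>N :: ('g \<Rightarrow> 'a) filter. N \<noteq> bot \<and>
     (\<forall>\<^sub>F T in N. finite {s. T s \<noteq> 0} \<and> (\<forall>s. T s \<in> central_positive) \<and>
        (\<Sum>s | T s \<noteq> 0. (T s)\<^sup>2) = 1) \<and>
     (\<forall>t. ((\<lambda>T. \<Sum>s | T s \<noteq> 0 \<or> T (- t + s) \<noteq> 0.
              star (T s - \<alpha> t (T (- t + s))) * (T s - \<alpha> t (T (- t + s)))) \<longlongrightarrow> 0) N))"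


section \<open>Bounded operators on \<open>\<ell>\<^sup>2\<close> spaces\<close>

text \<open>Hilbert spaces are taken in the form $\ell^2(X)$, with \<open>X\<close> a set in an arbitrary index type
  \<open>'x\<close>, and an operator on $\ell^2(X)$ is given by its matrix with respect to the canonical basis
  (vanishing outside \<open>X \<times> X\<close>).  The algebraic operations, the norm and positivity below are those
  of the operators.  Sums and differences of matrices are pointwise (Function_Algebras).\<close>

type_synonym 'x oper = "'x \<Rightarrow> 'x \<Rightarrow> complex"

definition op_form :: "'x oper \<Rightarrow> 'x set \<Rightarrow> ('x \<Rightarrow> complex) \<Rightarrow> ('x \<Rightarrow> complex) \<Rightarrow> complex" where
  "op_form T F \<xi> \<eta> = (\<Sum>x\<in>F. \<Sum>y\<in>F. cnj (\<xi> x) * T x y * \<eta> y)"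

definition op_bound :: "real \<Rightarrow> 'x oper \<Rightarrow> bool" where
  "op_bound C T \<longleftrightarrow> 0 \<le> C \<and> (\<forall>F \<xi> \<eta>. finite F \<longrightarrow>
     cmod (op_form T F \<xi> \<eta>) \<le> C * L2_set (\<lambda>x. cmod (\<xi> x)) F * L2_set (\<lambda>x. cmod (\<eta> x)) F)"

definition op_norm :: "'x oper \<Rightarrow> real" where
  "op_norm T = Inf {C. op_bound C T}"

definition bounded_ops :: "'x set \<Rightarrow> 'x oper set" where
  "bounded_ops X = {T. (\<exists>C. op_bound C T) \<and> (\<forall>x y. T x y \<noteq> 0 \<longrightarrow> x \<in> X \<and> y \<in> X)}"

definition op_pos :: "'x oper \<Rightarrow> bool" where
  "op_pos T \<longleftrightarrow> (\<forall>F \<xi>. finite F \<longrightarrow> op_form T F \<xi> \<xi> \<in> \<real>\<^sub>\<ge>\<^sub>0)"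

definition op_id :: "'x set \<Rightarrow> 'x oper" where
  "op_id X = (\<lambda>x y. if x = y \<and> x \<in> X then 1 else 0)"

definition op_scale :: "complex \<Rightarrow> 'x oper \<Rightarrow> 'x oper" where
  "op_scale c T = (\<lambda>x y. c * T x y)"

definition op_adj :: "'x oper \<Rightarrow> 'x oper" where
  "op_adj T = (\<lambda>x y. cnj (T y x))"

definition op_mult :: "'x oper \<Rightarrow> 'x oper \<Rightarrow> 'x oper" where
  "op_mult S T = (\<lambda>x y. \<Sum>\<^sub>\<infinity>z. S x z * T z y)"

definition op_conj :: "'x oper \<Rightarrow> 'x oper \<Rightarrow> 'x oper" where
  "op_conj b x = op_mult (op_mult b x) (op_adj b)"

definition op_span :: "'x oper set \<Rightarrow> 'x oper set" where
  "op_span S = {\<Sum>T\<in>F. op_scale (c T) T | F c. finite F \<and> F \<subseteq> S}"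

definition op_closure :: "'x oper set \<Rightarrow> 'x oper set" where
  "op_closure V = {T. \<forall>e>0. \<exists>S\<in>V. op_bound e (T - S)}"

definition op_tensor :: "'x oper \<Rightarrow> 'y oper \<Rightarrow> ('x \<times> 'y) oper" where
  "op_tensor S T = (\<lambda>(x, g) (y, h). S x y * T g h)"

definition min_tensor :: "'x oper set \<Rightarrow> 'y oper set \<Rightarrow> ('x \<times> 'y) oper set" where
  "min_tensor V W = op_closure (op_span {op_tensor v w | v w. v \<in> V \<and> w \<in> W})"

definition faithful_rep :: "('a::unital_cstar_algebra \<Rightarrow> 'h oper) \<Rightarrow> bool" where
  "faithful_rep \<pi> \<longleftrightarrow> inj \<pi> \<and> range \<pi> \<subseteq> bounded_ops UNIV \<and> \<pi> 1 = op_id UNIV \<and>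
     (\<forall>a b. \<pi> (a + b) = \<pi> a + \<pi> b) \<and> (\<forall>c a. \<pi> (c *\<^sub>C a) = op_scale c (\<pi> a)) \<and>
     (\<forall>a b. \<pi> (a * b) = op_mult (\<pi> a) (\<pi> b)) \<and> (\<forall>a. \<pi> (star a) = op_adj (\<pi> a))"


section \<open>Operator systems and completely positive maps\<close>

definition opsys_on :: "'x set \<Rightarrow> 'x oper set \<Rightarrow> bool" where
  "opsys_on X V \<longleftrightarrow> V \<subseteq> bounded_ops X \<and> op_id X \<in> V \<and>
     (\<forall>S\<in>V. \<forall>T\<in>V. S + T \<in> V) \<and> (\<forall>c. \<forall>T\<in>V. op_scale c T \<in> V) \<and>
     (\<forall>T\<in>V. op_adj T \<in> V) \<and> op_closure V \<subseteq> V"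

definition opsys :: "'x oper set \<Rightarrow> bool" where
  "opsys V \<longleftrightarrow> (\<exists>X. opsys_on X V)"

definition subsystem :: "'x oper set \<Rightarrow> 'x oper set \<Rightarrow> bool" where
  "subsystem V B \<longleftrightarrow> V \<subseteq> B \<and> (\<exists>X. opsys_on X V \<and> opsys_on X B)"

definition linear_map_on :: "'x oper set \<Rightarrow> ('x oper \<Rightarrow> 'y oper) \<Rightarrow> bool" where
  "linear_map_on B f \<longleftrightarrow> (\<forall>x\<in>B. \<forall>y\<in>B. f (x + y) = f x + f y) \<and>
     (\<forall>c. \<forall>x\<in>B. f (op_scale c x) = op_scale c (f x))"

text \<open>The operator on $\mathbb C^n \otimes \ell^2(X)$ given by an \<open>n \<times> n\<close> matrix of operators.\<close>

definition block :: "nat \<Rightarrow> (nat \<Rightarrow> nat \<Rightarrow> 'x oper) \<Rightarrow> (nat \<times> 'x) oper" where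
  "block n A = (\<lambda>(i, x) (j, y). if i < n \<and> j < n then A i j x y else 0)"

definition cp_map :: "'x oper set \<Rightarrow> 'y oper set \<Rightarrow> ('x oper \<Rightarrow> 'y oper) \<Rightarrow> bool" where
  "cp_map B D f \<longleftrightarrow> f \<in> B \<rightarrow>\<^sub>E D \<and> linear_map_on B f \<and>
     (\<forall>n A. (\<forall>i<n. \<forall>j<n. A i j \<in> B) \<longrightarrow> op_pos (block n A) \<longrightarrow>
        op_pos (block n (\<lambda>i j. f (A i j))))"

definition ccp_map :: "'x oper set \<Rightarrow> 'y oper set \<Rightarrow> ('x oper \<Rightarrow> 'y oper) \<Rightarrow> bool" where
  "ccp_map B D f \<longleftrightarrow> cp_map B D f \<and> (\<forall>x\<in>B. op_norm (f x) \<le> op_norm x)"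

definition positive_functional :: "'x oper set \<Rightarrow> ('x oper \<Rightarrow> complex) \<Rightarrow> bool" where
  "positive_functional B \<rho> \<longleftrightarrow> (\<forall>x\<in>B. \<forall>y\<in>B. \<rho> (x + y) = \<rho> x + \<rho> y) \<and>
     (\<forall>c. \<forall>x\<in>B. \<rho> (op_scale c x) = c * \<rho> x) \<and> (\<forall>x\<in>B. op_pos x \<longrightarrow> \<rho> x \<in> \<real>\<^sub>\<ge>\<^sub>0)"


section \<open>\<open>A\<close>-admissible maps\<close>

definition right_module ::
    "'x oper set \<Rightarrow> ('x oper \<Rightarrow> 'a::unital_cstar_algebra \<Rightarrow> 'x oper) \<Rightarrow> bool" where
  "right_module B m \<longleftrightarrow> (\<forall>a. \<forall>x\<in>B. m x a \<in> B) \<and> (\<forall>a. linear_map_on B (\<lambda>x. m x a)) \<and>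
     (\<forall>x\<in>B. \<forall>a b. m x (a + b) = m x a + m x b) \<and>
     (\<forall>x\<in>B. \<forall>c a. m x (c *\<^sub>C a) = op_scale c (m x a)) \<and>
     (\<forall>x\<in>B. \<forall>a b. m x (a * b) = m (m x a) b) \<and> (\<forall>x\<in>B. m x 1 = x)"

text \<open>\<open>admissible B m D n f\<close>: the map \<open>f : B \<rightarrow> D\<close> is \<open>A\<close>-admissible with respect to the right
  \<open>A\<close>-module structures \<open>m\<close> of \<open>B\<close> and \<open>n\<close> of \<open>D\<close>.\<close>

inductive admissible ::
    "'x oper set \<Rightarrow> ('x oper \<Rightarrow> 'a::unital_cstar_algebra \<Rightarrow> 'x oper) \<Rightarrow>
     'x oper set \<Rightarrow> ('x oper \<Rightarrow> 'a \<Rightarrow> 'x oper) \<Rightarrow> ('x oper \<Rightarrow> 'x oper) \<Rightarrow> bool" where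
  module_map: "opsys B \<Longrightarrow> opsys D \<Longrightarrow> right_module B m \<Longrightarrow> right_module D n \<Longrightarrow> cp_map B D f \<Longrightarrow>
    (\<And>x a. x \<in> B \<Longrightarrow> f (m x a) = n (f x) a) \<Longrightarrow> admissible B m D n f"
| conj_domain: "admissible B m D n f \<Longrightarrow> b \<in> B \<Longrightarrow> (\<And>x. x \<in> B \<Longrightarrow> op_conj b x \<in> B) \<Longrightarrow>
    admissible B m D n (\<lambda>x\<in>B. f (op_conj b x))"
| conj_codomain: "admissible B m D n f \<Longrightarrow> d \<in> D \<Longrightarrow> (\<And>x. x \<in> B \<Longrightarrow> op_conj d (f x) \<in> D) \<Longrightarrow>
    admissible B m D n (\<lambda>x\<in>B. op_conj d (f x))"
| functional: "opsys B \<Longrightarrow> opsys D \<Longrightarrow> right_module B m \<Longrightarrow> right_module D n \<Longrightarrow>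
    positive_functional B \<rho> \<Longrightarrow> d \<in> D \<Longrightarrow> op_pos d \<Longrightarrow>
    admissible B m D n (\<lambda>x\<in>B. op_scale (\<rho> x) d)"
| composition: "admissible B m C k f \<Longrightarrow> admissible C k D n g \<Longrightarrow>
    admissible B m D n (compose B g f)"
| multiple: "admissible B m D n f \<Longrightarrow> r > 0 \<Longrightarrow>
    admissible B m D n (\<lambda>x\<in>B. op_scale (complex_of_real r) (f x))"
| sum: "admissible B m D n f \<Longrightarrow> admissible B m D n g \<Longrightarrow>
    admissible B m D n (\<lambda>x\<in>B. f x + g x)"


section \<open>Coactions\<close>

definition left_regular :: "'g::group_add \<Rightarrow> 'g oper" where
  "left_regular s = (\<lambda>g h. if g = s + h then 1 else 0)"

definition reduced_group_algebra :: "'g::group_add oper set" where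
  "reduced_group_algebra = op_closure (op_span (range left_regular))"

definition dual_reduced_group_algebra :: "('g::group_add oper \<Rightarrow> complex) set" where
  "dual_reduced_group_algebra = {\<phi>.
     (\<forall>x\<in>reduced_group_algebra. \<forall>y\<in>reduced_group_algebra. \<phi> (x + y) = \<phi> x + \<phi> y) \<and>
     (\<forall>c. \<forall>x\<in>reduced_group_algebra. \<phi> (op_scale c x) = c * \<phi> x) \<and>
     (\<exists>K. \<forall>x\<in>reduced_group_algebra. cmod (\<phi> x) \<le> K * op_norm x)}"

text \<open>$f \otimes \mathrm{id}$ on $V \otimes C^*_r(\Gamma)$: the map \<open>f\<close> is applied to the blocks
  $z_{g,h} \in V$ of an element \<open>z\<close>.  See \<open>tensor_id_op_tensor\<close> below.\<close>

definition tensor_id :: "('x oper \<Rightarrow> 'y oper) \<Rightarrow> ('x \<times> 'g) oper \<Rightarrow> ('y \<times> 'g) oper" where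
  "tensor_id f z = (\<lambda>(x, g) (y, h). f (\<lambda>i j. z (i, g) (j, h)) x y)"

text \<open>The slice map $\mathrm{id} \otimes \phi$ on $V \otimes C^*_r(\Gamma)$, \<open>\<phi>\<close> being applied to
  the blocks of \<open>z\<close> in the other direction, which lie in $C^*_r(\Gamma)$.\<close>

definition slice :: "('g oper \<Rightarrow> complex) \<Rightarrow> ('x \<times> 'g) oper \<Rightarrow> 'x oper" where
  "slice \<phi> z = (\<lambda>x y. \<phi> (\<lambda>g h. z (x, g) (y, h)))"

text \<open>The comultiplication $\lambda_s \mapsto \lambda_s \otimes \lambda_s$ of $C^*_r(\Gamma)$,
  spatially implemented.\<close>

definition comult :: "'g::group_add oper \<Rightarrow> ('g \<times> 'g) oper" where
  "comult c = (\<lambda>(g, k) (h, l). if k = g - h + l then c g h else 0)"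

definition id_tensor_comult :: "('x \<times> 'g::group_add) oper \<Rightarrow> (('x \<times> 'g) \<times> 'g) oper" where
  "id_tensor_comult z =
     (\<lambda>((x, g), k) ((y, h), l). comult (\<lambda>i j. z (x, i) (y, j)) (g, k) (h, l))"

text \<open>A coaction on an operator system is a unital complete order embedding
  $B \rightarrow B \otimes C^*_r(\Gamma)$ satisfying the coaction identity; for C*-algebras and
  *-homomorphisms, being a complete order embedding amounts to injectivity.\<close>

definition coaction :: "'x oper set \<Rightarrow> ('x oper \<Rightarrow> ('x \<times> 'g::group_add) oper) \<Rightarrow> bool" where
  "coaction B \<delta> \<longleftrightarrow> opsys B \<and> cp_map B (min_tensor B reduced_group_algebra) \<delta> \<and>
     (\<forall>n A. (\<forall>i<n. \<forall>j<n. A i j \<in> B) \<longrightarrow> op_pos (block n (\<lambda>i j. \<delta> (A i j))) \<longrightarrow>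
        op_pos (block n A)) \<and>
     (\<forall>X. opsys_on X B \<longrightarrow> \<delta> (op_id X) = op_id (X \<times> UNIV)) \<and>
     (\<forall>b\<in>B. tensor_id \<delta> (\<delta> b) = id_tensor_comult (\<delta> b))"


section \<open>Coadmissible maps\<close>

text \<open>A family $\{\psi_i : B_i \rightarrow D\}$ is represented by the set of the pairs
  $(B_i, \psi_i)$; the members of the set serve as indices.\<close>

type_synonym 'x family = "('x oper set \<times> ('x oper \<Rightarrow> 'x oper)) set"

definition cofamily ::
    "'x oper set \<Rightarrow> ('x oper \<Rightarrow> ('x \<times> 'g::group_add) oper) \<Rightarrow>
     'x oper set \<Rightarrow> ('x oper \<Rightarrow> ('x \<times> 'g) oper) \<Rightarrow> 'x family \<Rightarrow> bool" where
  "cofamily B \<delta>B D \<delta>D S \<longleftrightarrow>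
     (\<forall>(V, \<psi>)\<in>S. subsystem V B \<and> cp_map V D \<psi>) \<and>
     (\<exists>\<delta>\<in>S \<rightarrow> S. \<forall>i\<in>S.
        \<delta>B ` fst i \<subseteq> min_tensor (fst (\<delta> i)) reduced_group_algebra \<and>
        (\<forall>b\<in>fst i. tensor_id (snd (\<delta> i)) (\<delta>B b) = \<delta>D (snd i b)))"

text \<open>Adding maps and forming compositions does not determine an index map on the new family.
  In rule \<open>slice_domain\<close> the role of \<open>\<delta>(i)\<close> is therefore played by any member of the family with
  which the expression makes sense.\<close>

inductive gamma_coadmissible ::
    "'x oper set \<Rightarrow> ('x oper \<Rightarrow> ('x \<times> 'g::group_add) oper) \<Rightarrow>
     'x oper set \<Rightarrow> ('x oper \<Rightarrow> ('x \<times> 'g) oper) \<Rightarrow> 'x family \<Rightarrow> bool" where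
  cofamily: "coaction B \<delta>B \<Longrightarrow> coaction D \<delta>D \<Longrightarrow> cofamily B \<delta>B D \<delta>D S \<Longrightarrow>
    gamma_coadmissible B \<delta>B D \<delta>D S"
| conj_domain: "gamma_coadmissible B \<delta>B D \<delta>D S \<Longrightarrow> (V, \<psi>) \<in> S \<Longrightarrow> b \<in> B \<Longrightarrow>
    (\<And>x. x \<in> V \<Longrightarrow> op_conj b x \<in> V) \<Longrightarrow>
    gamma_coadmissible B \<delta>B D \<delta>D (insert (V, \<lambda>x\<in>V. \<psi> (op_conj b x)) S)"
| conj_codomain: "gamma_coadmissible B \<delta>B D \<delta>D S \<Longrightarrow> (V, \<psi>) \<in> S \<Longrightarrow> d \<in> D \<Longrightarrow>
    (\<And>x. x \<in> V \<Longrightarrow> op_conj d (\<psi> x) \<in> D) \<Longrightarrow>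
    gamma_coadmissible B \<delta>B D \<delta>D (insert (V, \<lambda>x\<in>V. op_conj d (\<psi> x)) S)"
| sum: "gamma_coadmissible B \<delta>B D \<delta>D S \<Longrightarrow> \<psi>s \<noteq> [] \<Longrightarrow> (\<And>\<psi>. \<psi> \<in> set \<psi>s \<Longrightarrow> (V, \<psi>) \<in> S) \<Longrightarrow>
    gamma_coadmissible B \<delta>B D \<delta>D (insert (V, \<lambda>x\<in>V. \<Sum>\<psi>\<leftarrow>\<psi>s. \<psi> x) S)"
| slice_codomain: "gamma_coadmissible B \<delta>B D \<delta>D S \<Longrightarrow> (V, \<psi>) \<in> S \<Longrightarrow>
    \<phi> \<in> dual_reduced_group_algebra \<Longrightarrow> cp_map V D (\<lambda>x\<in>V. slice \<phi> (\<delta>D (\<psi> x))) \<Longrightarrow>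
    gamma_coadmissible B \<delta>B D \<delta>D (insert (V, \<lambda>x\<in>V. slice \<phi> (\<delta>D (\<psi> x))) S)"
| slice_domain: "gamma_coadmissible B \<delta>B D \<delta>D S \<Longrightarrow> (V, \<psi>) \<in> S \<Longrightarrow> (V', \<psi>') \<in> S \<Longrightarrow>
    \<delta>B ` V \<subseteq> min_tensor V' reduced_group_algebra \<Longrightarrow>
    \<phi> \<in> dual_reduced_group_algebra \<Longrightarrow> cp_map V D (\<lambda>x\<in>V. \<psi>' (slice \<phi> (\<delta>B x))) \<Longrightarrow>
    gamma_coadmissible B \<delta>B D \<delta>D (insert (V, \<lambda>x\<in>V. \<psi>' (slice \<phi> (\<delta>B x))) S)"
| composition: "gamma_coadmissible B \<delta>B D \<delta>D S \<Longrightarrow> gamma_coadmissible D \<delta>D C \<delta>C R \<Longrightarrow>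
    gamma_coadmissible B \<delta>B C \<delta>C
      {(V, compose V \<psi> \<phi>) | V \<phi> W \<psi>. (V, \<phi>) \<in> S \<and> (W, \<psi>) \<in> R \<and> \<phi> ` V \<subseteq> W}"
| union: "gamma_coadmissible B \<delta>B D \<delta>D S \<Longrightarrow> gamma_coadmissible B \<delta>B D \<delta>D R \<Longrightarrow>
    gamma_coadmissible B \<delta>B D \<delta>D (S \<union> R)"

text \<open>The \<open>A\<close>-module structure of a subsystem is the one inherited from \<open>B\<close>.\<close>

definition coadmissible_family ::
    "'x oper set \<Rightarrow> ('x oper \<Rightarrow> 'a::unital_cstar_algebra \<Rightarrow> 'x oper) \<Rightarrow>
     ('x oper \<Rightarrow> ('x \<times> 'g::group_add) oper) \<Rightarrow>
     'x oper set \<Rightarrow> ('x oper \<Rightarrow> 'a \<Rightarrow> 'x oper) \<Rightarrow> ('x oper \<Rightarrow> ('x \<times> 'g) oper) \<Rightarrow>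
     'x family \<Rightarrow> bool" where
  "coadmissible_family B m \<delta>B D n \<delta>D S \<longleftrightarrow>
     gamma_coadmissible B \<delta>B D \<delta>D S \<and> (\<forall>(V, \<psi>)\<in>S. admissible V m D n \<psi>)"

definition coadmissible_map ::
    "'x oper set \<Rightarrow> ('x oper \<Rightarrow> 'a::unital_cstar_algebra \<Rightarrow> 'x oper) \<Rightarrow>
     ('x oper \<Rightarrow> ('x \<times> 'g::group_add) oper) \<Rightarrow>
     'x oper set \<Rightarrow> ('x oper \<Rightarrow> 'a \<Rightarrow> 'x oper) \<Rightarrow> ('x oper \<Rightarrow> ('x \<times> 'g) oper) \<Rightarrow>
     ('x oper \<Rightarrow> 'x oper) \<Rightarrow> bool" where
  "coadmissible_map B m \<delta>B D n \<delta>D f \<longleftrightarrow>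
     (\<exists>S. coadmissible_family B m \<delta>B D n \<delta>D S \<and> (B, f) \<in> S)"


section \<open>The reduced crossed product and the matrix algebras\<close>

text \<open>Throughout, \<open>\<pi>\<close> is a faithful representation of \<open>A\<close> on \<open>H\<close> = $\ell^2$(\<open>'h\<close>).  The set
  $\Gamma^\infty$ consists of the nonempty lists over \<open>\<Gamma>\<close>, and $\bar t$ is \<open>sum_list t\<close>.
  All operator systems are realized on subspaces of $\ell^2$(\<open>'g list \<times> 'h\<close>), the Hilbert space
  of $M_F(A)$ being $\ell^2(F) \otimes H$ and that of the reduced crossed product being
  $\ell^2(\Gamma) \otimes H$, where $\Gamma = \Gamma^1$ is the set of lists of length one.
  The intermediate operator systems in the rules above range over all operator systems on
  subspaces of this space, and \<open>'h\<close> is arbitrary.\<close>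

text \<open>The operator $as$ in the regular representation:
  $(as\,\xi)(p) = \pi(\alpha_{p^{-1}}(a))\,\xi(s^{-1}p)$.\<close>

definition crossed_elem ::
    "('a::unital_cstar_algebra \<Rightarrow> 'h oper) \<Rightarrow> ('g::group_add \<Rightarrow> 'a \<Rightarrow> 'a) \<Rightarrow> 'a \<Rightarrow> 'g \<Rightarrow>
     ('g list \<times> 'h) oper" where
  "crossed_elem \<pi> \<alpha> a s = (\<lambda>(u, h) (v, k).
     if \<exists>p q. u = [p] \<and> v = [q] \<and> p = s + q then \<pi> (\<alpha> (- sum_list u) a) h k else 0)"

definition crossed_product ::
    "('a::unital_cstar_algebra \<Rightarrow> 'h oper) \<Rightarrow> ('g::group_add \<Rightarrow> 'a \<Rightarrow> 'a) \<Rightarrow>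
     ('g list \<times> 'h) oper set" where
  "crossed_product \<pi> \<alpha> = op_closure (op_span {crossed_elem \<pi> \<alpha> a s | a s. True})"

definition crossed_module ::
    "('a::unital_cstar_algebra \<Rightarrow> 'h oper) \<Rightarrow> ('g::group_add \<Rightarrow> 'a \<Rightarrow> 'a) \<Rightarrow>
     ('g list \<times> 'h) oper \<Rightarrow> 'a \<Rightarrow> ('g list \<times> 'h) oper" where
  "crossed_module \<pi> \<alpha> x b = op_mult x (crossed_elem \<pi> \<alpha> b 0)"

definition matrix_algebra ::
    "('a::unital_cstar_algebra \<Rightarrow> 'h oper) \<Rightarrow> 'g list set \<Rightarrow> ('g list \<times> 'h) oper set" where
  "matrix_algebra \<pi> F = {x. (\<forall>s\<in>F. \<forall>t\<in>F. (\<lambda>h k. x (s, h) (t, k)) \<in> range \<pi>) \<and>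
     (\<forall>s t h k. x (s, h) (t, k) \<noteq> 0 \<longrightarrow> s \<in> F \<and> t \<in> F)}"

definition matrix_elem ::
    "('a::unital_cstar_algebra \<Rightarrow> 'h oper) \<Rightarrow> 'a \<Rightarrow> 'g list \<Rightarrow> 'g list \<Rightarrow> ('g list \<times> 'h) oper" where
  "matrix_elem \<pi> a s t = (\<lambda>(u, h) (v, k). if u = s \<and> v = t then \<pi> a h k else 0)"

definition matrix_module ::
    "('a::unital_cstar_algebra \<Rightarrow> 'h oper) \<Rightarrow> ('g::group_add \<Rightarrow> 'a \<Rightarrow> 'a) \<Rightarrow>
     ('g list \<times> 'h) oper \<Rightarrow> 'a \<Rightarrow> ('g list \<times> 'h) oper" where
  "matrix_module \<pi> \<alpha> x b =
     (\<lambda>(s, h) (t, k). op_mult (\<lambda>i j. x (s, i) (t, j)) (\<pi> (\<alpha> (- sum_list t) b)) h k)"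

text \<open>The \<open>(s,t)\<close> block of \<open>x\<close> is tensored with $\lambda_{\bar s\bar t^{-1}}$.  On $M_F(A)$ this is
  the definition of $\delta_F$.  On the reduced crossed product it is the spatial form
  $x \mapsto W(x \otimes 1)W^*$, $W(\delta_p\otimes\xi\otimes\delta_g) =
  \delta_p\otimes\xi\otimes\delta_{pg}$, of the coaction $as \mapsto as \otimes \lambda_s$;
  see \<open>twist_crossed_elem\<close>.\<close>

definition twist :: "('g::group_add list \<times> 'h) oper \<Rightarrow> (('g list \<times> 'h) \<times> 'g) oper" where
  "twist x = (\<lambda>((s, h), g) ((t, k), g').
     x (s, h) (t, k) * left_regular (sum_list s - sum_list t) g g')"

definition crossed_coaction ::
    "('a::unital_cstar_algebra \<Rightarrow> 'h oper) \<Rightarrow> ('g::group_add \<Rightarrow> 'a \<Rightarrow> 'a) \<Rightarrow>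
     ('g list \<times> 'h) oper \<Rightarrow> (('g list \<times> 'h) \<times> 'g) oper" where
  "crossed_coaction \<pi> \<alpha> = restrict twist (crossed_product \<pi> \<alpha>)"

definition matrix_coaction ::
    "('a::unital_cstar_algebra \<Rightarrow> 'h oper) \<Rightarrow> 'g::group_add list set \<Rightarrow>
     ('g list \<times> 'h) oper \<Rightarrow> (('g list \<times> 'h) \<times> 'g) oper" where
  "matrix_coaction \<pi> F = restrict twist (matrix_algebra \<pi> F)"

lemma tensor_id_op_tensor:
  assumes "linear_map_on V f" "v \<in> V"
  shows "tensor_id f (op_tensor v c) = op_tensor (f v) c"
proof -
  have "f (\<lambda>i j. v i j * c g h) = (\<lambda>x y. f v x y * c g h)" for g h
    using assms by (simp add: linear_map_on_def op_scale_def mult.commute)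
  then show ?thesis
    by (auto simp: tensor_id_def op_tensor_def fun_eq_iff)
qed

lemma slice_op_tensor:
  assumes "\<phi> \<in> dual_reduced_group_algebra" "c \<in> reduced_group_algebra"
  shows "slice \<phi> (op_tensor v c) = op_scale (\<phi> c) v"
proof -
  have "\<phi> (\<lambda>g h. v x y * c g h) = v x y * \<phi> c" for x y
    using assms by (simp add: dual_reduced_group_algebra_def op_scale_def)
  then show ?thesis
    by (simp add: slice_def op_tensor_def op_scale_def mult.commute)
qed

lemma comult_left_regular: "comult (left_regular s) = op_tensor (left_regular s) (left_regular s)"
  by (auto simp: comult_def op_tensor_def left_regular_def fun_eq_iff algebra_simps)

lemma twist_crossed_elem:
  "twist (crossed_elem \<pi> \<alpha> a s) = op_tensor (crossed_elem \<pi> \<alpha> a s) (left_regular s)"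
  by (auto simp: twist_def crossed_elem_def op_tensor_def left_regular_def fun_eq_iff algebra_simps)

lemma twist_matrix_elem:
  "twist (matrix_elem \<pi> a s t) =
     op_tensor (matrix_elem \<pi> a s t) (left_regular (sum_list s - sum_list t))"
  by (auto simp: twist_def matrix_elem_def op_tensor_def fun_eq_iff)


section \<open>Nuclearity\<close>

definition comodule_nuclear ::
    "('a::unital_cstar_algebra \<Rightarrow> 'h oper) \<Rightarrow> ('g::group_add \<Rightarrow> 'a \<Rightarrow> 'a) \<Rightarrow>
     ('g list \<times> 'h) oper set \<Rightarrow> (('g list \<times> 'h) oper \<Rightarrow> 'a \<Rightarrow> ('g list \<times> 'h) oper) \<Rightarrow>
     (('g list \<times> 'h) oper \<Rightarrow> (('g list \<times> 'h) \<times> 'g) oper) \<Rightarrow> bool" where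
  "comodule_nuclear \<pi> \<alpha> B m \<delta> \<longleftrightarrow>
     (\<forall>\<epsilon>>0. \<forall>S. finite S \<and> S \<subseteq> B \<longrightarrow>
       (\<exists>F \<phi> \<psi>. finite F \<and> F \<subseteq> {t. t \<noteq> []} \<and>
          ccp_map B (matrix_algebra \<pi> F) \<phi> \<and>
          coadmissible_map B m \<delta>
            (matrix_algebra \<pi> F) (matrix_module \<pi> \<alpha>) (matrix_coaction \<pi> F) \<phi> \<and>
          ccp_map (matrix_algebra \<pi> F) B \<psi> \<and>
          coadmissible_map (matrix_algebra \<pi> F) (matrix_module \<pi> \<alpha>) (matrix_coaction \<pi> F)
            B m \<delta> \<psi> \<and>
          (\<forall>b\<in>S. op_norm (\<psi> (\<phi> b) - b) \<le> \<epsilon>)))"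

end

theory Submission
  imports Defs
begin

text \<open>Let \<open>T\<close> be a function as in the definition of amenability and \<open>F \<subseteq> \<Gamma>\<close> its support.  The map
  \<open>\<phi>\<close> is the compression to \<open>F\<close>.  The map \<open>\<theta> : a \<otimes> e\<^sub>s\<^sub>t \<mapsto> s a t\<^sup>-\<^sup>1\<close> of \<open>M\<^sub>F(A)\<close> into the crossed
  product is a completely positive module map and comap, and \<open>\<psi>(x) = \<theta>(d x d\<^sup>*)\<close> with the diagonal matrix
  \<open>d\<close> of entries \<open>s\<^sup>-\<^sup>1 T(s) s\<close>.  Since \<open>\<Sum>T(s)\<^sup>2 = 1\<close>, \<open>\<psi>\<close> is unital and therefore contractive, and
  \<open>\<psi>(\<phi>(as)) = c\<^sub>s as\<close> with \<open>c\<^sub>s = \<Sum>\<^sub>p T(p) \<alpha>\<^sub>s(T(s\<^sup>-\<^sup>1p))\<close>.  The sum in the definition of amenability equals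
  \<open>2 (1 - c\<^sub>s)\<close>, so \<open>\<psi> \<circ> \<phi>\<close> tends to the identity.  Complete positivity of \<open>\<theta>\<close> rests on the fact
  that the positivity of a matrix over \<open>A\<close> can be tested in any faithful representation.\<close>

section \<open>Operators given by matrices\<close>

text \<open>The obstacle: positivity in \<open>matrix_algebra \<pi> F\<close> is that of operators
  under \<pi>, whereas \<open>theta F x\<close> is built from all the representations
  \<open>\<lambda>a. \<pi> (\<alpha> w a)\<close>. The action is not assumed to be implemented by
  unitaries on H, so these need not be unitarily equivalent to \<pi>, and positivity of matrices has
  to be carried from one representation to another. This rests on a faithful representation being
  isometric, which is proved without spectral theory: the binomial series of sqrt (1 - t) on the
  closed unit ball supplies absolute values, and positivity is recognized by a norm inequality |r -
  a| <= r. The weight T is split symmetrically, one factor on each side of x; this gives complete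
  positivity and produces the squares in the unit condition. Conjugation by d is among the
  operations that the rules allow, so only \<theta> itself has to be compared with the module
  structures and the coactions. Being a comap becomes commuting with the projections
  \<open>diag_part r\<close> onto the homogeneous parts of the grading by \<Gamma>.\<close>

lemma op_boundD: "op_bound C T \<Longrightarrow> 0 \<le> C"
  by (simp add: op_bound_def)

text \<open>\<open>op_form\<close> allows only one finite set for both vectors. A rectangular sum
  with relabelled rows and columns is given that shape by moving the two vectors along
  \<open>f\<close> and \<open>f'\<close> and extending them by zero to the union of the
  images.\<close>

lemma op_form_inject:
  fixes \<xi> \<eta> :: "_ \<Rightarrow> complex"
  assumes fin: "finite G" "finite G'" and inj: "inj_on f G" "inj_on f' G'"
  defines "\<xi>' \<equiv> (\<lambda>x. if x \<in> f ` G then \<xi> (inv_into G f x) else 0)"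
    and "\<eta>' \<equiv> (\<lambda>x. if x \<in> f' ` G' then \<eta> (inv_into G' f' x) else 0)"
  shows "(\<Sum>z\<in>G. \<Sum>w\<in>G'. cnj (\<xi> z) * T (f z) (f' w) * \<eta> w) = op_form T (f ` G \<union> f' ` G') \<xi>' \<eta>'"
proof -
  have "(\<Sum>y\<in>f ` G \<union> f' ` G'. cnj (\<xi>' x) * T x y * \<eta>' y) = (\<Sum>y\<in>f' ` G'. cnj (\<xi>' x) * T x y * \<eta>' y)" for x
    by (rule sum.mono_neutral_right) (use fin in \<open>auto simp: \<eta>'_def\<close>)
  then have "op_form T (f ` G \<union> f' ` G') \<xi>' \<eta>' = (\<Sum>x\<in>f ` G \<union> f' ` G'. \<Sum>y\<in>f' ` G'. cnj (\<xi>' x) * T x y * \<eta>' y)"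
    by (simp add: op_form_def)
  also have "\<dots> = (\<Sum>x\<in>f ` G. \<Sum>y\<in>f' ` G'. cnj (\<xi>' x) * T x y * \<eta>' y)"
    by (rule sum.mono_neutral_right) (use fin in \<open>auto simp: \<xi>'_def\<close>)
  also have "\<dots> = (\<Sum>z\<in>G. \<Sum>w\<in>G'. cnj (\<xi> z) * T (f z) (f' w) * \<eta> w)"
    using inj by (simp add: sum.reindex \<xi>'_def \<eta>'_def)
  finally show ?thesis ..
qed

lemma L2_set_inject:
  assumes "finite G" "finite K" "inj_on f G" "f ` G \<subseteq> K"
  shows "L2_set (\<lambda>x. cmod (if x \<in> f ` G then \<xi> (inv_into G f x) else 0)) K = L2_set (\<lambda>z. cmod (\<xi> z)) G"
proof -
  have "(\<Sum>x\<in>K. (cmod (if x \<in> f ` G then \<xi> (inv_into G f x) else 0))\<^sup>2) =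
      (\<Sum>x\<in>f ` G. (cmod (\<xi> (inv_into G f x)))\<^sup>2)"
    by (rule sum.mono_neutral_cong_right) (use assms in auto)
  also have "\<dots> = (\<Sum>z\<in>G. (cmod (\<xi> z))\<^sup>2)"
    using assms by (simp add: sum.reindex)
  finally show ?thesis by (simp add: L2_set_def)
qed

lemma sum_nonneg_Reals:
  "(\<And>i. i \<in> I \<Longrightarrow> f i \<in> \<real>\<^sub>\<ge>\<^sub>0) \<Longrightarrow> sum f I \<in> (\<real>\<^sub>\<ge>\<^sub>0 :: complex set)"
  by (induction I rule: infinite_finite_induct) auto

lemma op_bound_inject:
  assumes "op_bound C T" "finite G" "finite G'" "inj_on f G" "inj_on f' G'"
  shows "cmod (\<Sum>z\<in>G. \<Sum>w\<in>G'. cnj (\<xi> z) * T (f z) (f' w) * \<eta> w)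
    \<le> C * L2_set (\<lambda>z. cmod (\<xi> z)) G * L2_set (\<lambda>z. cmod (\<eta> z)) G'"
proof -
  let ?\<xi> = "\<lambda>x. if x \<in> f ` G then \<xi> (inv_into G f x) else 0"
  let ?\<eta> = "\<lambda>x. if x \<in> f' ` G' then \<eta> (inv_into G' f' x) else 0"
  let ?K = "f ` G \<union> f' ` G'"
  have K: "finite ?K" using assms by simp
  have "cmod (op_form T ?K ?\<xi> ?\<eta>) \<le> C * L2_set (\<lambda>x. cmod (?\<xi> x)) ?K * L2_set (\<lambda>x. cmod (?\<eta> x)) ?K"
    using assms(1) K unfolding op_bound_def by blast
  also have "L2_set (\<lambda>x. cmod (?\<xi> x)) ?K = L2_set (\<lambda>z. cmod (\<xi> z)) G"
    by (rule L2_set_inject) (use assms in auto)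
  also have "L2_set (\<lambda>x. cmod (?\<eta> x)) ?K = L2_set (\<lambda>z. cmod (\<eta> z)) G'"
    by (rule L2_set_inject) (use assms in auto)
  finally show ?thesis
    unfolding op_form_inject[OF assms(2-5)] .
qed

lemma op_bound_rect:
  assumes "op_bound C T" "finite G" "finite G'"
  shows "cmod (\<Sum>z\<in>G. \<Sum>w\<in>G'. cnj (\<xi> z) * T z w * \<eta> w)
    \<le> C * L2_set (\<lambda>z. cmod (\<xi> z)) G * L2_set (\<lambda>z. cmod (\<eta> z)) G'"
  using op_bound_inject[OF assms, of id id] by simp

lemma op_pos_inject:
  assumes "op_pos T" "finite G" "inj_on f G"
  shows "(\<Sum>z\<in>G. \<Sum>w\<in>G. cnj (\<xi> z) * T (f z) (f w) * \<xi> w) \<in> \<real>\<^sub>\<ge>\<^sub>0"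
  unfolding op_form_inject[OF assms(2,2,3,3)] using assms by (simp add: op_pos_def)

lemma op_boundI:
  assumes "0 \<le> C" "\<And>F \<xi> \<eta>. finite F \<Longrightarrow>
     cmod (op_form T F \<xi> \<eta>) \<le> C * L2_set (\<lambda>x. cmod (\<xi> x)) F * L2_set (\<lambda>x. cmod (\<eta> x)) F"
  shows "op_bound C T"
  using assms by (simp add: op_bound_def)

text \<open>The operator is, up to identification of bases, a direct sum of the operators
  \<open>T \<gamma>\<close>: the functions \<open>l\<close>, \<open>l'\<close> give the summand of a basis vector of the range and of the
  domain, the functions \<open>f\<close>, \<open>f'\<close> its position in that summand.\<close>

lemma direct_sum_form:
  fixes l l' :: "'z \<Rightarrow> 'c" and Z Z' F :: "'z set"
  assumes "finite F"
  defines "L \<equiv> l ` (F \<inter> Z) \<union> l' ` (F \<inter> Z')"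
  shows "op_form (\<lambda>z w. if z \<in> Z \<and> w \<in> Z' \<and> l z = l' w then T (l z) (f z) (f' w) else 0) F \<xi> \<eta> =
    (\<Sum>\<gamma>\<in>L. \<Sum>z\<in>{z\<in>F \<inter> Z. l z = \<gamma>}. \<Sum>w\<in>{w\<in>F \<inter> Z'. l' w = \<gamma>}. cnj (\<xi> z) * T \<gamma> (f z) (f' w) * \<eta> w)"
proof -
  have L: "finite L" using assms by simp
  have 1: "(\<Sum>y\<in>F. cnj (\<xi> x) * (if x \<in> Z \<and> y \<in> Z' \<and> l x = l' y then T (l x) (f x) (f' y) else 0) * \<eta> y)
     = (if x \<in> Z then (\<Sum>w\<in>{w\<in>F \<inter> Z'. l' w = l x}. cnj (\<xi> x) * T (l x) (f x) (f' w) * \<eta> w) else 0)" for x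
  proof (cases "x \<in> Z")
    case True
    then show ?thesis
      by simp (rule sum.mono_neutral_cong_right, use assms in auto)
  qed auto
  have "op_form (\<lambda>z w. if z \<in> Z \<and> w \<in> Z' \<and> l z = l' w then T (l z) (f z) (f' w) else 0) F \<xi> \<eta>
     = (\<Sum>x\<in>F. if x \<in> Z then (\<Sum>w\<in>{w\<in>F \<inter> Z'. l' w = l x}. cnj (\<xi> x) * T (l x) (f x) (f' w) * \<eta> w) else 0)"
    by (simp add: op_form_def 1)
  also have "\<dots> = (\<Sum>x\<in>F \<inter> Z. \<Sum>w\<in>{w\<in>F \<inter> Z'. l' w = l x}. cnj (\<xi> x) * T (l x) (f x) (f' w) * \<eta> w)"
    by (rule sum.mono_neutral_cong_right) (use assms in auto)
  also have "\<dots> = (\<Sum>\<gamma>\<in>L. \<Sum>z\<in>{z\<in>F \<inter> Z. l z = \<gamma>}. \<Sum>w\<in>{w\<in>F \<inter> Z'. l' w = l z}. cnj (\<xi> z) * T (l z) (f z) (f' w) * \<eta> w)"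
    by (rule sum.group[symmetric]) (use assms L in auto)
  also have "\<dots> = (\<Sum>\<gamma>\<in>L. \<Sum>z\<in>{z\<in>F \<inter> Z. l z = \<gamma>}. \<Sum>w\<in>{w\<in>F \<inter> Z'. l' w = \<gamma>}. cnj (\<xi> z) * T \<gamma> (f z) (f' w) * \<eta> w)"
    by (intro sum.cong) auto
  finally show ?thesis .
qed

text \<open>The fibres of \<open>l\<close> are disjoint, so each square is counted at most once;
  points outside \<open>Z\<close> or with a label outside \<open>L\<close> are dropped.\<close>

lemma L2_set_group_le:
  assumes "finite F" "finite L"
  shows "L2_set (\<lambda>\<gamma>. L2_set g {z\<in>F \<inter> Z. l z = \<gamma>}) L \<le> L2_set g F"
proof -
  have "(\<Sum>\<gamma>\<in>L. \<Sum>z\<in>{z\<in>F \<inter> Z. l z = \<gamma>}. (g z)\<^sup>2) = (\<Sum>\<gamma>\<in>L. \<Sum>z\<in>{z\<in>{z\<in>F \<inter> Z. l z \<in> L}. l z = \<gamma>}. (g z)\<^sup>2)"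
    by (intro sum.cong) auto
  also have "\<dots> = (\<Sum>z\<in>{z\<in>F \<inter> Z. l z \<in> L}. (g z)\<^sup>2)"
    by (rule sum.group) (use assms in auto)
  also have "\<dots> \<le> (\<Sum>z\<in>F. (g z)\<^sup>2)"
    by (rule sum_mono2) (use assms in auto)
  finally show ?thesis
    by (simp add: L2_set_def sum_nonneg)
qed

text \<open>Cauchy-Schwarz is applied twice: inside each summand, through the bound on
  \<open>T \<gamma>\<close>, and then over the labels. Injectivity of the label together with the
  position keeps a basis vector of a summand from occurring twice, which could enlarge the
  norm.\<close>

lemma direct_sum_bound:
  fixes Z Z' :: "'z set"
  assumes T: "\<And>\<gamma>. op_bound C (T \<gamma>)" and C: "0 \<le> C"
    and inj: "inj_on (\<lambda>z. (l z, f z)) Z" "inj_on (\<lambda>z. (l' z, f' z)) Z'"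
  shows "op_bound C (\<lambda>z w. if z \<in> Z \<and> w \<in> Z' \<and> l z = l' w then T (l z) (f z) (f' w) else 0)"
proof (rule op_boundI[OF C])
  fix F :: "'z set" and \<xi> \<eta> assume F: "finite F"
  define L where "L = l ` (F \<inter> Z) \<union> l' ` (F \<inter> Z')"
  have L: "finite L" using F by (simp add: L_def)
  define Fz where "Fz \<gamma> = {z\<in>F \<inter> Z. l z = \<gamma>}" for \<gamma>
  define Fw where "Fw \<gamma> = {z\<in>F \<inter> Z'. l' z = \<gamma>}" for \<gamma>
  have fin: "finite (Fz \<gamma>)" "finite (Fw \<gamma>)" for \<gamma> using F by (auto simp: Fz_def Fw_def)
  have inj': "inj_on f (Fz \<gamma>)" "inj_on f' (Fw \<gamma>)" for \<gamma>
    using inj by (auto simp: Fz_def Fw_def inj_on_def)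
  have "cmod (op_form (\<lambda>z w. if z \<in> Z \<and> w \<in> Z' \<and> l z = l' w then T (l z) (f z) (f' w) else 0) F \<xi> \<eta>)
     = cmod (\<Sum>\<gamma>\<in>L. \<Sum>z\<in>Fz \<gamma>. \<Sum>w\<in>Fw \<gamma>. cnj (\<xi> z) * T \<gamma> (f z) (f' w) * \<eta> w)"
    unfolding direct_sum_form[OF F] L_def Fz_def Fw_def ..
  also have "\<dots> \<le> (\<Sum>\<gamma>\<in>L. C * L2_set (\<lambda>z. cmod (\<xi> z)) (Fz \<gamma>) * L2_set (\<lambda>z. cmod (\<eta> z)) (Fw \<gamma>))"
    by (intro sum_norm_le op_bound_inject T fin inj')
  also have "\<dots> = C * (\<Sum>\<gamma>\<in>L. \<bar>L2_set (\<lambda>z. cmod (\<xi> z)) (Fz \<gamma>)\<bar> * \<bar>L2_set (\<lambda>z. cmod (\<eta> z)) (Fw \<gamma>)\<bar>)"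
    by (simp add: sum_distrib_left mult.assoc)
  also have "\<dots> \<le> C * (L2_set (\<lambda>\<gamma>. L2_set (\<lambda>z. cmod (\<xi> z)) (Fz \<gamma>)) L * L2_set (\<lambda>\<gamma>. L2_set (\<lambda>z. cmod (\<eta> z)) (Fw \<gamma>)) L)"
    by (intro mult_left_mono L2_set_mult_ineq C)
  also have "\<dots> \<le> C * (L2_set (\<lambda>x. cmod (\<xi> x)) F * L2_set (\<lambda>x. cmod (\<eta> x)) F)"
    unfolding Fz_def Fw_def
    by (intro mult_left_mono mult_mono L2_set_group_le C F L) auto
  finally show "cmod (op_form (\<lambda>z w. if z \<in> Z \<and> w \<in> Z' \<and> l z = l' w then T (l z) (f z) (f' w) else 0) F \<xi> \<eta>)
    \<le> C * L2_set (\<lambda>x. cmod (\<xi> x)) F * L2_set (\<lambda>x. cmod (\<eta> x)) F"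
    by (simp add: mult.assoc)
qed

lemma direct_sum_pos:
  fixes Z :: "'z set"
  assumes T: "\<And>\<gamma>. op_pos (T \<gamma>)" and inj: "inj_on (\<lambda>z. (l z, f z)) Z"
  shows "op_pos (\<lambda>z w. if z \<in> Z \<and> w \<in> Z \<and> l z = l w then T (l z) (f z) (f w) else 0)"
  unfolding op_pos_def
proof (intro allI impI)
  fix F \<xi> assume F: "finite (F :: 'z set)"
  show "op_form (\<lambda>z w. if z \<in> Z \<and> w \<in> Z \<and> l z = l w then T (l z) (f z) (f w) else 0) F \<xi> \<xi> \<in> \<real>\<^sub>\<ge>\<^sub>0"
    unfolding direct_sum_form[OF F]
    by (intro sum_nonneg_Reals op_pos_inject T) (use F inj in \<open>auto simp: inj_on_def\<close>)
qed

text \<open>The case of a single summand. It serves to place or read off single blocks and to cut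
  down to a subset; its positive counterpart also rearranges nested index pairs.\<close>

lemma compression_bound:
  assumes "op_bound C T" "inj_on f Z" "inj_on f' Z'"
  shows "op_bound C (\<lambda>z w. if z \<in> Z \<and> w \<in> Z' then T (f z) (f' w) else 0)"
  using direct_sum_bound[of C "\<lambda>_::unit. T" "\<lambda>_. ()" f Z "\<lambda>_. ()" f' Z'] assms op_boundD[OF assms(1)]
  by (simp add: inj_on_def)

lemma compression_pos:
  assumes "op_pos T" "inj_on f Z"
  shows "op_pos (\<lambda>z w. if z \<in> Z \<and> w \<in> Z then T (f z) (f w) else 0)"
  using direct_sum_pos[of "\<lambda>_::unit. T" "\<lambda>_. ()" f Z] assms by (simp add: inj_on_def)

subsection \<open>Linearity of forms and norms\<close>

lemma op_form_add: "op_form (S + T) F \<xi> \<eta> = op_form S F \<xi> \<eta> + op_form T F \<xi> \<eta>"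
  by (simp add: op_form_def sum.distrib[symmetric] algebra_simps)

lemma op_form_diff: "op_form (S - T) F \<xi> \<eta> = op_form S F \<xi> \<eta> - op_form T F \<xi> \<eta>"
  by (simp add: op_form_def sum_subtractf[symmetric] algebra_simps)

lemma op_form_scale: "op_form (op_scale c T) F \<xi> \<eta> = c * op_form T F \<xi> \<eta>"
  by (simp add: op_form_def op_scale_def sum_distrib_left algebra_simps)

lemma op_form_adj: "op_form (op_adj T) F \<xi> \<eta> = cnj (op_form T F \<eta> \<xi>)"
  unfolding op_form_def op_adj_def
  by (subst sum.swap) (simp add: algebra_simps)

lemma op_form_id:
  assumes "finite F"
  shows "op_form (op_id X) F \<xi> \<xi> = (\<Sum>x\<in>F \<inter> X. (cmod (\<xi> x))\<^sup>2)"
proof -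
  have "op_form (op_id X) F \<xi> \<xi> = (\<Sum>x\<in>F. \<Sum>y\<in>F. if y = x then (if x \<in> X then cnj (\<xi> x) * \<xi> x else 0) else 0)"
    unfolding op_form_def op_id_def by (intro sum.cong) auto
  also have "\<dots> = (\<Sum>x\<in>F. if x \<in> X then cnj (\<xi> x) * \<xi> x else 0)"
    using assms by simp
  also have "\<dots> = (\<Sum>x\<in>F \<inter> X. cnj (\<xi> x) * \<xi> x)"
    using assms by (simp add: sum.inter_restrict)
  also have "\<dots> = of_real (\<Sum>x\<in>F \<inter> X. (cmod (\<xi> x))\<^sup>2)"
    unfolding of_real_sum complex_norm_square by (simp add: mult.commute)
  finally show ?thesis .
qed

lemma L2_set_sq: "(L2_set g F)\<^sup>2 = (\<Sum>x\<in>F. (g x)\<^sup>2)"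
  by (simp add: L2_set_def sum_nonneg)

lemma op_bound_mono: "op_bound C T \<Longrightarrow> C \<le> D \<Longrightarrow> op_bound D T"
  unfolding op_bound_def
  by (meson L2_set_nonneg mult_right_mono order_trans)

lemma op_bound_0: "op_bound 0 0"
  by (simp add: op_bound_def op_form_def)

lemma op_bound_add:
  assumes "op_bound C S" "op_bound D T" shows "op_bound (C + D) (S + T)"
  using assms unfolding op_bound_def op_form_add
  by (smt (verit) distrib_right norm_triangle_ineq)

lemma op_bound_diff:
  assumes "op_bound C S" "op_bound D T" shows "op_bound (C + D) (S - T)"
  using assms unfolding op_bound_def op_form_diff
  by (smt (verit) distrib_right norm_triangle_ineq4)

lemma op_bound_scale:
  assumes "op_bound C T" shows "op_bound (cmod c * C) (op_scale c T)"
  using assms unfolding op_bound_def op_form_scale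
  by (simp add: norm_mult mult.assoc mult_left_mono)

lemma op_bound_adj: "op_bound C T \<Longrightarrow> op_bound C (op_adj T)"
  unfolding op_bound_def op_form_adj complex_mod_cnj
  by (subst mult.assoc, subst mult.commute[of "L2_set _ _"], subst mult.assoc[symmetric]) blast

lemma op_bound_sum:
  assumes "\<And>i. i \<in> I \<Longrightarrow> op_bound (C i) (T i)"
  shows "op_bound (sum C I) (sum T I)"
  using assms by (induction I rule: infinite_finite_induct) (auto simp: op_bound_0 op_bound_add)

lemma op_norm_le: "op_bound C T \<Longrightarrow> op_norm T \<le> C"
  unfolding op_norm_def by (rule cInf_lower) (auto simp: bdd_below_def op_bound_def)

text \<open>Each inequality in \<open>op_bound\<close> is a closed condition on the constant, so the
  infimum of a nonempty set of bounds is again a bound.\<close>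

lemma op_bound_op_norm:
  assumes "op_bound C T" shows "op_bound (op_norm T) T"
proof -
  have ne: "{C. op_bound C T} \<noteq> {}" using assms by auto
  show ?thesis
  proof (rule op_boundI)
    show "0 \<le> op_norm T" unfolding op_norm_def
      by (rule cInf_greatest[OF ne]) (auto simp: op_bound_def)
  next
    fix F :: "'a set" and \<xi> \<eta> assume F: "finite F"
    let ?a = "L2_set (\<lambda>x. cmod (\<xi> x)) F * L2_set (\<lambda>x. cmod (\<eta> x)) F"
    have *: "cmod (op_form T F \<xi> \<eta>) \<le> D * ?a" if "op_bound D T" for D
      using that F by (auto simp: op_bound_def mult.assoc)
    have "cmod (op_form T F \<xi> \<eta>) \<le> op_norm T * ?a"
    proof (cases "?a = 0")
      case True
      then show ?thesis using *[OF assms] by (metis mult_zero_right)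
    next
      case False
      then have a: "?a > 0" by (metis L2_set_nonneg mult_nonneg_nonneg less_eq_real_def)
      have "cmod (op_form T F \<xi> \<eta>) / ?a \<le> op_norm T"
        unfolding op_norm_def by (rule cInf_greatest[OF ne]) (use * a in \<open>auto simp: pos_divide_le_eq\<close>)
      then show ?thesis using a by (simp add: pos_divide_le_eq)
    qed
    then show "cmod (op_form T F \<xi> \<eta>) \<le> op_norm T * L2_set (\<lambda>x. cmod (\<xi> x)) F * L2_set (\<lambda>x. cmod (\<eta> x)) F"
      by (simp add: mult.assoc)
  qed
qed

lemma op_bound_entry:
  assumes "op_bound C T" shows "cmod (T x y) \<le> C"
  using op_bound_rect[OF assms, of "{x}" "{y}" "\<lambda>_. 1" "\<lambda>_. 1"] by (simp add: L2_set_def)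

subsection \<open>Positive forms\<close>

lemma op_form_comb:
  "op_form T F (\<lambda>x. \<xi> x + c * \<eta> x) (\<lambda>x. \<xi> x + c * \<eta> x) =
   op_form T F \<xi> \<xi> + c * op_form T F \<xi> \<eta> + cnj c * op_form T F \<eta> \<xi> + cnj c * c * op_form T F \<eta> \<eta>"
  by (simp add: op_form_def sum_distrib_left sum.distrib[symmetric] algebra_simps)

lemma op_pos_form:
  assumes "op_pos T" "finite F"
  shows "0 \<le> Re (op_form T F \<xi> \<xi>)" "Im (op_form T F \<xi> \<xi>) = 0"
  using assms by (auto simp: op_pos_def complex_nonneg_Reals_iff)

text \<open>Polarization: the form is real on the diagonal, in particular at \<xi> + \<eta> and at
  \<xi> + i \<eta>, and these two facts fix the imaginary and the real part of the claim.\<close>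

lemma op_pos_form_cnj:
  assumes "op_pos T" "finite F"
  shows "op_form T F \<eta> \<xi> = cnj (op_form T F \<xi> \<eta>)"
proof -
  have c: "Im (c * op_form T F \<xi> \<eta> + cnj c * op_form T F \<eta> \<xi>) = 0" for c
  proof -
    have "cnj c * c = of_real ((cmod c)\<^sup>2)"
      unfolding complex_norm_square by (rule mult.commute)
    then show ?thesis
      using op_pos_form(2)[OF assms, of "\<lambda>x. \<xi> x + c * \<eta> x"] op_pos_form(2)[OF assms, of \<xi>]
        op_pos_form(2)[OF assms, of \<eta>]
      unfolding op_form_comb by simp
  qed
  from c[of 1] c[of \<i>] show ?thesis by (simp add: complex_eq_iff)
qed

lemma op_pos_cauchy_schwarz:
  assumes "op_pos T" "finite F"
  shows "(cmod (op_form T F \<xi> \<eta>))\<^sup>2 \<le> Re (op_form T F \<xi> \<xi>) * Re (op_form T F \<eta> \<eta>)"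
proof -
  define q where "q = op_form T F \<xi> \<eta>"
  define a where "a = Re (op_form T F \<xi> \<xi>)"
  define b where "b = Re (op_form T F \<eta> \<eta>)"
  have ab: "0 \<le> a" "0 \<le> b" using op_pos_form[OF assms] by (auto simp: a_def b_def)
  have *: "0 \<le> a - 2 * t * (cmod q)\<^sup>2 + t\<^sup>2 * (cmod q)\<^sup>2 * b" for t :: real
  proof -
    \<comment> \<open>The phase of \<open>q\<close> is absorbed into the scalar, so that the
      expansion becomes a real quadratic polynomial in \<open>t\<close>.\<close>
    define c where "c = - of_real t * cnj q"
    have "0 \<le> Re (op_form T F \<xi> \<xi> + c * q + cnj c * cnj q + cnj c * c * op_form T F \<eta> \<eta>)"
      using op_pos_form(1)[OF assms, of "\<lambda>x. \<xi> x + c * \<eta> x"]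
      unfolding op_form_comb op_pos_form_cnj[OF assms, of \<eta> \<xi>] q_def .
    moreover have qq: "of_real (cmod q) * of_real (cmod q) = q * cnj q"
      by (simp add: complex_norm_square[symmetric] power2_eq_square[symmetric])
    moreover have "c * q = of_real (- t * (cmod q)\<^sup>2)" "cnj c * cnj q = of_real (- t * (cmod q)\<^sup>2)"
      "cnj c * c = of_real (t\<^sup>2 * (cmod q)\<^sup>2)"
      by (simp_all add: c_def power2_eq_square qq)
    ultimately show ?thesis by (simp add: a_def b_def)
  qed
  have "(cmod q)\<^sup>2 \<le> a * b"
  proof (cases "b = 0")
    case True
    show ?thesis
    proof (cases "q = 0")
      case False
      \<comment> \<open>For \<open>b = 0\<close> the polynomial is linear in \<open>t\<close>, and
        this \<open>t\<close> gives it the value -1.\<close>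
      then show ?thesis using *[of "(a + 1) / (2 * (cmod q)\<^sup>2)"] True by simp
    qed (use ab in simp)
  next
    case False
    with ab have b: "b > 0" by simp
    have "0 \<le> a - (cmod q)\<^sup>2 / b"
      using *[of "1 / b"] b by (simp add: power2_eq_square field_simps)
    then show ?thesis using b by (simp add: field_simps)
  qed
  then show ?thesis by (simp add: q_def a_def b_def)
qed

lemma op_pos_hermitian:
  assumes "op_pos T" shows "T x y = cnj (T y x)"
proof -
  have *: "op_form T {x, y} (\<lambda>z. if z = u then 1 else 0) (\<lambda>z. if z = v then 1 else 0) = T u v"
    if "u \<in> {x, y}" "v \<in> {x, y}" for u v
  proof -
    have "op_form T {x, y} (\<lambda>z. if z = u then 1 else 0) (\<lambda>z. if z = v then 1 else 0) =
        (\<Sum>z\<in>{x, y}. \<Sum>w\<in>{x, y}. if w = v then (if z = u then T z w else 0) else 0)"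
      unfolding op_form_def by (intro sum.cong) auto
    also have "\<dots> = (\<Sum>z\<in>{x, y}. if z = u then T z v else 0)"
      by (intro sum.cong refl, subst sum.delta) (use that in auto)
    also have "\<dots> = T u v"
      by (subst sum.delta) (use that in auto)
    finally show ?thesis .
  qed
  show ?thesis
    using op_pos_form_cnj[OF assms, of "{x, y}" "\<lambda>z. if z = x then 1 else 0" "\<lambda>z. if z = y then 1 else 0"]
    by (simp only: * insertI1 insertI2 finite.intros)
qed

text \<open>For a positive operator the diagonal values control the norm without the loss of a
  factor in polarization, by Cauchy-Schwarz for the form of \<open>T\<close> itself.\<close>

lemma op_pos_bound:
  assumes "op_pos T" "0 \<le> C"
    and le: "\<And>F \<xi>. finite F \<Longrightarrow> Re (op_form T F \<xi> \<xi>) \<le> C * (\<Sum>x\<in>F. (cmod (\<xi> x))\<^sup>2)"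
  shows "op_bound C T"
proof (rule op_boundI[OF \<open>0 \<le> C\<close>])
  fix F \<xi> \<eta> assume F: "finite (F :: 'a set)"
  have "(cmod (op_form T F \<xi> \<eta>))\<^sup>2 \<le> Re (op_form T F \<xi> \<xi>) * Re (op_form T F \<eta> \<eta>)"
    by (rule op_pos_cauchy_schwarz[OF assms(1) F])
  also have "\<dots> \<le> (C * (\<Sum>x\<in>F. (cmod (\<xi> x))\<^sup>2)) * (C * (\<Sum>x\<in>F. (cmod (\<eta> x))\<^sup>2))"
    by (intro mult_mono le F) (use assms op_pos_form[OF assms(1) F] in \<open>auto intro!: mult_nonneg_nonneg sum_nonneg\<close>)
  also have "\<dots> = (C * L2_set (\<lambda>x. cmod (\<xi> x)) F * L2_set (\<lambda>x. cmod (\<eta> x)) F)\<^sup>2"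
    by (simp add: power_mult_distrib L2_set_sq power2_eq_square[of C])
  finally show "cmod (op_form T F \<xi> \<eta>) \<le> C * L2_set (\<lambda>x. cmod (\<xi> x)) F * L2_set (\<lambda>x. cmod (\<eta> x)) F"
    by (rule power2_le_imp_le) (use assms in auto)
qed

lemma op_form_herm_real:
  assumes "\<And>x y. T x y = cnj (T y x)"
  shows "Im (op_form T F \<xi> \<xi>) = 0"
proof -
  have "op_adj T = T" by (intro ext) (simp add: op_adj_def assms[symmetric])
  then have "cnj (op_form T F \<xi> \<xi>) = op_form T F \<xi> \<xi>" by (simp add: op_form_adj[symmetric])
  then show ?thesis by (simp add: complex_eq_iff)
qed

subsection \<open>Products\<close>

text \<open>Testing the form against the vector \<open>T \<eta>\<close>, cut down to
  \<open>G\<close>, gives N^2 <= C N |\<eta>|, and one factor N cancels. As the bound does not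
  depend on \<open>G\<close>, columns are square summable.\<close>

lemma column_l2:
  assumes "op_bound C T" "finite F" "finite G"
  shows "L2_set (\<lambda>z. cmod (\<Sum>y\<in>F. T z y * \<eta> y)) G \<le> C * L2_set (\<lambda>y. cmod (\<eta> y)) F"
proof -
  define v where "v z = (\<Sum>y\<in>F. T z y * \<eta> y)" for z
  define N where "N = L2_set (\<lambda>z. cmod (v z)) G"
  have "of_real (N\<^sup>2) = (\<Sum>z\<in>G. cnj (v z) * v z)"
    unfolding N_def L2_set_sq of_real_sum complex_norm_square by (simp add: mult.commute)
  also have "\<dots> = (\<Sum>z\<in>G. \<Sum>y\<in>F. cnj (v z) * T z y * \<eta> y)"
    by (intro sum.cong refl) (simp add: v_def sum_distrib_left mult.assoc)
  finally have "N\<^sup>2 = cmod (\<Sum>z\<in>G. \<Sum>y\<in>F. cnj (v z) * T z y * \<eta> y)"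
    by (metis norm_of_real abs_power2)
  also have "\<dots> \<le> C * N * L2_set (\<lambda>y. cmod (\<eta> y)) F"
    unfolding N_def by (rule op_bound_rect) (use assms in auto)
  finally have *: "N * N \<le> N * (C * L2_set (\<lambda>y. cmod (\<eta> y)) F)"
    by (simp add: power2_eq_square algebra_simps)
  have "N \<le> C * L2_set (\<lambda>y. cmod (\<eta> y)) F"
  proof (cases "N = 0")
    case True
    then show ?thesis using op_boundD[OF assms(1)] by simp
  next
    case False
    then have "N > 0" unfolding N_def by (simp add: order_less_le)
    with * show ?thesis by simp
  qed
  then show ?thesis by (simp add: N_def v_def)
qed

lemma row_l2:
  assumes "op_bound C T" "finite F" "finite G"
  shows "L2_set (\<lambda>z. cmod (\<Sum>x\<in>F. cnj (\<xi> x) * T x z)) G \<le> C * L2_set (\<lambda>y. cmod (\<xi> y)) F"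
proof -
  have "cmod (\<Sum>x\<in>F. cnj (\<xi> x) * T x z) = cmod (\<Sum>x\<in>F. op_adj T z x * \<xi> x)" for z
    by (subst complex_mod_cnj[symmetric]) (simp add: op_adj_def mult.commute)
  then show ?thesis using column_l2[OF op_bound_adj[OF assms(1)] assms(2,3)] by simp
qed

lemma l2_summable:
  fixes v :: "'z \<Rightarrow> complex"
  assumes "\<And>G. finite G \<Longrightarrow> L2_set (\<lambda>z. cmod (v z)) G \<le> K"
  shows "(\<lambda>z. (cmod (v z))\<^sup>2) summable_on UNIV"
proof (rule nonneg_bdd_above_summable_on)
  show "bdd_above (sum (\<lambda>z. (cmod (v z))\<^sup>2) ` {F. F \<subseteq> UNIV \<and> finite F})"
  proof (rule bdd_aboveI2)
    fix F :: "'z set" assume "F \<in> {F. F \<subseteq> UNIV \<and> finite F}"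
    then have "(L2_set (\<lambda>z. cmod (v z)) F)\<^sup>2 \<le> K\<^sup>2"
      using assms by (intro power_mono) auto
    then show "(\<Sum>z\<in>F. (cmod (v z))\<^sup>2) \<le> K\<^sup>2" by (simp add: L2_set_sq)
  qed
qed auto

lemma l2_product_summable:
  fixes u v :: "'z \<Rightarrow> complex"
  assumes "(\<lambda>z. (cmod (u z))\<^sup>2) summable_on UNIV" "(\<lambda>z. (cmod (v z))\<^sup>2) summable_on UNIV"
  shows "(\<lambda>z. u z * v z) summable_on UNIV"
  by (rule abs_summable_summable, rule abs_summable_product)
    (use assms in \<open>simp_all add: norm_mult power2_eq_square\<close>)

text \<open>Rows of \<open>S\<close> and columns of \<open>T\<close> are square summable. This
  guards every use of \<open>op_mult\<close>, since \<open>infsum\<close> takes the value 0 where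
  the series fails to be summable.\<close>

lemma op_mult_summable:
  assumes "op_bound C S" "op_bound D T"
  shows "(\<lambda>z. S x z * T z y) summable_on UNIV"
proof (rule l2_product_summable)
  show "(\<lambda>z. (cmod (S x z))\<^sup>2) summable_on UNIV"
    using row_l2[OF assms(1), of "{x}" _ "\<lambda>_. 1"] by (intro l2_summable) simp
  show "(\<lambda>z. (cmod (T z y))\<^sup>2) summable_on UNIV"
    using column_l2[OF assms(2), of "{y}" _ "\<lambda>_. 1"] by (intro l2_summable) simp
qed

lemma op_mult_has_sum:
  assumes "op_bound C S" "op_bound D T"
  shows "((\<lambda>z. S x z * T z y) has_sum op_mult S T x y) UNIV"
  unfolding op_mult_def by (rule has_sum_infsum) (rule op_mult_summable[OF assms])

lemma has_sum_sum:
  fixes f :: "'i \<Rightarrow> 'z \<Rightarrow> 'b::topological_comm_monoid_add"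
  assumes "\<And>i. i \<in> I \<Longrightarrow> (f i has_sum s i) A"
  shows "((\<lambda>z. \<Sum>i\<in>I. f i z) has_sum (\<Sum>i\<in>I. s i)) A"
  using assms by (induction I rule: infinite_finite_induct) (auto intro!: has_sum_add)

lemma op_form_mult:
  assumes "op_bound C S" "op_bound D T"
  shows "((\<lambda>z. (\<Sum>x\<in>F. cnj (\<xi> x) * S x z) * (\<Sum>y\<in>F. T z y * \<eta> y)) has_sum op_form (op_mult S T) F \<xi> \<eta>) UNIV"
proof -
  have "((\<lambda>z. \<Sum>x\<in>F. \<Sum>y\<in>F. (cnj (\<xi> x) * (S x z * T z y)) * \<eta> y) has_sum op_form (op_mult S T) F \<xi> \<eta>) UNIV"
    unfolding op_form_def
    by (intro has_sum_sum has_sum_cmult_left has_sum_cmult_right op_mult_has_sum[OF assms])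
  then show ?thesis by (simp add: sum_product mult.assoc)
qed

lemma has_sum_norm_le:
  fixes f :: "'z \<Rightarrow> 'b::real_normed_vector"
  assumes "(f has_sum s) UNIV" "\<And>G. finite G \<Longrightarrow> norm (sum f G) \<le> K"
  shows "norm s \<le> K"
proof (rule tendsto_upperbound)
  show "((\<lambda>G. norm (sum f G)) \<longlongrightarrow> norm s) (finite_subsets_at_top UNIV)"
    using assms(1) unfolding has_sum_def by (rule tendsto_norm)
  show "\<forall>\<^sub>F G in finite_subsets_at_top UNIV. norm (sum f G) \<le> K"
    using assms(2) by (auto intro: eventually_finite_subsets_at_top_weakI)
qed simp

lemma op_bound_mult:
  fixes S T :: "'z oper"
  assumes S: "op_bound C S" and T: "op_bound D T"
  shows "op_bound (C * D) (op_mult S T)"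
proof (rule op_boundI)
  note C = op_boundD[OF S] and D = op_boundD[OF T]
  show "0 \<le> C * D" using C D by simp
  fix F :: "'z set" and \<xi> \<eta> assume F: "finite F"
  show "cmod (op_form (op_mult S T) F \<xi> \<eta>) \<le> C * D * L2_set (\<lambda>x. cmod (\<xi> x)) F * L2_set (\<lambda>x. cmod (\<eta> x)) F"
  proof (rule has_sum_norm_le[OF op_form_mult[OF S T]])
    fix G :: "'z set" assume G: "finite G"
    let ?u = "\<lambda>z. \<Sum>x\<in>F. cnj (\<xi> x) * S x z" and ?v = "\<lambda>z. \<Sum>y\<in>F. T z y * \<eta> y"
    have "cmod (\<Sum>z\<in>G. ?u z * ?v z) \<le> (\<Sum>z\<in>G. \<bar>cmod (?u z)\<bar> * \<bar>cmod (?v z)\<bar>)"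
      by (rule sum_norm_le) (simp add: norm_mult)
    also have "\<dots> \<le> L2_set (\<lambda>z. cmod (?u z)) G * L2_set (\<lambda>z. cmod (?v z)) G"
      by (rule L2_set_mult_ineq)
    also have "\<dots> \<le> (C * L2_set (\<lambda>x. cmod (\<xi> x)) F) * (D * L2_set (\<lambda>x. cmod (\<eta> x)) F)"
      by (intro mult_mono row_l2[OF S F G] column_l2[OF T F G]) (use C in auto)
    finally show "cmod (\<Sum>z\<in>G. ?u z * ?v z) \<le> C * D * L2_set (\<lambda>x. cmod (\<xi> x)) F * L2_set (\<lambda>x. cmod (\<eta> x)) F"
      by (simp add: algebra_simps)
  qed
qed

lemma op_mult_diff_left:
  assumes "op_bound C S" "op_bound C' S'" "op_bound D T"
  shows "op_mult (S - S') T = op_mult S T - op_mult S' T"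
proof (intro ext)
  fix x y
  have "((\<lambda>z. S x z * T z y + - (S' x z * T z y)) has_sum op_mult S T x y + - op_mult S' T x y) UNIV"
    by (intro has_sum_add has_sum_uminus[THEN iffD2]) (simp_all add: op_mult_has_sum[OF assms(1,3)] op_mult_has_sum[OF assms(2,3)])
  then show "op_mult (S - S') T x y = (op_mult S T - op_mult S' T) x y"
    unfolding op_mult_def[of "S - S'"] by (simp add: infsumI algebra_simps)
qed

lemma op_form_gram:
  assumes "op_bound C S"
  shows "((\<lambda>z. (cmod (\<Sum>y\<in>F. S z y * \<eta> y))\<^sup>2) has_sum Re (op_form (op_mult (op_adj S) S) F \<eta> \<eta>)) UNIV"
    and "Im (op_form (op_mult (op_adj S) S) F \<eta> \<eta>) = 0"
proof -
  have "(\<Sum>x\<in>F. cnj (\<eta> x) * op_adj S x z) = cnj (\<Sum>y\<in>F. S z y * \<eta> y)" for z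
    by (simp add: op_adj_def mult.commute)
  then have "(\<Sum>x\<in>F. cnj (\<eta> x) * op_adj S x z) * (\<Sum>y\<in>F. S z y * \<eta> y) = of_real ((cmod (\<Sum>y\<in>F. S z y * \<eta> y))\<^sup>2)" for z
    unfolding complex_norm_square by (simp only: mult.commute)
  then have *: "((\<lambda>z. of_real ((cmod (\<Sum>y\<in>F. S z y * \<eta> y))\<^sup>2)) has_sum op_form (op_mult (op_adj S) S) F \<eta> \<eta>) UNIV"
    using op_form_mult[OF op_bound_adj[OF assms] assms, where F = F and \<xi> = \<eta> and \<eta> = \<eta>] by simp
  show "((\<lambda>z. (cmod (\<Sum>y\<in>F. S z y * \<eta> y))\<^sup>2) has_sum Re (op_form (op_mult (op_adj S) S) F \<eta> \<eta>)) UNIV"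
    using has_sum_Re[OF *] by simp
  show "Im (op_form (op_mult (op_adj S) S) F \<eta> \<eta>) = 0"
    using has_sum_unique[OF has_sum_Im[OF *], of 0] by simp
qed

lemma op_pos_gram:
  assumes "op_bound C S"
  shows "op_pos (op_mult (op_adj S) S)"
  unfolding op_pos_def complex_nonneg_Reals_iff
  by (auto intro!: has_sum_nonneg[OF op_form_gram(1)[OF assms]] op_form_gram(2)[OF assms])

text \<open>The form of S*S at \<eta> is |S \<eta>|^2, and Cauchy-Schwarz turns a bound for |S
  \<eta>| into one for the form of \<open>S\<close>. The a priori bound \<open>D\<close> makes the
  product S*S converge; its size does not enter the result.\<close>

lemma op_bound_of_gram:
  fixes S :: "'z oper"
  assumes "op_bound D S" "0 \<le> C"
    and le: "\<And>F \<eta>. finite F \<Longrightarrow> Re (op_form (op_mult (op_adj S) S) F \<eta> \<eta>) \<le> C\<^sup>2 * (\<Sum>y\<in>F. (cmod (\<eta> y))\<^sup>2)"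
  shows "op_bound C S"
proof (rule op_boundI[OF assms(2)])
  fix F :: "'z set" and \<xi> \<eta> assume F: "finite F"
  let ?v = "\<lambda>z. \<Sum>y\<in>F. S z y * \<eta> y"
  have "(L2_set (\<lambda>z. cmod (?v z)) F)\<^sup>2 \<le> Re (op_form (op_mult (op_adj S) S) F \<eta> \<eta>)"
    unfolding L2_set_sq by (rule finite_sum_le_has_sum[OF op_form_gram(1)[OF assms(1)]]) (use F in auto)
  also have "\<dots> \<le> (C * L2_set (\<lambda>x. cmod (\<eta> x)) F)\<^sup>2"
    using le[OF F] by (simp add: power_mult_distrib L2_set_sq)
  finally have *: "L2_set (\<lambda>z. cmod (?v z)) F \<le> C * L2_set (\<lambda>x. cmod (\<eta> x)) F"
    by (rule power2_le_imp_le) (use assms in simp)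
  have "cmod (op_form S F \<xi> \<eta>) = cmod (\<Sum>x\<in>F. cnj (\<xi> x) * ?v x)"
    by (simp add: op_form_def sum_distrib_left mult.assoc)
  also have "\<dots> \<le> (\<Sum>x\<in>F. \<bar>cmod (\<xi> x)\<bar> * \<bar>cmod (?v x)\<bar>)"
    by (rule sum_norm_le) (simp add: norm_mult)
  also have "\<dots> \<le> L2_set (\<lambda>x. cmod (\<xi> x)) F * L2_set (\<lambda>x. cmod (?v x)) F"
    by (rule L2_set_mult_ineq)
  also have "\<dots> \<le> L2_set (\<lambda>x. cmod (\<xi> x)) F * (C * L2_set (\<lambda>x. cmod (\<eta> x)) F)"
    by (intro mult_left_mono *) auto
  finally show "cmod (op_form S F \<xi> \<eta>) \<le> C * L2_set (\<lambda>x. cmod (\<xi> x)) F * L2_set (\<lambda>x. cmod (\<eta> x)) F"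
    by (simp add: algebra_simps)
qed

text \<open>With \<open>\<zeta> = d\<^sup>* \<xi>\<close>, a vector of infinite support, the form of \<open>dXd\<^sup>*\<close> at \<open>\<xi>\<close> is
  approximated by the forms of \<open>X\<close> at the truncations of \<open>\<zeta>\<close> to finite sets.\<close>

lemma op_pos_conj:
  fixes X d :: "'z oper"
  assumes X: "op_pos X" "op_bound C X" and d: "op_bound D d"
  shows "op_pos (op_conj d X)"
  unfolding op_pos_def
proof (intro allI impI)
  fix F :: "'z set" and \<xi> assume F: "finite F"
  define \<zeta> where "\<zeta> z = cnj (\<Sum>x\<in>F. cnj (\<xi> x) * d x z)" for z
  define K where "K = D * L2_set (\<lambda>y. cmod (\<xi> y)) F"
  have K: "L2_set (\<lambda>z. cmod (\<zeta> z)) G \<le> K" if "finite G" for G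
    using row_l2[OF d F that, of \<xi>] by (simp only: \<zeta>_def complex_mod_cnj K_def)
  have K0: "0 \<le> K" using K[of "{}"] by simp
  define N where "N = infsum (\<lambda>z. (cmod (\<zeta> z))\<^sup>2) UNIV"
  have N: "((\<lambda>z. (cmod (\<zeta> z))\<^sup>2) has_sum N) UNIV"
    unfolding N_def by (rule has_sum_infsum) (rule l2_summable[OF K])
  have dX: "op_bound (D * C) (op_mult d X)" by (rule op_bound_mult[OF d X(2)])
  define s where "s w = (\<Sum>x\<in>F. cnj (\<xi> x) * op_mult d X x w)" for w
  have s: "((\<lambda>z. cnj (\<zeta> z) * X z w) has_sum s w) UNIV" for w
  proof -
    have "((\<lambda>z. \<Sum>x\<in>F. cnj (\<xi> x) * (d x z * X z w)) has_sum s w) UNIV"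
      unfolding s_def by (intro has_sum_sum has_sum_cmult_right op_mult_has_sum[OF d X(2)])
    then show ?thesis by (simp add: \<zeta>_def sum_distrib_right mult.assoc)
  qed
  have \<zeta>2: "\<zeta> w = (\<Sum>y\<in>F. op_adj d w y * \<xi> y)" for w
    by (simp add: \<zeta>_def op_adj_def mult.commute)
  have form: "((\<lambda>w. s w * \<zeta> w) has_sum op_form (op_conj d X) F \<xi> \<xi>) UNIV"
    unfolding s_def \<zeta>2 op_conj_def by (rule op_form_mult[OF dX op_bound_adj[OF d]])
  define R where "R G' G = (\<Sum>z\<in>G'. \<Sum>w\<in>G. cnj (\<zeta> z) * X z w * \<zeta> w)" for G' G
  have R: "((\<lambda>G'. R G' G) \<longlongrightarrow> (\<Sum>w\<in>G. s w * \<zeta> w)) (finite_subsets_at_top UNIV)" for G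
  proof -
    have "((\<lambda>z. \<Sum>w\<in>G. (cnj (\<zeta> z) * X z w) * \<zeta> w) has_sum (\<Sum>w\<in>G. s w * \<zeta> w)) UNIV"
      by (intro has_sum_sum has_sum_cmult_left s)
    then show ?thesis by (simp add: has_sum_def R_def)
  qed
  \<comment> \<open>The rows run to infinity first, while the columns stay in \<open>G\<close>. What
    is missing from the square truncation is the block of rows in G' - G, controlled by the tail of
    the square summable vector \<zeta>.\<close>
  have le: "cmod ((\<Sum>w\<in>G. s w * \<zeta> w) - R G G) \<le> C * sqrt (N - (\<Sum>z\<in>G. (cmod (\<zeta> z))\<^sup>2)) * K" if G: "finite G" for G
  proof (rule tendsto_upperbound)
    show "((\<lambda>G'. cmod (R G' G - R G G)) \<longlongrightarrow> cmod ((\<Sum>w\<in>G. s w * \<zeta> w) - R G G)) (finite_subsets_at_top UNIV)"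
      by (intro tendsto_intros R)
    show "\<forall>\<^sub>F G' in finite_subsets_at_top UNIV. cmod (R G' G - R G G) \<le> C * sqrt (N - (\<Sum>z\<in>G. (cmod (\<zeta> z))\<^sup>2)) * K"
      unfolding eventually_finite_subsets_at_top
    proof (intro exI[of _ G] conjI allI impI)
      fix G' assume G': "finite G' \<and> G \<subseteq> G' \<and> G' \<subseteq> UNIV"
      have 1: "R G' G - R G G = R (G' - G) G"
        unfolding R_def using G' by (simp add: sum_diff)
      have "(\<Sum>z\<in>G'. (cmod (\<zeta> z))\<^sup>2) \<le> N"
        by (rule finite_sum_le_has_sum[OF N]) (use G' in auto)
      then have a: "L2_set (\<lambda>z. cmod (\<zeta> z)) (G' - G) \<le> sqrt (N - (\<Sum>z\<in>G. (cmod (\<zeta> z))\<^sup>2))"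
        unfolding L2_set_def using G' by (simp add: sum_diff)
      have "cmod (R (G' - G) G) \<le> C * L2_set (\<lambda>z. cmod (\<zeta> z)) (G' - G) * L2_set (\<lambda>z. cmod (\<zeta> z)) G"
        unfolding R_def by (rule op_bound_rect[OF X(2)]) (use G' G in auto)
      also have "\<dots> \<le> C * sqrt (N - (\<Sum>z\<in>G. (cmod (\<zeta> z))\<^sup>2)) * K"
        by (intro mult_mono mult_left_mono a K[OF G] mult_nonneg_nonneg op_boundD[OF X(2)] order_trans[OF L2_set_nonneg a] L2_set_nonneg)
      finally show "cmod (R G' G - R G G) \<le> C * sqrt (N - (\<Sum>z\<in>G. (cmod (\<zeta> z))\<^sup>2)) * K"
        unfolding 1 .
    qed (use G in auto)
  qed simp
  have "((\<lambda>G. C * sqrt (N - (\<Sum>z\<in>G. (cmod (\<zeta> z))\<^sup>2)) * K) \<longlongrightarrow> C * sqrt (N - N) * K) (finite_subsets_at_top UNIV)"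
    using N unfolding has_sum_def by (intro tendsto_intros)
  then have 0: "((\<lambda>G. C * sqrt (N - (\<Sum>z\<in>G. (cmod (\<zeta> z))\<^sup>2)) * K) \<longlongrightarrow> 0) (finite_subsets_at_top UNIV)"
    by simp
  have "((\<lambda>G. (\<Sum>w\<in>G. s w * \<zeta> w) - R G G) \<longlongrightarrow> 0) (finite_subsets_at_top UNIV)"
    by (rule Lim_null_comparison[OF _ 0]) (auto intro: eventually_finite_subsets_at_top_weakI le)
  then have "((\<lambda>G. (\<Sum>w\<in>G. s w * \<zeta> w) - ((\<Sum>w\<in>G. s w * \<zeta> w) - R G G)) \<longlongrightarrow> op_form (op_conj d X) F \<xi> \<xi> - 0)
      (finite_subsets_at_top UNIV)"
    using form unfolding has_sum_def by (intro tendsto_diff)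
  then have lim: "((\<lambda>G. R G G) \<longlongrightarrow> op_form (op_conj d X) F \<xi> \<xi>) (finite_subsets_at_top UNIV)"
    by simp
  show "op_form (op_conj d X) F \<xi> \<xi> \<in> \<real>\<^sub>\<ge>\<^sub>0"
  proof (rule Lim_in_closed_set[OF closed_nonneg_Reals_complex _ _ lim])
    show "\<forall>\<^sub>F G in finite_subsets_at_top UNIV. R G G \<in> \<real>\<^sub>\<ge>\<^sub>0"
      using X(1) unfolding op_pos_def op_form_def R_def
      by (auto intro: eventually_finite_subsets_at_top_weakI)
  qed simp
qed

section \<open>C*-algebras and their representations\<close>

lemma scaleC_minus_one: "(-1::complex) *\<^sub>C x = - (x::'a::unital_cstar_algebra)"
  using scaleR_scaleC[of "-1" x] by simp

lemma star_zero [simp]: "star (0::'a::unital_cstar_algebra) = 0"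
  using star_add[of "0::'a" 0] by simp

lemma star_minus: "star (- x) = - star (x::'a::unital_cstar_algebra)"
  using star_add[of x "- x"] by (simp add: add_eq_0_iff)

lemma star_diff: "star (x - y) = star x - star (y::'a::unital_cstar_algebra)"
  using star_add[of x "- y"] by (simp add: star_minus)

lemma star_one [simp]: "star (1::'a::unital_cstar_algebra) = 1"
  by (metis mult.right_neutral star_mult star_star mult_1)

lemma star_scaleR: "star (r *\<^sub>R x) = r *\<^sub>R star (x::'a::unital_cstar_algebra)"
  by (simp add: scaleR_scaleC star_scaleC)

lemma star_sum: "star (sum f I) = (\<Sum>i\<in>I. star (f i :: 'a::unital_cstar_algebra))"
  by (induction I rule: infinite_finite_induct) (auto simp: star_add)

lemma norm_star [simp]: "norm (star x) = norm (x::'a::unital_cstar_algebra)"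
proof -
  have le: "norm x \<le> norm (star x)" for x :: 'a
  proof (cases "x = 0")
    case False
    have "norm x * norm x \<le> norm (star x) * norm x"
      using norm_mult_ineq[of "star x" x] cstar_identity[of x] by (simp add: power2_eq_square)
    then show ?thesis using False by simp
  qed simp
  show ?thesis using le[of x] le[of "star x"] by (simp add: star_star)
qed

lemma norm_selfadjoint_square:
  "star x = x \<Longrightarrow> norm (x * x) = (norm (x::'a::unital_cstar_algebra))\<^sup>2"
  using cstar_identity[of x] by simp

lemma bounded_linear_star: "bounded_linear (star :: 'a::unital_cstar_algebra \<Rightarrow> 'a)"
  by (rule bounded_linear_intro[of _ 1]) (auto simp: star_add star_scaleR)

lemma star_power: "star (x ^ n) = star (x::'a::unital_cstar_algebra) ^ n"
  by (induction n) (auto simp: star_mult power_commutes)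

subsection \<open>The square root\<close>

text \<open>The coefficients of the binomial series of \<open>sqrt (1 - t)\<close>, which converges absolutely
  also for \<open>\<bar>t\<bar> = 1\<close>.\<close>

definition sqrt_coeff :: "nat \<Rightarrow> real" where
  "sqrt_coeff n = (1/2 gchoose n) * (-1) ^ n"

definition sqrt_one_minus :: "'a::unital_cstar_algebra \<Rightarrow> 'a" where
  "sqrt_one_minus x = (\<Sum>n. sqrt_coeff n *\<^sub>R x ^ n)"

lemma sqrt_coeff_0: "sqrt_coeff 0 = 1"
  by (simp add: sqrt_coeff_def)

text \<open>All coefficients after the first have the same sign, so absolute convergence at t = 1 is
  a matter of bounded partial sums.\<close>

lemma sqrt_coeff_Suc: "sqrt_coeff (Suc n) \<le> 0"
proof -
  have "sqrt_coeff (Suc n) = pochhammer (-1/2) (Suc n) / fact (Suc n)"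
    unfolding sqrt_coeff_def gbinomial_pochhammer
    by (simp add: power_mult_distrib[symmetric] del: power_Suc)
  also have "\<dots> = - (pochhammer (1/2) n / (2 * fact (Suc n)))"
    by (simp add: pochhammer_rec)
  finally show ?thesis by (simp add: pochhammer_nonneg)
qed

text \<open>An alternating partial sum along a row of binomial coefficients is again a binomial
  coefficient, with 1/2 lowered to -1/2; its Pochhammer form shows the sign.\<close>

lemma sum_sqrt_coeff: "(\<Sum>k\<le>n. sqrt_coeff k) \<ge> 0"
proof -
  have "(\<Sum>k\<le>n. sqrt_coeff k) = (-1) ^ n * (1/2 - 1 gchoose n)"
    unfolding sqrt_coeff_def by (rule gbinomial_sum_lower_neg)
  also have "\<dots> = pochhammer (1/2) n / fact n"
    unfolding gbinomial_pochhammer by (simp add: power_mult_distrib[symmetric])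
  finally show ?thesis by (simp add: pochhammer_nonneg)
qed

text \<open>The partial sums start from the coefficient 1 and stay nonnegative, so the later
  coefficients can take away at most 1 in total. This constant becomes the estimate in
  \<open>norm_one_minus_sqrt\<close>.\<close>

lemma sum_abs_sqrt_coeff_Suc: "(\<Sum>k<n. \<bar>sqrt_coeff (Suc k)\<bar>) \<le> 1"
proof -
  have "(\<Sum>k<n. \<bar>sqrt_coeff (Suc k)\<bar>) = - (\<Sum>k<n. sqrt_coeff (Suc k))"
    by (simp add: sqrt_coeff_Suc sum_negf abs_of_nonpos)
  also have "\<dots> = 1 - (\<Sum>k\<le>n. sqrt_coeff k)"
    unfolding lessThan_Suc_atMost[symmetric] sum.lessThan_Suc_shift by (simp add: sqrt_coeff_0)
  also have "\<dots> \<le> 1" using sum_sqrt_coeff[of n] by simp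
  finally show ?thesis .
qed

lemma summable_abs_sqrt_coeff_Suc: "summable (\<lambda>k. \<bar>sqrt_coeff (Suc k)\<bar>)"
  by (rule summableI_nonneg_bounded[of _ 1]) (auto simp: sum_abs_sqrt_coeff_Suc)

text \<open>Vandermonde's identity with 1/2 + 1/2 = 1; the right side lists the coefficients of 1 -
  t.\<close>

lemma sqrt_coeff_convolution:
  "(\<Sum>i\<le>n. sqrt_coeff i * sqrt_coeff (n - i)) = (if n = 0 then 1 else if n = 1 then -1 else 0)"
proof -
  have "(\<Sum>i\<le>n. sqrt_coeff i * sqrt_coeff (n - i)) = (\<Sum>i\<le>n. (-1) ^ n * ((1/2 gchoose i) * (1/2 gchoose (n - i))))"
    by (intro sum.cong refl) (simp add: sqrt_coeff_def power_add[symmetric])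
  also have "\<dots> = (-1) ^ n * (1/2 + 1/2 gchoose n)"
    unfolding gbinomial_Vandermonde[symmetric] atLeast0AtMost by (simp add: sum_distrib_left)
  also have "\<dots> = (-1) ^ n * of_nat (1 choose n)"
    using binomial_gbinomial[of 1 n, where 'a = real] by simp
  also have "\<dots> = (if n = 0 then 1 else if n = 1 then -1 else 0)"
    by (cases n; cases "n - 1") auto
  finally show ?thesis .
qed

context
  fixes x :: "'a::unital_cstar_algebra"
  assumes x: "norm x \<le> 1"
begin

lemma norm_sqrt_term: "norm (sqrt_coeff n *\<^sub>R x ^ n) \<le> \<bar>sqrt_coeff n\<bar>"
proof -
  have "norm (x ^ n) \<le> 1"
    by (rule order_trans[OF norm_power_ineq]) (simp add: x power_le_one)
  then show ?thesis by (simp add: mult_left_le)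
qed

lemma summable_norm_sqrt: "summable (\<lambda>n. norm (sqrt_coeff n *\<^sub>R x ^ n))"
proof (rule summable_comparison_test')
  show "summable (\<lambda>n. \<bar>sqrt_coeff n\<bar>)"
    using summable_abs_sqrt_coeff_Suc by (subst summable_Suc_iff[symmetric])
qed (use norm_sqrt_term in auto)

lemma sqrt_one_minus_square: "sqrt_one_minus x * sqrt_one_minus x = 1 - x"
proof -
  let ?a = "\<lambda>n. sqrt_coeff n *\<^sub>R x ^ n"
  have "(\<Sum>i\<le>n. ?a i * ?a (n - i)) = (if n = 0 then 1 else if n = 1 then -1 else 0) *\<^sub>R x ^ n" for n
    unfolding sqrt_coeff_convolution[symmetric] scaleR_left.sum
    by (intro sum.cong refl) (simp add: power_add[symmetric])
  moreover have "(\<lambda>n. \<Sum>i\<le>n. ?a i * ?a (n - i)) sums (sqrt_one_minus x * sqrt_one_minus x)"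
    unfolding sqrt_one_minus_def by (rule Cauchy_product_sums[OF summable_norm_sqrt summable_norm_sqrt])
  ultimately have "(\<lambda>n. (if n = 0 then 1 else if n = 1 then -1 else 0) *\<^sub>R x ^ n) sums (sqrt_one_minus x * sqrt_one_minus x)"
    by simp
  moreover have "(\<lambda>n. (if n = 0 then 1 else if n = 1 then -1 else 0) *\<^sub>R x ^ n) sums
      (\<Sum>n\<in>{0, 1::nat}. (if n = 0 then 1 else if n = 1 then -1 else 0) *\<^sub>R x ^ n)"
    by (rule sums_finite) auto
  ultimately show ?thesis using sums_unique2 by fastforce
qed

text \<open>The series without its constant term has coefficients of total size at most 1. The
  estimate stands in for the positivity of the square root: \<open>rep_pos_of_norm\<close> turns it
  into positivity of the image.\<close>

lemma norm_one_minus_sqrt: "norm (1 - sqrt_one_minus x) \<le> 1"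
proof -
  let ?a = "\<lambda>n. sqrt_coeff n *\<^sub>R x ^ n"
  have s: "summable (\<lambda>n. norm (?a (Suc n)))"
    using summable_norm_sqrt summable_Suc_iff[of "\<lambda>n. norm (?a n)"] by blast
  have "sqrt_one_minus x = (\<Sum>n. ?a (Suc n)) + ?a 0"
    unfolding sqrt_one_minus_def
    using suminf_split_head[OF summable_norm_cancel[OF summable_norm_sqrt]] by simp
  then have "norm (1 - sqrt_one_minus x) = norm (\<Sum>n. ?a (Suc n))"
    by (simp add: sqrt_coeff_0)
  also have "\<dots> \<le> (\<Sum>n. norm (?a (Suc n)))"
    by (rule summable_norm[OF s])
  also have "\<dots> \<le> (\<Sum>n. \<bar>sqrt_coeff (Suc n)\<bar>)"
    by (rule suminf_le[OF _ s summable_abs_sqrt_coeff_Suc]) (rule norm_sqrt_term)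
  also have "\<dots> \<le> 1"
    by (rule suminf_le_const[OF summable_abs_sqrt_coeff_Suc]) (rule sum_abs_sqrt_coeff_Suc)
  finally show ?thesis .
qed

lemma star_sqrt_one_minus:
  assumes "star x = x" shows "star (sqrt_one_minus x) = sqrt_one_minus x"
proof -
  have "star (sqrt_one_minus x) = (\<Sum>n. star (sqrt_coeff n *\<^sub>R x ^ n))"
    unfolding sqrt_one_minus_def
    by (rule bounded_linear.suminf[OF bounded_linear_star])
      (rule summable_norm_cancel[OF summable_norm_sqrt])
  then show ?thesis by (simp add: star_scaleR star_power assms sqrt_one_minus_def)
qed

lemma sqrt_one_minus_commute:
  assumes "y * x = x * y" shows "y * sqrt_one_minus x = sqrt_one_minus x * y"
proof -
  have s: "summable (\<lambda>n. sqrt_coeff n *\<^sub>R x ^ n)"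
    by (rule summable_norm_cancel[OF summable_norm_sqrt])
  have "y * x ^ n = x ^ n * y" for n
    by (induction n) (auto simp: assms mult.assoc, metis assms mult.assoc)
  then show ?thesis
    unfolding sqrt_one_minus_def suminf_mult[OF s, symmetric] suminf_mult2[OF s] by simp
qed

end

text \<open>With \<open>y = cos \<theta>\<close> and the unitary \<open>u = e^{i\<theta>}\<close> this is \<open>2y\<^sup>2 - 1 = cos 2\<theta>\<close>.\<close>

lemma norm_chebyshev2_le:
  fixes y :: "'a::unital_cstar_algebra"
  assumes y: "star y = y" "norm y \<le> 1"
  shows "norm (2 *\<^sub>R (y * y) - 1) \<le> 1"
proof -
  have "norm (y * y) \<le> 1"
    using y by (simp add: norm_selfadjoint_square power_le_one)
  note sq = this
  define b where "b = sqrt_one_minus (y * y)"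
  have b: "star b = b" "b * b = 1 - y * y" "y * b = b * y"
    unfolding b_def using star_sqrt_one_minus[OF sq] sqrt_one_minus_square[OF sq] sqrt_one_minus_commute[OF sq, of y]
    by (auto simp: star_mult y mult.assoc)
  define c where "c = \<i> *\<^sub>C b"
  have c: "star c = - c" "c * c = - (b * b)" "y * c = c * y"
    unfolding c_def star_scaleC mult_scaleC_left mult_scaleC_right scaleC_scaleC b
    using scaleC_scaleC[of "-1" \<i> b] by (simp_all add: scaleC_minus_one)
  \<comment> \<open>y + c is the unitary u and y - c its adjoint; the squares of these two elements
    of norm 1 add up to twice 2 y^2 - 1.\<close>
  have "star (y + c) * (y + c) = 1"
    by (simp add: star_add y c b algebra_simps)
  then have "(norm (y + c))\<^sup>2 = 1" using cstar_identity[of "y + c"] by simp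
  then have u: "norm (y + c) = 1" by (simp add: power2_eq_1_iff) (smt (verit) norm_ge_zero)
  have u': "norm (y - c) = 1" using norm_star[of "y + c"] u by (simp add: star_add y c)
  have "2 *\<^sub>R (2 *\<^sub>R (y * y) - 1) = (y + c) * (y + c) + (y - c) * (y - c)"
    by (simp add: c b algebra_simps scaleR_2)
  also have "norm \<dots> \<le> 1 + 1"
    by (intro norm_triangle_le add_mono order_trans[OF norm_mult_ineq]) (simp_all add: u u')
  finally show ?thesis by simp
qed

text \<open>The identity sin^2 = (1 - cos 2\<theta>) / 2. It brings 1 - y^2 into the unit ball,
  where \<open>sqrt_one_minus\<close> is available and yields the absolute value of
  \<open>y\<close>.\<close>

lemma norm_one_minus_square_le:
  fixes y :: "'a::unital_cstar_algebra"
  assumes y: "star y = y" "norm y \<le> 1"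
  shows "norm (1 - y * y) \<le> 1"
proof -
  have "2 *\<^sub>R (1 - y * y) = 1 - (2 *\<^sub>R (y * y) - 1)" by (simp add: algebra_simps scaleR_2)
  also have "norm \<dots> \<le> 1 + 1"
    by (rule order_trans[OF norm_triangle_ineq4]) (use norm_chebyshev2_le[OF y] in simp)
  finally show ?thesis by simp
qed

subsection \<open>Representations\<close>

definition star_rep :: "('a::unital_cstar_algebra \<Rightarrow> 'h oper) \<Rightarrow> bool" where
  "star_rep \<rho> \<longleftrightarrow> range \<rho> \<subseteq> bounded_ops UNIV \<and> \<rho> 1 = op_id UNIV \<and>
     (\<forall>a b. \<rho> (a + b) = \<rho> a + \<rho> b) \<and> (\<forall>c a. \<rho> (c *\<^sub>C a) = op_scale c (\<rho> a)) \<and>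
     (\<forall>a b. \<rho> (a * b) = op_mult (\<rho> a) (\<rho> b)) \<and> (\<forall>a. \<rho> (star a) = op_adj (\<rho> a))"

lemma faithful_rep_star_rep: "faithful_rep \<pi> \<longleftrightarrow> inj \<pi> \<and> star_rep \<pi>"
  by (auto simp: faithful_rep_def star_rep_def)

context
  fixes \<rho> :: "'a::unital_cstar_algebra \<Rightarrow> 'h oper"
  assumes \<rho>: "star_rep \<rho>"
begin

lemma rep_add: "\<rho> (a + b) = \<rho> a + \<rho> b"
  and rep_scaleC: "\<rho> (c *\<^sub>C a) = op_scale c (\<rho> a)"
  and rep_mult: "\<rho> (a * b) = op_mult (\<rho> a) (\<rho> b)"
  and rep_star: "\<rho> (star a) = op_adj (\<rho> a)"
  and rep_one: "\<rho> 1 = op_id UNIV"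
  using \<rho> by (auto simp: star_rep_def)

lemma rep_zero: "\<rho> 0 = 0"
  using rep_add[of 0 0] by simp

lemma rep_minus: "\<rho> (- a) = - \<rho> a"
  using rep_add[of a "- a"] rep_zero by (simp add: add_eq_0_iff)

lemma rep_diff: "\<rho> (a - b) = \<rho> a - \<rho> b"
  using rep_add[of a "- b"] by (simp add: rep_minus)

lemma rep_scaleR: "\<rho> (r *\<^sub>R a) = op_scale (complex_of_real r) (\<rho> a)"
  by (simp add: scaleR_scaleC rep_scaleC)

lemma rep_sum: "\<rho> (sum f I) = (\<Sum>i\<in>I. \<rho> (f i))"
  by (induction I rule: infinite_finite_induct) (auto simp: rep_add rep_zero)

lemma rep_bounded: obtains C where "op_bound C (\<rho> a)"
proof -
  have "\<rho> a \<in> bounded_ops UNIV" using \<rho> by (auto simp: star_rep_def)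
  then show thesis using that by (auto simp: bounded_ops_def)
qed

text \<open>For x = a*a / |a|^2 the element 1 - x is of the form b*b by the square root, so its
  image is positive; this says that the image of a*a is at most |a|^2.\<close>

lemma rep_contractive: "op_bound (norm a) (\<rho> a)"
proof (cases "a = 0")
  case True
  then show ?thesis by (simp add: rep_zero op_bound_0)
next
  case False
  then have a: "norm a > 0" by simp
  define x where "x = (1 / (norm a)\<^sup>2) *\<^sub>R (star a * a)"
  have x: "norm x \<le> 1" "star x = x"
    using a by (simp_all add: x_def cstar_identity star_scaleR star_mult star_star)
  define b where "b = sqrt_one_minus x"
  have b: "star b * b = 1 - x"
    using sqrt_one_minus_square[OF x(1)] star_sqrt_one_minus[OF x] by (simp add: b_def)
  obtain D where D: "op_bound D (\<rho> b)" by (rule rep_bounded)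
  have "\<rho> (star b * b) = op_id UNIV - op_scale (complex_of_real (1 / (norm a)\<^sup>2)) (op_mult (op_adj (\<rho> a)) (\<rho> a))"
    unfolding b rep_diff rep_one x_def rep_scaleR rep_mult rep_star ..
  then have eq: "op_mult (op_adj (\<rho> b)) (\<rho> b) = op_id UNIV - op_scale (complex_of_real (1 / (norm a)\<^sup>2)) (op_mult (op_adj (\<rho> a)) (\<rho> a))"
    by (simp add: rep_mult rep_star)
  obtain E where E: "op_bound E (\<rho> a)" by (rule rep_bounded)
  show ?thesis
  proof (rule op_bound_of_gram[OF E])
    fix F :: "'h set" and \<eta> assume F: "finite F"
    have "0 \<le> Re (op_form (op_mult (op_adj (\<rho> b)) (\<rho> b)) F \<eta> \<eta>)"
      by (rule op_pos_form(1)[OF op_pos_gram[OF D] F])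
    then show "Re (op_form (op_mult (op_adj (\<rho> a)) (\<rho> a)) F \<eta> \<eta>) \<le> (norm a)\<^sup>2 * (\<Sum>y\<in>F. (cmod (\<eta> y))\<^sup>2)"
      unfolding eq op_form_diff op_form_scale op_form_id[OF F] using a by (simp add: field_simps)
  qed simp
qed

text \<open>The form of r - a at \<xi> is at most r |\<xi>|^2, and subtracting it from r |\<xi>|^2
  leaves the form of \<open>a\<close>. Positivity is thus read off from a norm, with no spectrum at
  hand.\<close>

lemma rep_pos_of_norm:
  assumes "star a = a" "op_bound r (\<rho> (r *\<^sub>R 1 - a))"
  shows "op_pos (\<rho> a)"
  unfolding op_pos_def complex_nonneg_Reals_iff
proof (intro allI impI conjI)
  fix F :: "'h set" and \<xi> assume F: "finite F"
  have "\<rho> a = op_adj (\<rho> a)" using assms(1) rep_star by metis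
  then have "\<rho> a x y = cnj (\<rho> a y x)" for x y by (metis (no_types) op_adj_def)
  then show "Im (op_form (\<rho> a) F \<xi> \<xi>) = 0" by (rule op_form_herm_real)
  have "Re (op_form (\<rho> (r *\<^sub>R 1 - a)) F \<xi> \<xi>) \<le> cmod (op_form (\<rho> (r *\<^sub>R 1 - a)) F \<xi> \<xi>)"
    by (rule complex_Re_le_cmod)
  also have "\<dots> \<le> r * L2_set (\<lambda>x. cmod (\<xi> x)) F * L2_set (\<lambda>x. cmod (\<xi> x)) F"
    using assms(2) F by (auto simp: op_bound_def)
  also have "\<dots> = r * (\<Sum>x\<in>F. (cmod (\<xi> x))\<^sup>2)"
    by (simp add: mult.assoc L2_set_sq[of "\<lambda>x. cmod (\<xi> x)", unfolded power2_eq_square[of "L2_set _ _"]])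
  finally show "0 \<le> Re (op_form (\<rho> a) F \<xi> \<xi>)"
    by (simp add: rep_diff rep_scaleR rep_one op_form_diff op_form_scale op_form_id[OF F])
qed

lemma rep_pos_conj:
  assumes "op_pos (\<rho> a)" shows "op_pos (\<rho> (b * a * star b))"
  using op_pos_conj[OF assms rep_contractive rep_contractive]
  by (simp add: op_conj_def rep_mult rep_star)

end

text \<open>Let \<open>y = 2k\<^sup>2 - 1\<close> and \<open>\<bar>y\<bar> = sqrt (1 - (1 - y\<^sup>2))\<close>.  The element \<open>x = \<bar>y\<bar> + y\<close>, twice the positive
  part of \<open>y\<close>, satisfies \<open>x y x = x \<bar>y\<bar> x\<close>, whose image is positive.  If the image of
  \<open>k\<^sup>2\<close> had norm less than \<open>1/2\<close>, then the image of \<open>x y x\<close> would be negative, whence \<open>x = 0\<close>.\<close>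

lemma faithful_rep_not_small:
  fixes \<pi> :: "'a::unital_cstar_algebra \<Rightarrow> 'h oper"
  assumes \<pi>: "faithful_rep \<pi>" and k: "star k = k" "norm k = 1"
    and r: "op_bound r (\<pi> (k * k))" "r < 1 / 2"
  shows False
proof -
  have rep: "star_rep \<pi>" and inj: "inj \<pi>" using \<pi> by (auto simp: faithful_rep_star_rep)
  define h where "h = k * k"
  have h: "norm h = 1" "star h = h"
    by (simp_all add: h_def norm_selfadjoint_square k star_mult)
  define y where "y = 2 *\<^sub>R h - 1"
  have y: "star y = y" "norm y \<le> 1"
    using norm_chebyshev2_le[of k] by (simp_all add: y_def h_def k star_diff star_scaleR star_mult)
  have t: "norm (1 - y * y) \<le> 1" by (rule norm_one_minus_square_le[OF y])
  define m where "m = sqrt_one_minus (1 - y * y)"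
  have m: "m * m = y * y" "star m = m" "y * m = m * y" "norm (1 - m) \<le> 1"
    unfolding m_def using sqrt_one_minus_square[OF t] star_sqrt_one_minus[OF t]
      sqrt_one_minus_commute[OF t, of y] norm_one_minus_sqrt[OF t]
    by (auto simp: star_diff star_mult y algebra_simps)
  define x where "x = m + y"
  have x: "star x = x" by (simp add: x_def star_add m y)
  have "x * y = x * m" by (simp add: x_def m algebra_simps)
  then have xyx: "x * (2 *\<^sub>R h - 1) * x = x * m * x" by (simp add: y_def)
  have "op_pos (\<pi> m)"
    by (rule rep_pos_of_norm[OF rep m(2), of 1])
      (use op_bound_mono[OF rep_contractive[OF rep, of "1 - m"] m(4)] in simp)
  then have 1: "op_pos (\<pi> (x * m * x))" using rep_pos_conj[OF rep, of m x] by (simp add: x)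
  have "op_pos (\<pi> (r *\<^sub>R 1 - h))"
    by (rule rep_pos_of_norm[OF rep, of _ r]) (use r h in \<open>simp_all add: star_diff star_scaleR h_def\<close>)
  then have 2: "op_pos (\<pi> (x * (r *\<^sub>R 1 - h) * x))" using rep_pos_conj[OF rep, of _ x] by (simp add: x)
  have xx: "\<pi> (x * x) = op_mult (op_adj (\<pi> x)) (\<pi> x)"
    using rep_mult[OF rep, of x x] rep_star[OF rep, of x] by (simp add: x)
  have "op_bound 0 (\<pi> x)"
  proof (rule op_bound_of_gram[OF rep_contractive[OF rep]])
    fix F :: "'h set" and \<eta> assume F: "finite F"
    let ?f = "\<lambda>a. Re (op_form (\<pi> a) F \<eta> \<eta>)"
    have f: "?f (a + b) = ?f a + ?f b" "?f (s *\<^sub>R a) = s * ?f a" for a b s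
      by (simp_all add: rep_add[OF rep] rep_scaleR[OF rep] op_form_add op_form_scale)
    \<comment> \<open>Both terms on the left have positive image, whereas 2 r - 1 is negative. So
      the form of x*x is at most 0, which leaves only \<open>x = 0\<close>.\<close>
    have "x * m * x + 2 *\<^sub>R (x * (r *\<^sub>R 1 - h) * x) = (2 * r - 1) *\<^sub>R (x * x)"
      unfolding xyx[symmetric] by (simp add: algebra_simps)
    then have "(2 * r - 1) * ?f (x * x) = ?f (x * m * x) + 2 * ?f (x * (r *\<^sub>R 1 - h) * x)"
      using f by metis
    also have "\<dots> \<ge> 0"
      using op_pos_form(1)[OF 1 F, of \<eta>] op_pos_form(1)[OF 2 F, of \<eta>] by simp
    finally have "?f (x * x) \<le> 0" using r(2) by (simp add: zero_le_mult_iff)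
    then show "Re (op_form (op_mult (op_adj (\<pi> x)) (\<pi> x)) F \<eta> \<eta>) \<le> 0\<^sup>2 * (\<Sum>y\<in>F. (cmod (\<eta> y))\<^sup>2)"
      by (simp add: xx)
  qed simp
  then have "\<pi> x = \<pi> 0" using op_bound_entry[of 0 "\<pi> x"] by (simp add: rep_zero[OF rep] fun_eq_iff)
  \<comment> \<open>Vanishing of \<open>x\<close> says that y is minus its absolute value. Then 1 -
    m = 2 h has norm 2, against the bound 1 for 1 - m.\<close>
  then have "m = - y" using inj by (simp add: inj_eq x_def eq_neg_iff_add_eq_0)
  then have "1 - m = 2 *\<^sub>R h" by (simp add: y_def)
  then show False using m(4) h(1) by simp
qed

text \<open>If the image were shorter than \<open>a\<close>, the normalized element a*a / |a|^2
  would have norm 1 and an image of norm at most \<open>q < 1\<close>. Repeated squaring of this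
  self-adjoint element keeps the norm 1 and drives the image below 1/2, which
  \<open>faithful_rep_not_small\<close> excludes.\<close>

lemma faithful_rep_isometric:
  assumes \<pi>: "faithful_rep \<pi>" and C: "op_bound C (\<pi> a)"
  shows "norm a \<le> C"
proof (rule ccontr)
  assume "\<not> norm a \<le> C"
  then have lt: "C < norm a" by simp
  have rep: "star_rep \<pi>" using \<pi> by (auto simp: faithful_rep_star_rep)
  have C0: "0 \<le> C" by (rule op_boundD[OF C])
  define q where "q = C\<^sup>2 / (norm a)\<^sup>2"
  have "C\<^sup>2 < (norm a)\<^sup>2" using lt C0 by (intro power_strict_mono) auto
  moreover have "0 < (norm a)\<^sup>2" using lt C0 by auto
  ultimately have q: "0 \<le> q" "q < 1" by (simp_all add: q_def)
  have *: "\<exists>k. star k = k \<and> norm k = 1 \<and> op_bound (q ^ (2 ^ n)) (\<pi> k)" for n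
  proof (induction n)
    case 0
    let ?k = "(1 / (norm a)\<^sup>2) *\<^sub>R (star a * a)"
    have "op_bound (cmod (complex_of_real (1 / (norm a)\<^sup>2)) * (C * C)) (\<pi> ?k)"
      unfolding rep_scaleR[OF rep] rep_mult[OF rep] rep_star[OF rep]
      by (intro op_bound_scale op_bound_mult op_bound_adj C)
    moreover have "cmod (complex_of_real (1 / (norm a)\<^sup>2)) * (C * C) = q"
      unfolding norm_of_real q_def by (simp add: power2_eq_square)
    ultimately have "op_bound (q ^ (2 ^ 0)) (\<pi> ?k)" by (simp only: power_0 power_one_right)
    moreover have "star ?k = ?k" "norm ?k = 1"
      using lt C0 by (auto simp: cstar_identity star_scaleR star_mult star_star)
    ultimately show ?case by blast
  next
    case (Suc n)
    then obtain k where k: "star k = k" "norm k = 1" "op_bound (q ^ (2 ^ n)) (\<pi> k)" by blast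
    have "op_bound (q ^ (2 ^ n) * q ^ (2 ^ n)) (\<pi> (k * k))"
      unfolding rep_mult[OF rep] by (intro op_bound_mult k)
    then have "op_bound (q ^ (2 ^ Suc n)) (\<pi> (k * k))"
      by (simp add: power_add[symmetric] mult_2)
    then show ?case using k by (intro exI[of _ "k * k"]) (simp add: star_mult norm_selfadjoint_square)
  qed
  have "(\<lambda>n. q ^ n) \<longlonglongrightarrow> 0" using q by (intro LIMSEQ_power_zero) auto
  then have "\<forall>\<^sub>F n in sequentially. q ^ n < 1 / 2" by (rule order_tendstoD) auto
  then obtain n where n: "q ^ n < 1 / 2" by (auto simp: eventually_sequentially)
  obtain k where k: "star k = k" "norm k = 1" "op_bound (q ^ (2 ^ n)) (\<pi> k)" using * by blast
  have "q ^ (2 ^ n) * q ^ (2 ^ n) \<le> 1 * q ^ n"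
    by (intro mult_mono power_decreasing) (use q in \<open>auto simp: power_le_one less_imp_le\<close>)
  with n have "q ^ (2 ^ n) * q ^ (2 ^ n) < 1 / 2" by simp
  with op_bound_mult[OF k(3) k(3)] show False
    using faithful_rep_not_small[OF \<pi> k(1,2)] by (auto simp: rep_mult[OF rep])
qed

subsection \<open>Matrices over the algebra\<close>

text \<open>For finite \<open>I\<close> this is a bounded operator on the sum of copies of H indexed
  by \<open>I\<close>. With \<open>I = UNIV\<close> it is a formal matrix that need not be bounded;
  the entries of operators on the whole space are handled in this form.\<close>

definition ampl :: "('a::unital_cstar_algebra \<Rightarrow> 'h oper) \<Rightarrow> 'i set \<Rightarrow> ('i \<Rightarrow> 'i \<Rightarrow> 'a) \<Rightarrow> ('i \<times> 'h) oper" where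
  "ampl \<rho> I Z = (\<lambda>(i, h) (j, k). if i \<in> I \<and> j \<in> I then \<rho> (Z i j) h k else 0)"

definition mat_mult :: "'i set \<Rightarrow> ('i \<Rightarrow> 'i \<Rightarrow> 'a::unital_cstar_algebra) \<Rightarrow> ('i \<Rightarrow> 'i \<Rightarrow> 'a) \<Rightarrow> 'i \<Rightarrow> 'i \<Rightarrow> 'a" where
  "mat_mult I Z W = (\<lambda>i j. \<Sum>k\<in>I. Z i k * W k j)"

definition mat_hermitian :: "'i set \<Rightarrow> ('i \<Rightarrow> 'i \<Rightarrow> 'a::unital_cstar_algebra) \<Rightarrow> bool" where
  "mat_hermitian I Z \<longleftrightarrow> (\<forall>i\<in>I. \<forall>j\<in>I. star (Z i j) = Z j i)"

lemma ampl_apply: "ampl \<rho> I Z (i, h) (j, k) = (if i \<in> I \<and> j \<in> I then \<rho> (Z i j) h k else 0)"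
  by (simp add: ampl_def)

lemma ampl_single_bound:
  assumes "op_bound C T"
  shows "op_bound C (\<lambda>z w. if fst z = i \<and> fst w = j then T (snd z) (snd w) else 0)"
  using compression_bound[OF assms, of snd "{i} \<times> UNIV" snd "{j} \<times> UNIV"]
  by (simp add: inj_on_def mem_Times_iff)

lemma ampl_single_entry_bound:
  assumes "op_bound C T"
  shows "op_bound C (\<lambda>h k. T (i, h) (j, k))"
  using compression_bound[OF assms, of "Pair i" UNIV "Pair j" UNIV]
  by (simp add: inj_on_def)

lemma sum_fun2_apply: "(sum f I) x y = (\<Sum>i\<in>I. f i x y :: 'b::comm_monoid_add)"
  by (induction I rule: infinite_finite_induct) auto

lemma ampl_eq_sum:
  fixes \<rho> :: "'a::unital_cstar_algebra \<Rightarrow> 'h oper" and I :: "'i set"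
  assumes "finite I"
  shows "ampl \<rho> I Z = (\<Sum>i\<in>I. \<Sum>j\<in>I. (\<lambda>z w. if fst z = i \<and> fst w = j then \<rho> (Z i j) (snd z) (snd w) else 0))"
proof (intro ext)
  fix z w :: "'i \<times> 'h"
  have 1: "(\<Sum>j\<in>I. (if fst z = i \<and> fst w = j then \<rho> (Z i j) (snd z) (snd w) else 0))
      = (if fst z = i then (if fst w \<in> I then \<rho> (Z i (fst w)) (snd z) (snd w) else 0) else 0)" for i
    using assms by (auto simp: sum.delta)
  have "(\<Sum>i\<in>I. \<Sum>j\<in>I. (if fst z = i \<and> fst w = j then \<rho> (Z i j) (snd z) (snd w) else 0)) = ampl \<rho> I Z z w"
    unfolding 1 using assms by (auto simp: ampl_def sum.delta split: prod.splits)
  then show "ampl \<rho> I Z z w = (\<Sum>i\<in>I. \<Sum>j\<in>I. (\<lambda>z w. if fst z = i \<and> fst w = j then \<rho> (Z i j) (snd z) (snd w) else 0)) z w"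
    by (simp add: sum_fun2_apply)
qed

lemma mat_hermitian_square: "mat_hermitian I Z \<Longrightarrow> mat_hermitian I (mat_mult I Z Z)"
  by (auto simp: mat_hermitian_def mat_mult_def star_sum star_mult intro!: sum.cong)

context
  fixes \<rho> :: "'a::unital_cstar_algebra \<Rightarrow> 'h oper" and I :: "'i set"
  assumes \<rho>: "star_rep \<rho>" and I: "finite I"
begin

text \<open>Crude, but expressed by norms in the algebra alone and so the same for every
  representation. The loss is removed in \<open>ampl_bound_transfer\<close>.\<close>

lemma ampl_bound: "op_bound (\<Sum>i\<in>I. \<Sum>j\<in>I. norm (Z i j)) (ampl \<rho> I Z)"
  unfolding ampl_eq_sum[OF I]
  by (intro op_bound_sum ampl_single_bound rep_contractive[OF \<rho>])

text \<open>The infinite sum over the basis vectors (l, x) splits by l into finitely many sums over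
  x, each an entry of a product under \<rho>.\<close>

lemma ampl_mult: "op_mult (ampl \<rho> I Z) (ampl \<rho> I W) = ampl \<rho> I (mat_mult I Z W)"
proof (intro ext, clarify)
  fix i h j k
  have 1: "((\<lambda>z. if fst z = l then ampl \<rho> I Z (i, h) z * ampl \<rho> I W z (j, k) else 0)
      has_sum (if i \<in> I \<and> j \<in> I then \<rho> (Z i l * W l j) h k else 0)) UNIV" if "l \<in> I" for l
  proof -
    have "((\<lambda>x. \<rho> (Z i l) h x * \<rho> (W l j) x k) has_sum \<rho> (Z i l * W l j) h k) UNIV"
      unfolding rep_mult[OF \<rho>] by (rule op_mult_has_sum) (rule rep_contractive[OF \<rho>])+
    then have "((\<lambda>x. ampl \<rho> I Z (i, h) (l, x) * ampl \<rho> I W (l, x) (j, k))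
        has_sum (if i \<in> I \<and> j \<in> I then \<rho> (Z i l * W l j) h k else 0)) UNIV"
      using that by (auto simp: ampl_apply)
    then have "((\<lambda>z. ampl \<rho> I Z (i, h) z * ampl \<rho> I W z (j, k))
        has_sum (if i \<in> I \<and> j \<in> I then \<rho> (Z i l * W l j) h k else 0)) (Pair l ` UNIV)"
      by (subst has_sum_reindex) (auto simp: o_def inj_on_def)
    then show ?thesis
      by (rule has_sum_cong_neutral[THEN iffD1, rotated 3]) auto
  qed
  have "((\<lambda>z. \<Sum>l\<in>I. if fst z = l then ampl \<rho> I Z (i, h) z * ampl \<rho> I W z (j, k) else 0)
      has_sum (\<Sum>l\<in>I. if i \<in> I \<and> j \<in> I then \<rho> (Z i l * W l j) h k else 0)) UNIV"
    by (intro has_sum_sum 1)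
  moreover have "(\<Sum>l\<in>I. if fst z = l then ampl \<rho> I Z (i, h) z * ampl \<rho> I W z (j, k) else 0)
      = ampl \<rho> I Z (i, h) z * ampl \<rho> I W z (j, k)" for z
    using I by (cases z) (auto simp: sum.delta ampl_apply)
  moreover have "(\<Sum>l\<in>I. if i \<in> I \<and> j \<in> I then \<rho> (Z i l * W l j) h k else 0) = ampl \<rho> I (mat_mult I Z W) (i, h) (j, k)"
    by (auto simp: ampl_apply mat_mult_def rep_sum[OF \<rho>] sum_fun2_apply intro!: sum.neutral)
  ultimately show "op_mult (ampl \<rho> I Z) (ampl \<rho> I W) (i, h) (j, k) = ampl \<rho> I (mat_mult I Z W) (i, h) (j, k)"
    unfolding op_mult_def by (simp add: infsumI)
qed

lemma ampl_adj: "mat_hermitian I Z \<Longrightarrow> op_adj (ampl \<rho> I Z) = ampl \<rho> I Z"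
proof (intro ext, clarify)
  fix i h j k assume Z: "mat_hermitian I Z"
  have "cnj (\<rho> (Z j i) k h) = \<rho> (star (Z j i)) h k"
    unfolding rep_star[OF \<rho>] op_adj_def ..
  with Z show "op_adj (ampl \<rho> I Z) (i, h) (j, k) = ampl \<rho> I Z (i, h) (j, k)"
    by (simp add: op_adj_def ampl_apply mat_hermitian_def)
qed

text \<open>The C*-identity for the self-adjoint operator of a hermitian matrix. With both
  directions at hand one can pass to high powers, estimate there and return without loss.\<close>

lemma ampl_square_bound_iff:
  assumes Z: "mat_hermitian I Z" and C: "0 \<le> C"
  shows "op_bound (C\<^sup>2) (ampl \<rho> I (mat_mult I Z Z)) \<longleftrightarrow> op_bound C (ampl \<rho> I Z)"
proof
  assume *: "op_bound (C\<^sup>2) (ampl \<rho> I (mat_mult I Z Z))"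
  show "op_bound C (ampl \<rho> I Z)"
  proof (rule op_bound_of_gram[OF ampl_bound C])
    fix F :: "('i \<times> 'h) set" and \<eta> assume F: "finite F"
    have "Re (op_form (ampl \<rho> I (mat_mult I Z Z)) F \<eta> \<eta>) \<le> cmod (op_form (ampl \<rho> I (mat_mult I Z Z)) F \<eta> \<eta>)"
      by (rule complex_Re_le_cmod)
    also have "\<dots> \<le> C\<^sup>2 * L2_set (\<lambda>x. cmod (\<eta> x)) F * L2_set (\<lambda>x. cmod (\<eta> x)) F"
      using * F by (auto simp: op_bound_def)
    also have "\<dots> = C\<^sup>2 * (\<Sum>x\<in>F. (cmod (\<eta> x))\<^sup>2)"
      by (simp add: mult.assoc L2_set_sq[of "\<lambda>x. cmod (\<eta> x)", unfolded power2_eq_square[of "L2_set _ _"]])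
    finally show "Re (op_form (op_mult (op_adj (ampl \<rho> I Z)) (ampl \<rho> I Z)) F \<eta> \<eta>) \<le> C\<^sup>2 * (\<Sum>y\<in>F. (cmod (\<eta> y))\<^sup>2)"
      by (simp add: ampl_adj[OF Z] ampl_mult)
  qed
next
  assume "op_bound C (ampl \<rho> I Z)"
  from op_bound_mult[OF this this] show "op_bound (C\<^sup>2) (ampl \<rho> I (mat_mult I Z Z))"
    by (simp add: ampl_mult power2_eq_square)
qed

lemma ampl_power_bound_iff:
  assumes Z: "mat_hermitian I Z" and C: "0 \<le> C"
  shows "op_bound (C ^ (2 ^ n)) (ampl \<rho> I (((\<lambda>Z. mat_mult I Z Z) ^^ n) Z)) \<longleftrightarrow> op_bound C (ampl \<rho> I Z)"
proof (induction n)
  case (Suc n)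
  have "mat_hermitian I (((\<lambda>Z. mat_mult I Z Z) ^^ n) Z)"
    by (induction n) (auto simp: Z mat_hermitian_square)
  from ampl_square_bound_iff[OF this, of "C ^ (2 ^ n)"] C Suc show ?case
    by (simp add: power_mult[symmetric] mult.commute)
qed simp

lemma ampl_diff: "ampl \<rho> I (\<lambda>i j. Z i j - W i j) = ampl \<rho> I Z - ampl \<rho> I W"
  by (auto simp: ampl_def fun_eq_iff rep_diff[OF \<rho>])

lemma ampl_scaleR: "ampl \<rho> I (\<lambda>i j. c *\<^sub>R Z i j) = op_scale (complex_of_real c) (ampl \<rho> I Z)"
  by (auto simp: ampl_def fun_eq_iff rep_scaleR[OF \<rho>] op_scale_def)

lemma ampl_one: "ampl \<rho> I (\<lambda>i j. if i = j then 1 else 0) = op_id (I \<times> UNIV)"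
  by (auto simp: ampl_def fun_eq_iff rep_one[OF \<rho>] rep_zero[OF \<rho>] op_id_def)

end

section \<open>Independence of norm and positivity of matrices from the representation\<close>

lemma op_bound_closed:
  assumes "\<And>D. C < D \<Longrightarrow> op_bound D T" "0 \<le> C"
  shows "op_bound C T"
proof -
  have "op_bound (op_norm T) T" using assms(1)[of "C + 1"] by (intro op_bound_op_norm) simp
  moreover have "op_norm T \<le> C" 
  proof (rule dense_ge)
    fix D assume "C < D"
    then show "op_norm T \<le> D" by (rule op_norm_le[OF assms(1)])
  qed
  ultimately show ?thesis by (rule op_bound_mono)
qed

text \<open>On matrices over \<open>A\<close> the norms induced by \<open>\<pi>\<close> and \<open>\<rho>\<close> are comparable, up to a
  constant; applied to the powers \<open>Z^(2^n)\<close> the C*-identity removes the constant.\<close>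

lemma ampl_bound_transfer:
  fixes \<pi> :: "'a::unital_cstar_algebra \<Rightarrow> 'h oper" and \<rho> :: "'a \<Rightarrow> 'k oper"
  assumes \<pi>: "faithful_rep \<pi>" and \<rho>: "star_rep \<rho>" and I: "finite I"
    and Z: "mat_hermitian I Z" and C: "op_bound C (ampl \<pi> I Z)"
  shows "op_bound C (ampl \<rho> I Z)"
proof (rule op_bound_closed)
  have rep: "star_rep \<pi>" using \<pi> by (simp add: faithful_rep_star_rep)
  show C0: "0 \<le> C" by (rule op_boundD[OF C])
  fix D assume D: "C < D"
  let ?Z = "\<lambda>n. ((\<lambda>Z. mat_mult I Z Z) ^^ n) Z"
  let ?K = "real (card I) * real (card I)"
  \<comment> \<open>Each entry of the power is a block of the operator under \<pi>, so its norm in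
    the algebra is at most \<open>C ^ (2 ^ n)\<close>. The factor \<open>?K\<close>, the number of
    entries, is the price of the crude bound under \<rho>.\<close>
  have 1: "op_bound (?K * C ^ (2 ^ n)) (ampl \<rho> I (?Z n))" for n
  proof -
    have "op_bound (C ^ (2 ^ n)) (ampl \<pi> I (?Z n))"
      using ampl_power_bound_iff[OF rep I Z C0] C by simp
    then have "op_bound (C ^ (2 ^ n)) (\<pi> (?Z n i j))" if "i \<in> I" "j \<in> I" for i j
      using ampl_single_entry_bound[of _ "ampl \<pi> I (?Z n)" i j] that by (simp add: ampl_apply)
    then have "norm (?Z n i j) \<le> C ^ (2 ^ n)" if "i \<in> I" "j \<in> I" for i j
      using faithful_rep_isometric[OF \<pi>] that by blast
    then have "(\<Sum>i\<in>I. \<Sum>j\<in>I. norm (?Z n i j)) \<le> (\<Sum>i\<in>I. \<Sum>j\<in>I. C ^ (2 ^ n))"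
      by (intro sum_mono)
    then show ?thesis
      by (intro op_bound_mono[OF ampl_bound[OF \<rho> I]]) (simp add: mult.assoc)
  qed
  \<comment> \<open>The loss \<open>?K\<close> is fixed while C / D < 1 is raised to growing powers,
    so some power absorbs it.\<close>
  have "(\<lambda>n. ?K * (C / D) ^ n) \<longlonglongrightarrow> ?K * 0"
    using D C0 by (intro tendsto_intros LIMSEQ_power_zero) auto
  then have "\<forall>\<^sub>F n in sequentially. ?K * (C / D) ^ n < 1" by (intro order_tendstoD) auto
  then obtain n where n: "?K * (C / D) ^ n < 1" by (auto simp: eventually_sequentially)
  have "(C / D) ^ (2 ^ n) \<le> (C / D) ^ n"
    using D C0 by (intro power_decreasing) (auto simp: less_imp_le)
  then have "?K * (C / D) ^ (2 ^ n) \<le> ?K * (C / D) ^ n" by (intro mult_left_mono) auto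
  then have "?K * (C / D) ^ (2 ^ n) \<le> 1" using n by linarith
  then have "?K * C ^ (2 ^ n) \<le> D ^ (2 ^ n)"
    using D C0 by (simp add: power_divide pos_divide_le_eq)
  then have "op_bound (D ^ (2 ^ n)) (ampl \<rho> I (?Z n))" by (rule op_bound_mono[OF 1])
  then show "op_bound D (ampl \<rho> I Z)"
    using ampl_power_bound_iff[OF \<rho> I Z] D C0 by simp
qed

text \<open>If 0 <= Z <= C under \<pi>, then C - Z also lies between 0 and C, so its norm is at most
  \<open>C\<close>. Norms of hermitian matrices transfer, and under \<rho> the inequality |C - Z| <=
  C forces Z >= 0.\<close>

lemma ampl_pos_transfer:
  fixes \<pi> :: "'a::unital_cstar_algebra \<Rightarrow> 'h oper" and \<rho> :: "'a \<Rightarrow> 'k oper" and I :: "'i set"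
  assumes \<pi>: "faithful_rep \<pi>" and \<rho>: "star_rep \<rho>" and I: "finite I"
    and pos: "op_pos (ampl \<pi> I Z)"
  shows "op_pos (ampl \<rho> I Z)"
proof -
  have rep: "star_rep \<pi>" and inj: "inj \<pi>" using \<pi> by (simp_all add: faithful_rep_star_rep)
  have Z: "mat_hermitian I Z"
    unfolding mat_hermitian_def
  proof (intro ballI)
    fix i j assume ij: "i \<in> I" "j \<in> I"
    have "\<pi> (Z i j) h k = cnj (\<pi> (Z j i) k h)" for h k
      using op_pos_hermitian[OF pos, of "(i, h)" "(j, k)"] ij by (simp add: ampl_apply)
    then have "op_adj (\<pi> (Z i j)) = \<pi> (Z j i)"
      by (simp add: op_adj_def fun_eq_iff)
    then have "\<pi> (star (Z i j)) = \<pi> (Z j i)" by (simp add: rep_star[OF rep])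
    then show "star (Z i j) = Z j i" using inj by (simp add: inj_eq)
  qed
  define C where "C = (\<Sum>i\<in>I. \<Sum>j\<in>I. norm (Z i j)) + 1"
  have C: "C > 0" unfolding C_def by (simp add: add_nonneg_pos sum_nonneg)
  have bd: "op_bound C (ampl \<pi> I Z)"
    by (rule op_bound_mono[OF ampl_bound[OF rep I]]) (simp add: C_def)
  let ?W = "\<lambda>i j. C *\<^sub>R (if i = j then 1 else 0) - Z i j"
  have W: "mat_hermitian I ?W" using Z by (auto simp: mat_hermitian_def star_diff star_scaleR)
  have form: "Re (op_form (ampl \<sigma> I ?W) F \<xi> \<xi>) =
      C * (\<Sum>x\<in>F \<inter> (I \<times> UNIV). (cmod (\<xi> x))\<^sup>2) - Re (op_form (ampl \<sigma> I Z) F \<xi> \<xi>)"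
    if "star_rep \<sigma>" "finite F" for \<sigma> :: "'a \<Rightarrow> 'l oper" and F \<xi>
    unfolding ampl_diff[OF that(1) I] ampl_scaleR[OF that(1) I] ampl_one[OF that(1) I] op_form_diff op_form_scale
      op_form_id[OF that(2)] by simp
  \<comment> \<open>The unit of the matrix algebra is the identity of \<open>I \<times> UNIV\<close>
    only. Vectors are therefore cut down to these coordinates, where C |\<xi>|^2 is exactly the
    contribution of C times the unit.\<close>
  have restr: "op_form (ampl \<sigma> I Y) F \<xi> \<eta> = op_form (ampl \<sigma> I Y) (F \<inter> (I \<times> UNIV)) \<xi> \<eta>"
    if "finite F" for \<sigma> :: "'a \<Rightarrow> 'l oper" and Y F \<xi> \<eta>
  proof -
    have z: "ampl \<sigma> I Y x y = 0" if "x \<notin> I \<times> UNIV \<or> y \<notin> I \<times> UNIV" for x y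
      using that by (cases x; cases y) (auto simp: ampl_apply)
    have "(\<Sum>y\<in>F. cnj (\<xi> x) * ampl \<sigma> I Y x y * \<eta> y) = (\<Sum>y\<in>F \<inter> (I \<times> UNIV). cnj (\<xi> x) * ampl \<sigma> I Y x y * \<eta> y)" for x
      by (rule sum.mono_neutral_right) (use that z in auto)
    moreover have "(\<Sum>x\<in>F. \<Sum>y\<in>F \<inter> (I \<times> UNIV). cnj (\<xi> x) * ampl \<sigma> I Y x y * \<eta> y) =
        (\<Sum>x\<in>F \<inter> (I \<times> UNIV). \<Sum>y\<in>F \<inter> (I \<times> UNIV). cnj (\<xi> x) * ampl \<sigma> I Y x y * \<eta> y)"
    proof (rule sum.mono_neutral_right)
      show "\<forall>x\<in>F - F \<inter> (I \<times> UNIV). (\<Sum>y\<in>F \<inter> (I \<times> UNIV). cnj (\<xi> x) * ampl \<sigma> I Y x y * \<eta> y) = 0"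
        using z by (intro ballI sum.neutral) simp
    qed (use that in auto)
    ultimately show ?thesis by (simp add: op_form_def)
  qed
  have posW: "op_pos (ampl \<pi> I ?W)"
    unfolding op_pos_def complex_nonneg_Reals_iff
  proof (intro allI impI conjI)
    fix F :: "('i \<times> 'h) set" and \<xi> assume F: "finite F"
    show "Im (op_form (ampl \<pi> I ?W) F \<xi> \<xi>) = 0"
      by (rule op_form_herm_real) (subst ampl_adj[OF rep I W, symmetric], simp only: op_adj_def)
    let ?G = "F \<inter> (I \<times> UNIV)"
    have "Re (op_form (ampl \<pi> I Z) F \<xi> \<xi>) \<le> cmod (op_form (ampl \<pi> I Z) ?G \<xi> \<xi>)"
      unfolding restr[OF F] by (rule complex_Re_le_cmod)
    also have "\<dots> \<le> C * L2_set (\<lambda>x. cmod (\<xi> x)) ?G * L2_set (\<lambda>x. cmod (\<xi> x)) ?G"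
      using bd F by (auto simp: op_bound_def)
    also have "\<dots> = C * (\<Sum>x\<in>?G. (cmod (\<xi> x))\<^sup>2)"
      by (simp add: mult.assoc L2_set_sq[of "\<lambda>x. cmod (\<xi> x)", unfolded power2_eq_square[of "L2_set _ _"]])
    finally show "0 \<le> Re (op_form (ampl \<pi> I ?W) F \<xi> \<xi>)"
      by (simp add: form[OF rep F])
  qed
  have "op_bound C (ampl \<pi> I ?W)"
  proof (rule op_pos_bound[OF posW])
    fix F :: "('i \<times> 'h) set" and \<xi> assume F: "finite F"
    have "Re (op_form (ampl \<pi> I ?W) F \<xi> \<xi>) \<le> C * (\<Sum>x\<in>F \<inter> (I \<times> UNIV). (cmod (\<xi> x))\<^sup>2)"
      using form[OF rep F] op_pos_form(1)[OF pos F] by simp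
    also have "\<dots> \<le> C * (\<Sum>x\<in>F. (cmod (\<xi> x))\<^sup>2)"
      using C F by (intro mult_left_mono sum_mono2) auto
    finally show "Re (op_form (ampl \<pi> I ?W) F \<xi> \<xi>) \<le> C * (\<Sum>x\<in>F. (cmod (\<xi> x))\<^sup>2)" .
  qed (use C in simp)
  then have bdW: "op_bound C (ampl \<rho> I ?W)" by (rule ampl_bound_transfer[OF \<pi> \<rho> I W])
  show ?thesis
    unfolding op_pos_def complex_nonneg_Reals_iff
  proof (intro allI impI conjI)
    fix F :: "('i \<times> 'k) set" and \<xi> assume F: "finite F"
    show "Im (op_form (ampl \<rho> I Z) F \<xi> \<xi>) = 0"
      by (rule op_form_herm_real) (subst ampl_adj[OF \<rho> I Z, symmetric], simp only: op_adj_def)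
    let ?G = "F \<inter> (I \<times> UNIV)"
    have "Re (op_form (ampl \<rho> I ?W) F \<xi> \<xi>) \<le> cmod (op_form (ampl \<rho> I ?W) ?G \<xi> \<xi>)"
      unfolding restr[OF F] by (rule complex_Re_le_cmod)
    also have "\<dots> \<le> C * L2_set (\<lambda>x. cmod (\<xi> x)) ?G * L2_set (\<lambda>x. cmod (\<xi> x)) ?G"
      using bdW F by (auto simp: op_bound_def)
    also have "\<dots> = C * (\<Sum>x\<in>?G. (cmod (\<xi> x))\<^sup>2)"
      by (simp add: mult.assoc L2_set_sq[of "\<lambda>x. cmod (\<xi> x)", unfolded power2_eq_square[of "L2_set _ _"]])
    finally show "0 \<le> Re (op_form (ampl \<rho> I Z) F \<xi> \<xi>)"
      by (simp add: form[OF \<rho> F])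
  qed
qed

section \<open>Operator systems and completely positive maps\<close>

interpretation oper: vector_space op_scale
  by unfold_locales (auto simp: op_scale_def fun_eq_iff algebra_simps)

lemma op_span_eq_span: "op_span S = oper.span S"
  by (simp add: op_span_def oper.span_explicit)

section \<open>Norm closures of subspaces of operators\<close>

lemma op_closureE:
  assumes "T \<in> op_closure V" "0 < e"
  obtains S where "S \<in> V" "op_bound e (T - S)"
  using assms unfolding op_closure_def by blast

text \<open>Used for every passage from generators to the closure. \<open>L\<close> need not be
  linear; it has to be Lipschitz between \<open>T\<close> and its approximants, and its values on
  \<open>V\<close> may already be limits of elements of \<open>W\<close>.\<close>

lemma op_closure_map:
  assumes T: "T \<in> op_closure V" and V: "\<And>S. S \<in> V \<Longrightarrow> L S \<in> op_closure W"
    and K: "0 \<le> K" and le: "\<And>S e. S \<in> V \<Longrightarrow> op_bound e (T - S) \<Longrightarrow> op_bound (K * e) (L T - L S)"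
  shows "L T \<in> op_closure W"
  unfolding op_closure_def
proof (intro CollectI allI impI)
  fix e :: real assume e: "e > 0"
  \<comment> \<open>K + 1 in place of K covers the case \<open>K = 0\<close> and still leaves K e'
    <= e / 2.\<close>
  define e' where "e' = e / (2 * (K + 1))"
  have e': "e' > 0" using e K by (simp add: e'_def)
  obtain S where S: "S \<in> V" "op_bound e' (T - S)" using op_closureE[OF T e'] .
  obtain R where R: "R \<in> W" "op_bound (e / 2) (L S - R)"
    using op_closureE[OF V[OF S(1)] half_gt_zero[OF e]] .
  have "op_bound (K * e' + e / 2) ((L T - L S) + (L S - R))"
    by (intro op_bound_add R le S)
  moreover have "K * e' + e / 2 \<le> e"
    using e K by (simp add: e'_def field_simps)
  ultimately have "op_bound e (L T - R)" by (simp add: op_bound_mono)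
  with R(1) show "\<exists>S\<in>W. op_bound e (L T - S)" by blast
qed

lemma op_closure_incl: "S \<in> V \<Longrightarrow> S \<in> op_closure V"
  unfolding op_closure_def by (auto intro!: bexI[of _ S] op_bound_mono[OF op_bound_0])

lemma op_closure_idem: "op_closure (op_closure V) \<subseteq> op_closure V"
  using op_closure_map[of _ "op_closure V" "\<lambda>x. x" V 1] by auto

lemma op_closure_add:
  assumes V: "\<And>S T. S \<in> V \<Longrightarrow> T \<in> V \<Longrightarrow> S + T \<in> V" and S: "S \<in> op_closure V" and T: "T \<in> op_closure V"
  shows "S + T \<in> op_closure V"
proof -
  have *: "S' + T \<in> op_closure V" if "S' \<in> V" for S'
    by (rule op_closure_map[OF T, of "\<lambda>T. S' + T" _ 1]) (use that V in \<open>auto intro: op_closure_incl simp: algebra_simps\<close>)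
  show ?thesis
    by (rule op_closure_map[OF S, of "\<lambda>S. S + T" _ 1]) (use * in \<open>auto simp: algebra_simps\<close>)
qed

lemma op_bound_scale_diff:
  "op_bound e (T - S) \<Longrightarrow> op_bound (cmod c * e) (op_scale c T - op_scale c S)"
  by (drule op_bound_scale) (simp add: oper.scale_right_diff_distrib)

lemma op_closure_scale:
  assumes "\<And>T. T \<in> V \<Longrightarrow> op_scale c T \<in> V" "T \<in> op_closure V"
  shows "op_scale c T \<in> op_closure V"
  by (rule op_closure_map[OF assms(2), of "op_scale c" _ "cmod c"])
    (use assms in \<open>auto intro: op_closure_incl op_bound_scale_diff\<close>)

lemma op_adj_add: "op_adj (S + T) = op_adj S + op_adj T"
  by (simp add: op_adj_def fun_eq_iff)

lemma op_adj_diff: "op_adj (S - T) = op_adj S - op_adj T"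
  by (simp add: op_adj_def fun_eq_iff)

lemma op_adj_scale: "op_adj (op_scale c T) = op_scale (cnj c) (op_adj T)"
  by (simp add: op_adj_def op_scale_def fun_eq_iff)

lemma op_closure_adj:
  assumes "\<And>T. T \<in> V \<Longrightarrow> op_adj T \<in> V" "T \<in> op_closure V"
  shows "op_adj T \<in> op_closure V"
  by (rule op_closure_map[OF assms(2), of op_adj _ 1])
    (use assms in \<open>auto intro: op_closure_incl simp: op_adj_diff[symmetric] op_bound_adj\<close>)

lemma op_closure_bounded_ops:
  assumes "V \<subseteq> bounded_ops X" shows "op_closure V \<subseteq> bounded_ops X"
proof
  fix T assume T: "T \<in> op_closure V"
  obtain S where S: "S \<in> V" "op_bound 1 (T - S)" using op_closureE[OF T zero_less_one] .
  obtain C where "op_bound C S" using assms S by (auto simp: bounded_ops_def)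
  from op_bound_add[OF S(2) this] have bd: "\<exists>C. op_bound C T" by (auto simp only: diff_add_cancel)
  have "T x y = 0" if xy: "\<not> (x \<in> X \<and> y \<in> X)" for x y
  proof -
    have "cmod (T x y) \<le> e" if "e > 0" for e
    proof -
      obtain S where S: "S \<in> V" "op_bound e (T - S)" using op_closureE[OF T \<open>e > 0\<close>] .
      then have "S x y = 0" using assms xy by (auto simp: bounded_ops_def)
      then show ?thesis using op_bound_entry[OF S(2), of x y] by simp
    qed
    then have "cmod (T x y) \<le> 0" by (rule dense_ge)
    then show ?thesis by simp
  qed
  with bd show "T \<in> bounded_ops X" by (auto simp: bounded_ops_def)
qed

lemma bounded_ops_iff:
  "T \<in> bounded_ops X \<longleftrightarrow> (\<exists>C. op_bound C T) \<and> (\<forall>x y. x \<notin> X \<or> y \<notin> X \<longrightarrow> T x y = 0)"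
  unfolding bounded_ops_def by blast

lemma bounded_ops_subspace: "oper.subspace (bounded_ops X)"
proof (rule oper.subspaceI)
  show "0 \<in> bounded_ops X"
    unfolding bounded_ops_iff using op_bound_0 by auto
  show "S + T \<in> bounded_ops X" if "S \<in> bounded_ops X" "T \<in> bounded_ops X" for S T
    using that unfolding bounded_ops_iff by (auto dest: op_bound_add)
  show "op_scale c T \<in> bounded_ops X" if "T \<in> bounded_ops X" for c T
  proof -
    have "\<exists>C. op_bound C (op_scale c T)" using that op_bound_scale[of _ T c] by (auto simp: bounded_ops_iff)
    moreover have "op_scale c T x y = 0" if "T x y = 0" for x y using that by (simp add: op_scale_def)
    ultimately show ?thesis using that unfolding bounded_ops_iff by blast
  qed
qed

lemma opsys_on_closed_span:
  assumes "G \<subseteq> bounded_ops X" "op_id X \<in> op_span G" "\<And>T. T \<in> G \<Longrightarrow> op_adj T \<in> op_span G"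
  shows "opsys_on X (op_closure (op_span G))"
  unfolding opsys_on_def
proof (intro conjI ballI allI)
  have "op_span G \<subseteq> bounded_ops X"
    unfolding op_span_eq_span by (rule oper.span_minimal[OF assms(1) bounded_ops_subspace])
  then show "op_closure (op_span G) \<subseteq> bounded_ops X" by (rule op_closure_bounded_ops)
  show "op_id X \<in> op_closure (op_span G)" by (rule op_closure_incl[OF assms(2)])
  show "S + T \<in> op_closure (op_span G)" if "S \<in> op_closure (op_span G)" "T \<in> op_closure (op_span G)" for S T
    by (rule op_closure_add[OF _ that]) (simp add: op_span_eq_span oper.span_add)
  show "op_scale c T \<in> op_closure (op_span G)" if "T \<in> op_closure (op_span G)" for c T
    by (rule op_closure_scale[OF _ that]) (simp add: op_span_eq_span oper.span_scale)
  have "op_adj T \<in> oper.span G" if "T \<in> oper.span G" for T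
    using that
  proof (induction rule: oper.span_induct_alt)
    case base
    have "op_adj (0 :: 'a oper) = 0" by (simp add: op_adj_def fun_eq_iff)
    then show ?case by (simp only: oper.span_zero)
  next
    case (step c x y)
    then show ?case
      using assms(3)[of x] unfolding op_adj_add op_adj_scale op_span_eq_span
      by (intro oper.span_add oper.span_scale) auto
  qed
  then show "op_adj T \<in> op_closure (op_span G)" if "T \<in> op_closure (op_span G)" for T
    by (intro op_closure_adj[OF _ that]) (simp add: op_span_eq_span)
  show "op_closure (op_closure (op_span G)) \<subseteq> op_closure (op_span G)"
    by (rule op_closure_idem)
qed

context
  fixes X :: "'x set" and B assumes B: "opsys_on X B"
begin

lemma opsys_on_bounded: "x \<in> B \<Longrightarrow> x \<in> bounded_ops X"
  and opsys_on_id: "op_id X \<in> B"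
  and opsys_on_add: "x \<in> B \<Longrightarrow> y \<in> B \<Longrightarrow> x + y \<in> B"
  and opsys_on_scale: "x \<in> B \<Longrightarrow> op_scale c x \<in> B"
  and opsys_on_adj: "x \<in> B \<Longrightarrow> op_adj x \<in> B"
  using B by (auto simp: opsys_on_def)

lemma opsys_on_zero: "0 \<in> B"
proof -
  have "op_scale 0 (op_id X) \<in> B" by (intro opsys_on_scale opsys_on_id)
  then show ?thesis by simp
qed

lemma opsys_on_diff: "x \<in> B \<Longrightarrow> y \<in> B \<Longrightarrow> x - y \<in> B"
  using opsys_on_add[of x "op_scale (-1) y"] opsys_on_scale[of y "-1"]
  by (simp add: op_scale_def fun_diff_def plus_fun_def)

lemma opsys_on_sum: "(\<And>i. i \<in> I \<Longrightarrow> f i \<in> B) \<Longrightarrow> sum f I \<in> B"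
  by (induction I rule: infinite_finite_induct) (auto simp: opsys_on_zero opsys_on_add)

end

section \<open>Unital completely positive maps are contractive\<close>

text \<open>At a pair of vectors with norms a and b the form is at least C a^2 + C b^2 - 2 C a b = C
  (a - b)^2. The support condition is needed because the diagonal is C times the identity of
  \<open>X\<close> only.\<close>

lemma op_pos_block_bound:
  assumes x: "op_bound C x" and supp: "\<And>u v. x u v \<noteq> 0 \<Longrightarrow> u \<in> X \<and> v \<in> X"
  shows "op_pos (block 2 (\<lambda>i j. if i = j then op_scale (complex_of_real C) (op_id X)
     else if i = 0 then x else op_adj x))" (is "op_pos ?M")
  unfolding op_pos_def complex_nonneg_Reals_iff
proof (intro allI impI conjI)
  fix F :: "(nat \<times> 'a) set" and \<xi> assume F: "finite F"
  have herm: "?M z w = cnj (?M w z)" for z w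
    by (auto simp: block_def op_scale_def op_id_def op_adj_def split: prod.splits)
  then show "Im (op_form ?M F \<xi> \<xi>) = 0" by (rule op_form_herm_real)
  define E where "E = snd ` F \<inter> X"
  have E: "finite E" using F by (simp add: E_def)
  \<comment> \<open>An arbitrary finite set \<open>F\<close> is replaced by a full product: \<zeta>
    extends \<xi> by zero, so that the sum separates into the four blocks.\<close>
  define \<zeta> where "\<zeta> i u = (if (i, u) \<in> F then \<xi> (i, u) else 0)" for i u
  define G where "G = {..<2::nat} \<times> E"
  have G: "finite G" using E by (simp add: G_def)
  have x0: "x u v = 0" if "u \<notin> X \<or> v \<notin> X" for u v using supp that by blast
  have Mz: "?M z w = 0" if "z \<notin> {..<2} \<times> X \<or> w \<notin> {..<2} \<times> X" for z w
  proof -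
    obtain i u j v where zw: "z = (i, u)" "w = (j, v)" by (cases z; cases w)
    with that have "\<not> i < 2 \<or> \<not> j < 2 \<or> u \<notin> X \<or> v \<notin> X" by auto
    then show ?thesis
      unfolding zw block_def op_scale_def op_id_def op_adj_def using x0[of u v] x0[of v u] by auto
  qed
  have out: "z \<notin> {..<2} \<times> X" if "z \<in> F - F \<inter> G" for z
    using that by (cases z) (force simp: G_def E_def)
  have 1: "(\<Sum>w\<in>F. cnj (\<xi> z) * ?M z w * \<xi> w) = (\<Sum>w\<in>F \<inter> G. cnj (\<xi> z) * ?M z w * \<xi> w)" for z
  proof (rule sum.mono_neutral_right)
    show "\<forall>w\<in>F - F \<inter> G. cnj (\<xi> z) * ?M z w * \<xi> w = 0"
      using Mz[OF disjI2[OF out]] by simp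
  qed (use F in auto)
  have "op_form ?M F \<xi> \<xi> = (\<Sum>z\<in>F. \<Sum>w\<in>F \<inter> G. cnj (\<xi> z) * ?M z w * \<xi> w)"
    unfolding op_form_def 1 ..
  also have "\<dots> = (\<Sum>z\<in>F \<inter> G. \<Sum>w\<in>F \<inter> G. cnj (\<xi> z) * ?M z w * \<xi> w)"
  proof (rule sum.mono_neutral_right)
    show "\<forall>z\<in>F - F \<inter> G. (\<Sum>w\<in>F \<inter> G. cnj (\<xi> z) * ?M z w * \<xi> w) = 0"
      using Mz[OF disjI1[OF out]] by (intro ballI sum.neutral) simp
  qed (use F in auto)
  also have "\<dots> = (\<Sum>z\<in>F \<inter> G. \<Sum>w\<in>F \<inter> G. cnj (\<zeta> (fst z) (snd z)) * ?M z w * \<zeta> (fst w) (snd w))"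
    by (intro sum.cong refl) (simp add: \<zeta>_def)
  also have "\<dots> = (\<Sum>z\<in>F \<inter> G. \<Sum>w\<in>G. cnj (\<zeta> (fst z) (snd z)) * ?M z w * \<zeta> (fst w) (snd w))"
    by (rule sum.cong[OF refl], rule sum.mono_neutral_left) (use G in \<open>auto simp: \<zeta>_def\<close>)
  also have "\<dots> = (\<Sum>z\<in>G. \<Sum>w\<in>G. cnj (\<zeta> (fst z) (snd z)) * ?M z w * \<zeta> (fst w) (snd w))"
    by (rule sum.mono_neutral_left) (use G in \<open>auto simp: \<zeta>_def\<close>)
  also have "\<dots> = (\<Sum>i<2. \<Sum>u\<in>E. \<Sum>j<2. \<Sum>v\<in>E. cnj (\<zeta> i u) * ?M (i, u) (j, v) * \<zeta> j v)"
    by (simp add: G_def sum.cartesian_product' split_def)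
  also have "\<dots> = (\<Sum>i<2. \<Sum>j<2. \<Sum>u\<in>E. \<Sum>v\<in>E. cnj (\<zeta> i u) * ?M (i, u) (j, v) * \<zeta> j v)"
    by (intro sum.cong refl sum.swap)
  also have "\<dots> = C * op_form (op_id X) E (\<zeta> 0) (\<zeta> 0) + (\<Sum>u\<in>E. \<Sum>v\<in>E. cnj (\<zeta> 0 u) * x u v * \<zeta> 1 v)
     + ((\<Sum>u\<in>E. \<Sum>v\<in>E. cnj (\<zeta> 1 u) * op_adj x u v * \<zeta> 0 v) + C * op_form (op_id X) E (\<zeta> 1) (\<zeta> 1))"
    by (simp add: numeral_2_eq_2 block_def op_scale_def op_form_def sum_distrib_left algebra_simps)
  also have "\<dots> = C * op_form (op_id X) E (\<zeta> 0) (\<zeta> 0) + op_form x E (\<zeta> 0) (\<zeta> 1)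
     + (cnj (op_form x E (\<zeta> 0) (\<zeta> 1)) + C * op_form (op_id X) E (\<zeta> 1) (\<zeta> 1))"
    unfolding op_form_adj[symmetric] by (simp add: op_form_def)
  finally have form: "Re (op_form ?M F \<xi> \<xi>) = C * (\<Sum>u\<in>E. (cmod (\<zeta> 0 u))\<^sup>2) + C * (\<Sum>u\<in>E. (cmod (\<zeta> 1 u))\<^sup>2)
     + 2 * Re (op_form x E (\<zeta> 0) (\<zeta> 1))"
    using op_form_id[OF E, of X] by (simp add: E_def Int_assoc)
  let ?a = "L2_set (\<lambda>u. cmod (\<zeta> 0 u)) E" and ?b = "L2_set (\<lambda>u. cmod (\<zeta> 1 u)) E"
  have "- Re (op_form x E (\<zeta> 0) (\<zeta> 1)) \<le> cmod (op_form x E (\<zeta> 0) (\<zeta> 1))"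
    by (metis complex_Re_le_cmod norm_minus_cancel uminus_complex.simps(1))
  also have "\<dots> \<le> C * ?a * ?b" using x E by (auto simp: op_bound_def)
  finally have 1: "- Re (op_form x E (\<zeta> 0) (\<zeta> 1)) \<le> C * ?a * ?b" .
  have "0 \<le> C * (?a - ?b)\<^sup>2" using op_boundD[OF x] by simp
  also have "\<dots> = C * ?a\<^sup>2 + C * ?b\<^sup>2 - 2 * (C * ?a * ?b)" by (simp add: power2_diff algebra_simps)
  finally show "0 \<le> Re (op_form ?M F \<xi> \<xi>)"
    using 1 unfolding form L2_set_sq by simp
qed

text \<open>The 2 by 2 matrix with \<open>C\<close> on the diagonal and \<open>x\<close> in the
  corner is positive, and so is its image, which again has C times the identity on the diagonal.
  Cauchy-Schwarz for that image bounds its corner \<open>f x\<close>.\<close>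

lemma unital_cp_bound:
  assumes B: "opsys_on X B" and D: "opsys_on Y D" and f: "cp_map B D f" "f (op_id X) = op_id Y"
    and x: "x \<in> B" "op_bound C x"
  shows "op_bound C (f x)"
proof (rule op_boundI[OF op_boundD[OF x(2)]])
  have lin: "f (op_scale c x) = op_scale c (f x)" if "x \<in> B" for c x
    using f that by (auto simp: cp_map_def linear_map_on_def)
  let ?A = "\<lambda>i j. if i = j then op_scale (complex_of_real C) (op_id X) else if i = 0 then x else op_adj x :: 'a oper"
  let ?M = "block 2 (\<lambda>i j. f (?A i j))"
  have "op_pos (block 2 ?A)"
    by (rule op_pos_block_bound[OF x(2)]) (use opsys_on_bounded[OF B x(1)] in \<open>auto simp: bounded_ops_def\<close>)
  moreover have "?A i j \<in> B" for i j
    using x opsys_on_id[OF B] opsys_on_scale[OF B] opsys_on_adj[OF B] by auto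
  ultimately have pos: "op_pos ?M"
    using f(1)[unfolded cp_map_def, THEN conjunct2, THEN conjunct2, rule_format, of 2 ?A] by blast
  fix F :: "'b set" and \<xi> \<eta> :: "'b \<Rightarrow> complex" assume F: "finite F"
  let ?G = "{..<2::nat} \<times> F"
  \<comment> \<open>\<xi> is placed in the first copy and \<eta> in the second, so the form of the 2
    by 2 matrix sees only the corner.\<close>
  let ?\<xi> = "\<lambda>z. if fst z = (0::nat) then \<xi> (snd z) else 0"
  let ?\<eta> = "\<lambda>z. if fst z = (1::nat) then \<eta> (snd z) else 0"
  have G: "finite ?G" using F by simp
  have form: "op_form ?M ?G u v = (\<Sum>i<2. \<Sum>j<2. op_form (f (?A i j)) F (\<lambda>x. u (i, x)) (\<lambda>x. v (j, x)))" for u v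
  proof -
    have "op_form ?M ?G u v = (\<Sum>i<2. \<Sum>x\<in>F. \<Sum>j<2. \<Sum>y\<in>F. cnj (u (i, x)) * ?M (i, x) (j, y) * v (j, y))"
      by (simp add: op_form_def sum.cartesian_product' split_def)
    also have "\<dots> = (\<Sum>i<2. \<Sum>j<2. \<Sum>x\<in>F. \<Sum>y\<in>F. cnj (u (i, x)) * ?M (i, x) (j, y) * v (j, y))"
      by (intro sum.cong refl sum.swap)
    finally show ?thesis by (simp add: op_form_def block_def)
  qed
  have z: "op_form T F (\<lambda>_. 0) v = 0" "op_form T F u (\<lambda>_. 0) = 0" for T u v
    by (simp_all add: op_form_def)
  have d: "Re (op_form (f (op_scale (complex_of_real C) (op_id X))) F u u) \<le> C * (L2_set (\<lambda>x. cmod (u x)) F)\<^sup>2" for u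
    unfolding lin[OF opsys_on_id[OF B]] f(2) op_form_scale op_form_id[OF F] L2_set_sq
    using op_boundD[OF x(2)] F by (auto intro!: mult_left_mono sum_mono2)
  have "(cmod (op_form (f x) F \<xi> \<eta>))\<^sup>2 = (cmod (op_form ?M ?G ?\<xi> ?\<eta>))\<^sup>2"
    unfolding form by (simp add: numeral_2_eq_2 z)
  also have "\<dots> \<le> Re (op_form ?M ?G ?\<xi> ?\<xi>) * Re (op_form ?M ?G ?\<eta> ?\<eta>)"
    by (rule op_pos_cauchy_schwarz[OF pos G])
  also have "\<dots> = Re (op_form (f (op_scale (complex_of_real C) (op_id X))) F \<xi> \<xi>)
      * Re (op_form (f (op_scale (complex_of_real C) (op_id X))) F \<eta> \<eta>)"
    unfolding form by (simp add: numeral_2_eq_2 z)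
  also have "\<dots> \<le> (C * (L2_set (\<lambda>x. cmod (\<xi> x)) F)\<^sup>2) * (C * (L2_set (\<lambda>x. cmod (\<eta> x)) F)\<^sup>2)"
  proof (intro mult_mono d)
    show "0 \<le> Re (op_form (f (op_scale (complex_of_real C) (op_id X))) F \<eta> \<eta>)"
      using op_pos_form(1)[OF pos G, of ?\<eta>] unfolding form by (simp add: numeral_2_eq_2 z)
  qed (use op_boundD[OF x(2)] in simp)
  also have "\<dots> = (C * L2_set (\<lambda>x. cmod (\<xi> x)) F * L2_set (\<lambda>x. cmod (\<eta> x)) F)\<^sup>2"
    by (simp add: power_mult_distrib power2_eq_square)
  finally show "cmod (op_form (f x) F \<xi> \<eta>) \<le> C * L2_set (\<lambda>x. cmod (\<xi> x)) F * L2_set (\<lambda>x. cmod (\<eta> x)) F"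
    by (rule power2_le_imp_le) (use op_boundD[OF x(2)] in simp)
qed

text \<open>A compression V* D V, where V sends the basis vector z to the sum of the vectors (z, p)
  over p in \<open>P\<close>: the test vector is made constant along the fibres.\<close>

lemma op_pos_fibre_sum:
  assumes "op_pos D" "finite P"
  shows "op_pos (\<lambda>z w. \<Sum>p\<in>P. \<Sum>q\<in>P. D (z, p) (w, q))"
  unfolding op_pos_def
proof (intro allI impI)
  fix F \<xi> assume F: "finite (F :: 'a set)"
  have "op_form (\<lambda>z w. \<Sum>p\<in>P. \<Sum>q\<in>P. D (z, p) (w, q)) F \<xi> \<xi> =
      (\<Sum>z\<in>F. \<Sum>w\<in>F. \<Sum>p\<in>P. \<Sum>q\<in>P. cnj (\<xi> z) * D (z, p) (w, q) * \<xi> w)"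
    by (simp add: op_form_def sum_distrib_left sum_distrib_right)
  also have "\<dots> = (\<Sum>z\<in>F. \<Sum>p\<in>P. \<Sum>w\<in>F. \<Sum>q\<in>P. cnj (\<xi> z) * D (z, p) (w, q) * \<xi> w)"
    by (intro sum.cong refl sum.swap)
  also have "\<dots> = op_form D (F \<times> P) (\<xi> \<circ> fst) (\<xi> \<circ> fst)"
    by (simp add: op_form_def sum.cartesian_product' split_def)
  also have "\<dots> \<in> \<real>\<^sub>\<ge>\<^sub>0" using assms F by (simp add: op_pos_def)
  finally show "op_form (\<lambda>z w. \<Sum>p\<in>P. \<Sum>q\<in>P. D (z, p) (w, q)) F \<xi> \<xi> \<in> \<real>\<^sub>\<ge>\<^sub>0" .
qed

lemma cp_map_restrict:
  assumes B: "opsys_on X B" and into: "\<And>x. x \<in> B \<Longrightarrow> f x \<in> D"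
    and add: "\<And>x y. x \<in> B \<Longrightarrow> y \<in> B \<Longrightarrow> f (x + y) = f x + f y"
    and scale: "\<And>c x. x \<in> B \<Longrightarrow> f (op_scale c x) = op_scale c (f x)"
    and pos: "\<And>n A. (\<And>i j. i < n \<Longrightarrow> j < n \<Longrightarrow> A i j \<in> B) \<Longrightarrow> op_pos (block n A) \<Longrightarrow>
      op_pos (block n (\<lambda>i j. f (A i j)))"
  shows "cp_map B D (restrict f B)"
  unfolding cp_map_def linear_map_on_def
proof (intro conjI ballI allI impI)
  show "restrict f B \<in> B \<rightarrow>\<^sub>E D" using into by auto
  show "restrict f B (x + y) = restrict f B x + restrict f B y" if "x \<in> B" "y \<in> B" for x y
    using that opsys_on_add[OF B] add by simp
  show "restrict f B (op_scale c x) = op_scale c (restrict f B x)" if "x \<in> B" for c x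
    using that opsys_on_scale[OF B] scale by simp
  fix n A assume A: "\<forall>i<n. \<forall>j<n. A i j \<in> B" "op_pos (block n A)"
  have "block n (\<lambda>i j. restrict f B (A i j)) = block n (\<lambda>i j. f (A i j))"
    using A by (auto simp: block_def fun_eq_iff)
  with pos[of n A] A show "op_pos (block n (\<lambda>i j. restrict f B (A i j)))" by simp
qed

section \<open>The spatial coaction\<close>

lemma group_label_iff: "g = s - t + g' \<longleftrightarrow> - s + g = - t + (g' :: 'g::group_add)"
  by (metis add.assoc add_minus_cancel diff_conv_add_uminus minus_add_cancel)

text \<open>Two basis vectors at (s, g) and (t, g') are linked only if s^-1 g and t^-1 g' agree. So
  \<open>twist x\<close> is a direct sum of copies of \<open>x\<close>, one for each group element,
  and has the same bounds and the same positivity.\<close>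

lemma twist_direct_sum:
  "twist x = (\<lambda>z w. if z \<in> UNIV \<and> w \<in> UNIV \<and> - sum_list (fst (fst z)) + snd z = - sum_list (fst (fst w)) + snd w
     then x (fst z) (fst w) else 0)"
  by (auto simp: twist_def left_regular_def fun_eq_iff group_label_iff)

lemma twist_bound: "op_bound C x \<Longrightarrow> op_bound C (twist x)"
  unfolding twist_direct_sum
  by (rule direct_sum_bound[of C "\<lambda>_. x"]) (auto simp: inj_on_def op_boundD)

lemma twist_add: "twist (x + y) = twist x + twist y"
  and twist_diff: "twist (x - y) = twist x - twist y"
  and twist_scale: "twist (op_scale c x) = op_scale c (twist x)"
  by (auto simp: twist_def fun_eq_iff op_scale_def algebra_simps)

lemma block_twist_pos_iff:
  "op_pos (block n (\<lambda>i j. twist (A i j))) \<longleftrightarrow> op_pos (block n A)"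
proof
  let ?l = "\<lambda>z :: nat \<times> (('a list \<times> 'b) \<times> 'a). - sum_list (fst (fst (snd z))) + snd (snd z)"
  let ?f = "\<lambda>z :: nat \<times> (('a list \<times> 'b) \<times> 'a). (fst z, fst (snd z))"
  assume "op_pos (block n A)"
  then have "op_pos (\<lambda>z w. if z \<in> UNIV \<and> w \<in> UNIV \<and> ?l z = ?l w then (\<lambda>_. block n A) (?l z) (?f z) (?f w) else 0)"
    by (intro direct_sum_pos) (auto simp: inj_on_def)
  also have "\<dots> = block n (\<lambda>i j. twist (A i j))"
    by (auto simp: block_def twist_direct_sum fun_eq_iff)
  finally show "op_pos (block n (\<lambda>i j. twist (A i j)))" .
next
  \<comment> \<open>The positions with g equal to the group element of s carry the label 0;
    restricting to them recovers one copy of the matrix.\<close>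
  let ?f = "\<lambda>z :: nat \<times> 'a list \<times> 'b. (fst z, (snd z, sum_list (fst (snd z))))"
  assume "op_pos (block n (\<lambda>i j. twist (A i j)))"
  then have "op_pos (\<lambda>z w. if z \<in> UNIV \<and> w \<in> UNIV then block n (\<lambda>i j. twist (A i j)) (?f z) (?f w) else 0)"
    by (intro compression_pos) (auto simp: inj_on_def)
  also have "\<dots> = block n A"
    by (auto simp: block_def twist_direct_sum fun_eq_iff)
  finally show "op_pos (block n A)" .
qed

text \<open>The part of \<open>x\<close> of degree \<open>r\<close> with respect to the grading by \<open>\<Gamma>\<close>.\<close>

definition diag_part :: "'g::group_add \<Rightarrow> ('g list \<times> 'h) oper \<Rightarrow> ('g list \<times> 'h) oper" where
  "diag_part r x = (\<lambda>z w. if sum_list (fst z) - sum_list (fst w) = r then x z w else 0)"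

text \<open>The blocks of \<open>twist x\<close> along the second tensor factor are the homogeneous
  parts of \<open>x\<close>. Hence \<open>tensor_id f\<close> acts on \<open>twist x\<close> by
  applying \<open>f\<close> to homogeneous parts, and a comap is a map that commutes with
  \<open>diag_part\<close>.\<close>

lemma twist_block: "(\<lambda>i j. twist x (i, g) (j, h)) = diag_part (g - h) x"
  by (auto simp: twist_def left_regular_def diag_part_def fun_eq_iff algebra_simps)

lemma twist_apply: "twist x (i, g) (j, h) = diag_part (g - h) x i j"
  by (simp flip: twist_block)

lemma diag_part_add: "diag_part r (x + y) = diag_part r x + diag_part r y"
  and diag_part_diff: "diag_part r (x - y) = diag_part r x - diag_part r y"
  and diag_part_scale: "diag_part r (op_scale c x) = op_scale c (diag_part r x)"
  and diag_part_zero: "diag_part r 0 = 0"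
  by (auto simp: diag_part_def fun_eq_iff op_scale_def)

lemma diag_part_sum: "diag_part r (sum f I) = (\<Sum>i\<in>I. diag_part r (f i))"
  by (induction I rule: infinite_finite_induct)
    (simp_all only: sum.infinite sum.empty sum.insert diag_part_zero diag_part_add not_False_eq_True)

text \<open>The part of degree \<open>r\<close> is the block of \<open>twist x\<close> at the pair
  r, 0, so it inherits the bound of \<open>twist x\<close>.\<close>

lemma diag_part_bound:
  fixes x :: "('g::group_add list \<times> 'h) oper"
  assumes "op_bound C x" shows "op_bound C (diag_part r x)"
proof -
  have "op_bound C (\<lambda>z w. if z \<in> UNIV \<and> w \<in> UNIV then twist x (z, r) (w, 0) else 0)"
    by (rule compression_bound[OF twist_bound[OF assms]]) (auto simp: inj_on_def)
  then show ?thesis by (simp add: twist_apply)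
qed

lemma tensor_id_twist: "tensor_id f (twist x) = (\<lambda>z w. f (diag_part (snd z - snd w) x) (fst z) (fst w))"
  by (auto simp: tensor_id_def twist_block fun_eq_iff)

lemma left_regular_in: "left_regular s \<in> reduced_group_algebra"
  unfolding reduced_group_algebra_def op_span_eq_span
  by (intro op_closure_incl oper.span_base) simp

lemma min_tensor_gen: "v \<in> V \<Longrightarrow> w \<in> W \<Longrightarrow> op_tensor v w \<in> op_span {op_tensor v w |v w. v \<in> V \<and> w \<in> W}"
  unfolding op_span_eq_span by (intro oper.span_base) blast

section \<open>Coactions and comaps in terms of the grading\<close>

lemma coaction_twist:
  fixes B :: "('g::group_add list \<times> 'h) oper set"
  assumes B: "opsys_on X B" and diag: "\<And>x r. x \<in> B \<Longrightarrow> diag_part r x \<in> B"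
    and tensor: "\<And>x. x \<in> B \<Longrightarrow> twist x \<in> min_tensor B reduced_group_algebra"
  shows "coaction B (restrict twist B)"
  unfolding coaction_def
proof (intro conjI allI impI ballI)
  show "opsys B" using B by (auto simp: opsys_def)
  show "cp_map B (min_tensor B reduced_group_algebra) (restrict twist B)"
    by (rule cp_map_restrict[OF B tensor]) (simp_all add: twist_add twist_scale block_twist_pos_iff)
next
  fix n and A :: "nat \<Rightarrow> nat \<Rightarrow> ('g list \<times> 'h) oper"
  assume A: "\<forall>i<n. \<forall>j<n. A i j \<in> B" and pos: "op_pos (block n (\<lambda>i j. restrict twist B (A i j)))"
  have "block n (\<lambda>i j. restrict twist B (A i j)) = block n (\<lambda>i j. twist (A i j))"
    using A by (auto simp: block_def fun_eq_iff)
  with pos show "op_pos (block n A)" by (simp add: block_twist_pos_iff)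
next
  fix Y :: "('g list \<times> 'h) set" assume "opsys_on Y B"
  then have "op_id Y \<in> B" by (rule opsys_on_id)
  moreover have "twist (op_id Y) = op_id (Y \<times> (UNIV :: 'g set))"
    by (auto simp: twist_direct_sum op_id_def fun_eq_iff)
  ultimately show "restrict twist B (op_id Y) = op_id (Y \<times> UNIV)" by simp
next
  fix b assume b: "b \<in> B"
  \<comment> \<open>The blocks of \<open>twist b\<close> are homogeneous parts of \<open>b\<close>
    and lie in \<open>B\<close>, so the value \<open>undefined\<close> of the restricted map outside
    \<open>B\<close> never occurs.\<close>
  have "tensor_id (restrict twist B) (twist b) = tensor_id twist (twist b)"
    unfolding tensor_id_twist using diag[OF b] by simp
  also have "\<dots> = id_tensor_comult (twist b)"
    by (auto simp: tensor_id_twist id_tensor_comult_def comult_def twist_apply diag_part_def fun_eq_iff algebra_simps)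
  finally show "tensor_id (restrict twist B) (restrict twist B b) = id_tensor_comult (restrict twist B b)"
    using b by simp
qed

text \<open>The index map is the identity of a one-element family, and the comap condition, read
  block by block, is \<open>comm\<close>.\<close>

lemma cofamily_single:
  fixes B D :: "('g::group_add list \<times> 'h) oper set"
  assumes B: "opsys_on X B" and cB: "coaction B (restrict twist B)" and f: "cp_map B D f"
    and comm: "\<And>x r. x \<in> B \<Longrightarrow> f (diag_part r x) = diag_part r (f x)"
  shows "cofamily B (restrict twist B) D (restrict twist D) {(B, f)}"
  unfolding cofamily_def
proof (intro conjI)
  show "\<forall>(V, \<psi>)\<in>{(B, f)}. subsystem V B \<and> cp_map V D \<psi>"
    using B f by (auto simp: subsystem_def)
  have "restrict twist B ` B \<subseteq> min_tensor B reduced_group_algebra"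
    using cB by (auto simp: coaction_def cp_map_def)
  moreover have "tensor_id f (restrict twist B b) = restrict twist D (f b)" if "b \<in> B" for b
  proof -
    have "f b \<in> D" using f that by (auto simp: cp_map_def)
    then show ?thesis using that
      by (auto simp: tensor_id_twist comm fun_eq_iff twist_apply)
  qed
  ultimately show "\<exists>\<delta>\<in>{(B, f)} \<rightarrow> {(B, f)}. \<forall>i\<in>{(B, f)}.
      restrict twist B ` fst i \<subseteq> min_tensor (fst (\<delta> i)) reduced_group_algebra \<and>
      (\<forall>b\<in>fst i. tensor_id (snd (\<delta> i)) (restrict twist B b) = restrict twist D (snd i b))"
    by (intro bexI[of _ "\<lambda>i. i"]) auto
qed

section \<open>The crossed product\<close>

locale covariant =
  fixes \<alpha> :: "'g::group_add \<Rightarrow> 'a::unital_cstar_algebra \<Rightarrow> 'a" and \<pi> :: "'a \<Rightarrow> 'h oper"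
  assumes action: "cstar_action \<alpha>" and faithful: "faithful_rep \<pi>"
begin

lemma rep: "star_rep \<pi>" and inj: "inj \<pi>"
  using faithful by (simp_all add: faithful_rep_star_rep)

lemma
  shows alpha_add: "\<alpha> s (a + b) = \<alpha> s a + \<alpha> s b"
    and alpha_scaleC: "\<alpha> s (c *\<^sub>C a) = c *\<^sub>C \<alpha> s a"
    and alpha_mult: "\<alpha> s (a * b) = \<alpha> s a * \<alpha> s b"
    and alpha_star: "\<alpha> s (star a) = star (\<alpha> s a)"
    and alpha_0: "\<alpha> 0 a = a"
    and alpha_comp: "\<alpha> (s + t) a = \<alpha> s (\<alpha> t a)"
  using action by (auto simp: cstar_action_def star_automorphism_def)

lemma alpha_minus_cancel [simp]: "\<alpha> s (\<alpha> (- s) a) = a" "\<alpha> (- s) (\<alpha> s a) = a"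
  by (simp_all add: alpha_comp[symmetric] alpha_0)

lemma alpha_zero [simp]: "\<alpha> s 0 = 0"
  using alpha_add[of s 0 0] by simp

lemma alpha_one [simp]: "\<alpha> s 1 = 1"
proof -
  have "\<alpha> s 1 * \<alpha> s (\<alpha> (- s) 1) = \<alpha> s (\<alpha> (- s) 1)"
    unfolding alpha_mult[symmetric] by simp
  then show ?thesis by simp
qed

lemma alpha_diff: "\<alpha> s (a - b) = \<alpha> s a - \<alpha> s b"
  using alpha_add[of s "a - b" b] by simp

lemma alpha_sum: "\<alpha> s (sum f I) = (\<Sum>i\<in>I. \<alpha> s (f i))"
  by (induction I rule: infinite_finite_induct) (auto simp: alpha_add)

lemma rep_alpha: "star_rep (\<lambda>a. \<pi> (\<alpha> s a))"
  using rep unfolding star_rep_def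
  by (auto simp: alpha_add alpha_scaleC alpha_mult alpha_star)

text \<open>\<pi> is isometric and the algebra is complete: elements whose images approximate
  \<open>T\<close> form a Cauchy sequence. Both operator systems keep their blocks in the algebra
  under closure for this reason.\<close>

lemma range_rep_closed:
  assumes "\<And>e. 0 < e \<Longrightarrow> \<exists>a. op_bound e (T - \<pi> a)"
  shows "T \<in> range \<pi>"
proof -
  have "\<forall>n. \<exists>a. op_bound (inverse (real (Suc n))) (T - \<pi> a)" using assms by simp
  then obtain a where a: "op_bound (inverse (real (Suc n))) (T - \<pi> (a n))" for n by metis
  have le: "norm (a m - a n) \<le> inverse (real (Suc m)) + inverse (real (Suc n))" for m n
  proof (rule faithful_rep_isometric[OF faithful])
    have "op_bound (inverse (real (Suc n)) + inverse (real (Suc m))) ((T - \<pi> (a n)) - (T - \<pi> (a m)))"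
      by (intro op_bound_diff a)
    then show "op_bound (inverse (real (Suc m)) + inverse (real (Suc n))) (\<pi> (a m - a n))"
      by (simp add: rep_diff[OF rep] add.commute)
  qed
  have small: "\<exists>N. \<forall>n\<ge>N. inverse (real (Suc n)) < e" if e: "0 < e" for e :: real
  proof -
    obtain N where N: "inverse (real (Suc N)) < e" using reals_Archimedean[OF e] by blast
    have "inverse (real (Suc n)) \<le> inverse (real (Suc N))" if "n \<ge> N" for n
      using that by (intro le_imp_inverse_le) auto
    with N show ?thesis by (meson le_less_trans)
  qed
  have "Cauchy a"
  proof (rule metric_CauchyI)
    fix e :: real assume "0 < e"
    then obtain N where N: "\<forall>n\<ge>N. inverse (real (Suc n)) < e / 2" using small[of "e / 2"] by auto
    have "dist (a m) (a n) < e" if "m \<ge> N" "n \<ge> N" for m n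
      using le[of m n] N[rule_format, OF that(1)] N[rule_format, OF that(2)] by (simp add: dist_norm)
    then show "\<exists>M. \<forall>m\<ge>M. \<forall>n\<ge>M. dist (a m) (a n) < e" by blast
  qed
  then obtain b where b: "a \<longlonglongrightarrow> b" using Cauchy_convergent_iff convergent_def by blast
  have "op_bound e (T - \<pi> b)" if e: "0 < e" for e
  proof -
    obtain N where N: "\<forall>n\<ge>N. inverse (real (Suc n)) < e / 2" using small[of "e / 2"] e by auto
    obtain M where M: "\<forall>n\<ge>M. norm (a n - b) < e / 2" using LIMSEQ_D[OF b, of "e / 2"] e by auto
    let ?n = "max M N"
    have "op_bound (e / 2) (T - \<pi> (a ?n))"
      by (rule op_bound_mono[OF a]) (use N in \<open>simp add: less_imp_le\<close>)
    moreover have "op_bound (e / 2) (\<pi> (a ?n) - \<pi> b)"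
      unfolding rep_diff[OF rep, symmetric]
      by (rule op_bound_mono[OF rep_contractive[OF rep]]) (use M in \<open>simp add: less_imp_le\<close>)
    ultimately have "op_bound (e / 2 + e / 2) ((T - \<pi> (a ?n)) + (\<pi> (a ?n) - \<pi> b))"
      by (rule op_bound_add)
    then show ?thesis by simp
  qed
  then have "op_bound 0 (T - \<pi> b)" by (rule op_bound_closed) auto
  then have "T = \<pi> b" using op_bound_entry[of 0 "T - \<pi> b"] by (auto simp: fun_eq_iff)
  then show ?thesis by simp
qed

subsection \<open>Operators with blocks in the algebra\<close>

definition blockwise :: "('g list \<times> 'h) oper set" where
  "blockwise = range (ampl \<pi> UNIV)"

definition entry :: "('g list \<times> 'h) oper \<Rightarrow> 'g list \<Rightarrow> 'g list \<Rightarrow> 'a" where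
  "entry x s t = inv \<pi> (\<lambda>h k. x (s, h) (t, k))"

lemma entry_ampl: "entry (ampl \<pi> UNIV c) = c"
  by (simp add: entry_def ampl_apply inv_f_f[OF inj] fun_eq_iff)

lemma entry_ampl_finite: "entry (ampl \<pi> F c) s t = (if s \<in> F \<and> t \<in> F then c s t else 0)"
proof -
  have "(\<lambda>h k. ampl \<pi> F c (s, h) (t, k)) = \<pi> (if s \<in> F \<and> t \<in> F then c s t else 0)"
    by (auto simp: ampl_apply rep_zero[OF rep] fun_eq_iff)
  then show ?thesis by (simp add: entry_def inv_f_f[OF inj])
qed

lemma ampl_UNIV_entry: "x \<in> blockwise \<Longrightarrow> ampl \<pi> UNIV (entry x) = x"
  by (auto simp: blockwise_def entry_ampl)

lemma ampl_eq_UNIV: "ampl \<pi> F c = ampl \<pi> UNIV (\<lambda>s t. if s \<in> F \<and> t \<in> F then c s t else 0)"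
  by (auto simp: ampl_def fun_eq_iff rep_zero[OF rep])

lemma ampl_in_blockwise: "ampl \<pi> F c \<in> blockwise"
  by (subst ampl_eq_UNIV) (simp add: blockwise_def)

lemma blockwise_iff: "x \<in> blockwise \<longleftrightarrow> (\<forall>s t. (\<lambda>h k. x (s, h) (t, k)) \<in> range \<pi>)"
proof
  assume "x \<in> blockwise"
  then show "\<forall>s t. (\<lambda>h k. x (s, h) (t, k)) \<in> range \<pi>" by (auto simp: blockwise_def ampl_apply)
next
  assume "\<forall>s t. (\<lambda>h k. x (s, h) (t, k)) \<in> range \<pi>"
  then have "\<forall>s t. \<exists>a. (\<lambda>h k. x (s, h) (t, k)) = \<pi> a" by blast
  then obtain c where "(\<lambda>h k. x (s, h) (t, k)) = \<pi> (c s t)" for s t by metis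
  then have "x (s, h) (t, k) = \<pi> (c s t) h k" for s h t k by metis
  then have "x = ampl \<pi> UNIV c" by (auto simp: ampl_def fun_eq_iff)
  then show "x \<in> blockwise" by (simp add: blockwise_def)
qed

lemma ampl_UNIV_add: "ampl \<pi> UNIV c + ampl \<pi> UNIV d = ampl \<pi> UNIV (\<lambda>s t. c s t + d s t)"
  by (auto simp: ampl_def fun_eq_iff rep_add[OF rep])

lemma ampl_UNIV_scale: "op_scale z (ampl \<pi> UNIV c) = ampl \<pi> UNIV (\<lambda>s t. z *\<^sub>C c s t)"
  by (auto simp: ampl_def fun_eq_iff rep_scaleC[OF rep] op_scale_def)

lemma ampl_UNIV_zero: "ampl \<pi> UNIV (\<lambda>s t. 0) = 0"
  by (auto simp: ampl_def fun_eq_iff rep_zero[OF rep])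

lemma blockwise_subspace: "oper.subspace blockwise"
  by (rule oper.subspaceI)
    (auto simp: blockwise_def ampl_UNIV_add ampl_UNIV_scale simp flip: ampl_UNIV_zero)

lemma entry_add: "x \<in> blockwise \<Longrightarrow> y \<in> blockwise \<Longrightarrow> entry (x + y) s t = entry x s t + entry y s t"
  by (auto simp: blockwise_def ampl_UNIV_add entry_ampl)

lemma entry_scale: "x \<in> blockwise \<Longrightarrow> entry (op_scale z x) s t = z *\<^sub>C entry x s t"
  by (auto simp: blockwise_def ampl_UNIV_scale entry_ampl)

lemma blockwise_closed: "op_closure blockwise \<subseteq> blockwise"
proof
  fix T assume T: "T \<in> op_closure blockwise"
  show "T \<in> blockwise"
    unfolding blockwise_iff
  proof (intro allI range_rep_closed)
    fix s t and e :: real assume "0 < e"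
    then obtain S where S: "S \<in> blockwise" "op_bound e (T - S)" using op_closureE[OF T] by blast
    then obtain a where "(\<lambda>h k. S (s, h) (t, k)) = \<pi> a" unfolding blockwise_iff by blast
    then have "(\<lambda>h k. (T - S) (s, h) (t, k)) = (\<lambda>h k. T (s, h) (t, k)) - \<pi> a"
      by (simp add: fun_eq_iff fun_diff_def)
    with ampl_single_entry_bound[OF S(2), of s t]
    show "\<exists>a. op_bound e ((\<lambda>h k. T (s, h) (t, k)) - \<pi> a)" by (metis (no_types))
  qed
qed

lemma op_closure_mono: "V \<subseteq> W \<Longrightarrow> op_closure V \<subseteq> op_closure W"
  by (auto simp: op_closure_def) blast

lemma matrix_module_ampl:
  "matrix_module \<pi> \<alpha> (ampl \<pi> UNIV c) b = ampl \<pi> UNIV (\<lambda>s t. c s t * \<alpha> (- sum_list t) b)"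
  by (auto simp: matrix_module_def ampl_apply rep_mult[OF rep] fun_eq_iff)

text \<open>On entries both module structures are right multiplication in column t by the element
  \<open>\<alpha> (- sum_list t) b\<close>. Elements are determined by their entries, so the axioms
  are checked entry by entry.\<close>

lemma right_module_blockwise:
  assumes "B \<subseteq> blockwise" "\<And>x a. x \<in> B \<Longrightarrow> m x a = matrix_module \<pi> \<alpha> x a"
    and "\<And>x a. x \<in> B \<Longrightarrow> m x a \<in> B"
    and add: "\<And>x y. x \<in> B \<Longrightarrow> y \<in> B \<Longrightarrow> x + y \<in> B" and scale: "\<And>c x. x \<in> B \<Longrightarrow> op_scale c x \<in> B"
  shows "right_module B m"
proof -
  have m: "m x a \<in> B" "m x a = matrix_module \<pi> \<alpha> (ampl \<pi> UNIV (entry x)) a"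
      "x \<in> blockwise" "ampl \<pi> UNIV (entry x) = x" if "x \<in> B" for x a
    using that assms by (auto simp: ampl_UNIV_entry subsetD)
  have c: "entry (m x a) s t = entry x s t * \<alpha> (- sum_list t) a" if "x \<in> B" for x a s t
    using m(2)[OF that] by (simp add: matrix_module_ampl entry_ampl)
  have eq: "x = y" if "x \<in> blockwise" "y \<in> blockwise" "\<And>s t. entry x s t = entry y s t" for x y
    using that by (metis ampl_UNIV_entry ext)
  have bw: "m x a \<in> blockwise" if "x \<in> B" for x a by (rule m(3)[OF m(1)[OF that]])
  note simps = c entry_add entry_scale m(1,3) bw add scale alpha_add alpha_scaleC alpha_mult
    oper.subspace_add[OF blockwise_subspace] oper.subspace_scale[OF blockwise_subspace]
    mult_scaleC_left mult_scaleC_right distrib_left distrib_right mult.assoc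
  show ?thesis
    unfolding right_module_def linear_map_on_def
  proof (intro conjI allI ballI)
    show "m x a \<in> B" if "x \<in> B" for x a by (rule m(1)[OF that])
    show "m (x + y) a = m x a + m y a" if "x \<in> B" "y \<in> B" for x y a
      by (rule eq) (simp_all add: simps that)
    show "m (op_scale z x) a = op_scale z (m x a)" if "x \<in> B" for x z a
      by (rule eq) (simp_all add: simps that)
    show "m x (a + b) = m x a + m x b" if "x \<in> B" for x a b
      by (rule eq) (simp_all add: simps that)
    show "m x (z *\<^sub>C a) = op_scale z (m x a)" if "x \<in> B" for x z a
      by (rule eq) (simp_all add: simps that)
    show "m x (a * b) = m (m x a) b" if "x \<in> B" for x a b
      by (rule eq) (simp_all add: simps that)
    show "m x 1 = x" if "x \<in> B" for x
      by (rule eq) (simp_all add: simps that)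
  qed
qed

section \<open>The crossed product as operator system, comodule and module\<close>

abbreviation "\<A> \<equiv> crossed_product \<pi> \<alpha>"

abbreviation \<M> :: "'g list set \<Rightarrow> ('g list \<times> 'h) oper set" where
  "\<M> \<equiv> matrix_algebra \<pi>"

definition singles :: "('g list \<times> 'h) set" where
  "singles = range (\<lambda>p. [p]) \<times> UNIV"

definition crossed_entry :: "'a \<Rightarrow> 'g \<Rightarrow> 'g list \<Rightarrow> 'g list \<Rightarrow> 'a" where
  "crossed_entry a s u v = (if \<exists>p q. u = [p] \<and> v = [q] \<and> p = s + q then \<alpha> (- sum_list u) a else 0)"

lemma crossed_elem_ampl: "crossed_elem \<pi> \<alpha> a s = ampl \<pi> UNIV (crossed_entry a s)"
  unfolding crossed_elem_def ampl_def crossed_entry_def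
  by (intro ext) (auto simp: split_def rep_zero[OF rep])

text \<open>Up to a permutation of the columns by \<open>s\<close>, the operator is the direct sum
  over p of the images of \<open>a\<close> under \<open>\<pi> \<circ> \<alpha> (- p)\<close>, each a
  contractive representation.\<close>

lemma crossed_elem_bound: "op_bound (norm a) (crossed_elem \<pi> \<alpha> a s)"
proof -
  have "op_bound (norm a) (\<lambda>z w. if z \<in> singles \<and> w \<in> singles \<and> hd (fst z) = s + hd (fst w)
      then \<pi> (\<alpha> (- hd (fst z)) a) (snd z) (snd w) else 0)"
    by (rule direct_sum_bound[where T = "\<lambda>p. \<pi> (\<alpha> (- p) a)"])
      (auto simp: singles_def inj_on_def intro: rep_contractive[OF rep_alpha])
  also have "(\<lambda>z w. if z \<in> singles \<and> w \<in> singles \<and> hd (fst z) = s + hd (fst w)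
      then \<pi> (\<alpha> (- hd (fst z)) a) (snd z) (snd w) else 0) = crossed_elem \<pi> \<alpha> a s"
    by (auto simp: crossed_elem_def singles_def fun_eq_iff)
  finally show ?thesis .
qed

lemma crossed_elem_supp: "crossed_elem \<pi> \<alpha> a s z w \<noteq> 0 \<Longrightarrow> z \<in> singles \<and> w \<in> singles"
  by (cases z; cases w) (auto simp: crossed_elem_def singles_def split: if_splits)

lemma crossed_elem_bounded: "crossed_elem \<pi> \<alpha> a s \<in> bounded_ops singles"
  unfolding bounded_ops_def using crossed_elem_bound crossed_elem_supp by blast

lemma crossed_elem_one: "crossed_elem \<pi> \<alpha> 1 0 = op_id singles"
  by (auto simp: crossed_elem_def op_id_def singles_def rep_one[OF rep] fun_eq_iff)

lemma crossed_elem_adj: "op_adj (crossed_elem \<pi> \<alpha> a s) = crossed_elem \<pi> \<alpha> (\<alpha> (- s) (star a)) (- s)"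
proof (intro ext, clarify)
  fix u h v k
  have 1: "cnj (\<pi> b k h) = \<pi> (star b) h k" for b
    unfolding rep_star[OF rep] op_adj_def ..
  show "op_adj (crossed_elem \<pi> \<alpha> a s) (u, h) (v, k) = crossed_elem \<pi> \<alpha> (\<alpha> (- s) (star a)) (- s) (u, h) (v, k)"
  proof (cases "\<exists>p. u = [p] \<and> v = [s + p]")
    case True
    then obtain p where p: "u = [p]" "v = [s + p]" by blast
    show ?thesis
      by (simp add: op_adj_def crossed_elem_def p 1 alpha_star[symmetric] alpha_comp[symmetric] minus_add)
  next
    case False
    have "p = - s + q \<longleftrightarrow> q = s + p" for p q by (metis add_minus_cancel minus_add_cancel)
    with False show ?thesis by (auto simp: op_adj_def crossed_elem_def)
  qed
qed

lemma crossed_elem_add: "crossed_elem \<pi> \<alpha> (a + b) s = crossed_elem \<pi> \<alpha> a s + crossed_elem \<pi> \<alpha> b s"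
  and crossed_elem_scaleC: "crossed_elem \<pi> \<alpha> (c *\<^sub>C a) s = op_scale c (crossed_elem \<pi> \<alpha> a s)"
  and crossed_elem_diff: "crossed_elem \<pi> \<alpha> (a - b) s = crossed_elem \<pi> \<alpha> a s - crossed_elem \<pi> \<alpha> b s"
  and crossed_elem_zero: "crossed_elem \<pi> \<alpha> 0 s = 0"
  by (auto simp: crossed_elem_def fun_eq_iff alpha_add alpha_scaleC alpha_diff rep_add[OF rep]
      rep_scaleC[OF rep] rep_diff[OF rep] rep_zero[OF rep] op_scale_def)

lemma crossed_elem_sum: "crossed_elem \<pi> \<alpha> (sum f I) s = (\<Sum>i\<in>I. crossed_elem \<pi> \<alpha> (f i) s)"
  by (induction I rule: infinite_finite_induct)
    (simp_all only: sum.infinite sum.empty sum.insert crossed_elem_zero crossed_elem_add not_False_eq_True)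

lemma crossed_elem_in_span: "crossed_elem \<pi> \<alpha> a s \<in> op_span {crossed_elem \<pi> \<alpha> a s |a s. True}"
  unfolding op_span_eq_span by (intro oper.span_base) blast

lemma crossed_elem_in: "crossed_elem \<pi> \<alpha> a s \<in> \<A>"
  unfolding crossed_product_def by (rule op_closure_incl[OF crossed_elem_in_span])

lemma opsys_crossed: "opsys_on singles \<A>"
  unfolding crossed_product_def
proof (rule opsys_on_closed_span)
  show "{crossed_elem \<pi> \<alpha> a s |a s. True} \<subseteq> bounded_ops singles"
    using crossed_elem_bounded by auto
  show "op_id singles \<in> op_span {crossed_elem \<pi> \<alpha> a s |a s. True}"
    unfolding crossed_elem_one[symmetric] by (rule crossed_elem_in_span)
  show "op_adj T \<in> op_span {crossed_elem \<pi> \<alpha> a s |a s. True}"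
    if "T \<in> {crossed_elem \<pi> \<alpha> a s |a s. True}" for T
  proof -
    from that obtain a s where "T = crossed_elem \<pi> \<alpha> a s" by blast
    then show ?thesis unfolding crossed_elem_adj by (simp only: crossed_elem_adj crossed_elem_in_span)
  qed
qed

lemma span_crossed_induct:
  assumes "T \<in> op_span {crossed_elem \<pi> \<alpha> a s |a s. True}"
    and "oper.subspace V" "\<And>a s. crossed_elem \<pi> \<alpha> a s \<in> V"
  shows "T \<in> V"
  using oper.span_minimal[OF _ assms(2), of "{crossed_elem \<pi> \<alpha> a s |a s. True}"] assms(1,3)
  unfolding op_span_eq_span by blast

lemma crossed_blockwise: "\<A> \<subseteq> blockwise"
proof -
  have "op_span {crossed_elem \<pi> \<alpha> a s |a s. True} \<subseteq> blockwise"
    by (intro subsetI, erule span_crossed_induct[OF _ blockwise_subspace])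
      (simp add: crossed_elem_ampl ampl_in_blockwise)
  then show ?thesis
    unfolding crossed_product_def using op_closure_mono blockwise_closed by blast
qed

lemma diag_part_crossed_elem:
  "diag_part r (crossed_elem \<pi> \<alpha> a s) = (if r = s then crossed_elem \<pi> \<alpha> a s else 0)"
  by (auto simp: diag_part_def crossed_elem_def fun_eq_iff)

lemma diag_part_crossed:
  assumes "x \<in> \<A>" shows "diag_part r x \<in> \<A>"
  unfolding crossed_product_def
proof (rule op_closure_map[OF assms[unfolded crossed_product_def], of "diag_part r" _ 1])
  fix S e
  show "diag_part r S \<in> op_closure (op_span {crossed_elem \<pi> \<alpha> a s |a s. True})"
    if S: "S \<in> op_span {crossed_elem \<pi> \<alpha> a s |a s. True}"
  proof -
    have "S \<in> {S. diag_part r S \<in> \<A>}"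
    proof (rule span_crossed_induct[OF S])
      show "oper.subspace {S. diag_part r S \<in> \<A>}"
        by (rule oper.subspaceI)
          (auto simp: diag_part_add diag_part_scale diag_part_zero opsys_on_zero[OF opsys_crossed]
            opsys_on_add[OF opsys_crossed] opsys_on_scale[OF opsys_crossed])
      show "crossed_elem \<pi> \<alpha> a s \<in> {S. diag_part r S \<in> \<A>}" for a s
        by (simp add: diag_part_crossed_elem crossed_elem_in opsys_on_zero[OF opsys_crossed])
    qed
    then show ?thesis by (simp add: crossed_product_def)
  qed
  show "op_bound (1 * e) (diag_part r x - diag_part r S)" if "op_bound e (x - S)"
    using diag_part_bound[OF that] by (simp add: diag_part_diff)
qed simp

lemma twist_crossed:
  assumes "x \<in> \<A>" shows "twist x \<in> min_tensor \<A> reduced_group_algebra"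
  unfolding min_tensor_def
proof (rule op_closure_map[OF assms[unfolded crossed_product_def], of twist _ 1])
  fix S e
  let ?G = "{op_tensor v w |v w. v \<in> \<A> \<and> w \<in> reduced_group_algebra}"
  show "twist S \<in> op_closure (op_span ?G)" if S: "S \<in> op_span {crossed_elem \<pi> \<alpha> a s |a s. True}"
  proof -
    have "S \<in> {S. twist S \<in> op_span ?G}"
    proof (rule span_crossed_induct[OF S])
      have "twist 0 = (0 :: (('g list \<times> 'h) \<times> 'g) oper)" by (auto simp: twist_def fun_eq_iff)
      then show "oper.subspace {S. twist S \<in> op_span ?G}"
        unfolding op_span_eq_span
        by (intro oper.subspaceI)
          (simp_all only: mem_Collect_eq twist_add twist_scale oper.span_zero oper.span_add oper.span_scale)
      show "crossed_elem \<pi> \<alpha> a s \<in> {S. twist S \<in> op_span ?G}" for a s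
        unfolding mem_Collect_eq twist_crossed_elem
        by (rule min_tensor_gen[OF crossed_elem_in left_regular_in])
    qed
    then show ?thesis by (simp add: op_closure_incl)
  qed
  show "op_bound (1 * e) (twist x - twist S)" if "op_bound e (x - S)"
    using twist_bound[OF that] by (simp add: twist_diff)
qed simp

lemma coaction_crossed: "coaction \<A> (crossed_coaction \<pi> \<alpha>)"
  unfolding crossed_coaction_def
  by (rule coaction_twist[OF opsys_crossed diag_part_crossed twist_crossed])

text \<open>\<open>crossed_elem \<pi> \<alpha> b 0\<close> is block diagonal over the lists of
  length one, where the two actions agree column by column. It is zero at the other lists, and there
  the columns of \<open>x\<close> vanish by the assumption on its support.\<close>

lemma crossed_module_eq:
  assumes x: "x \<in> bounded_ops singles"
  shows "crossed_module \<pi> \<alpha> x b = matrix_module \<pi> \<alpha> x b"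
proof (intro ext, clarify)
  fix s h t k
  let ?f = "\<lambda>z. x (s, h) z * crossed_elem \<pi> \<alpha> b 0 z (t, k)"
  have supp: "x z w = 0" if "w \<notin> singles" for z w using x that unfolding bounded_ops_iff by blast
  have "infsum ?f UNIV = infsum ?f (Pair t ` UNIV)"
    by (rule infsum_cong_neutral) (auto simp: crossed_elem_def image_iff split: if_splits)
  also have "\<dots> = infsum (?f \<circ> Pair t) UNIV"
    by (rule infsum_reindex) (auto simp: inj_on_def)
  also have "?f \<circ> Pair t = (\<lambda>j. x (s, h) (t, j) * \<pi> (\<alpha> (- sum_list t) b) j k)"
  proof (cases "\<exists>q. t = [q]")
    case True
    then show ?thesis by (auto simp: crossed_elem_def fun_eq_iff)
  next
    case False
    then have "x (s, h) (t, j) = 0" for j by (intro supp) (auto simp: singles_def)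
    then show ?thesis by (auto simp: fun_eq_iff)
  qed
  finally show "crossed_module \<pi> \<alpha> x b (s, h) (t, k) = matrix_module \<pi> \<alpha> x b (s, h) (t, k)"
    by (simp add: crossed_module_def matrix_module_def op_mult_def)
qed

lemma matrix_module_crossed_elem:
  "matrix_module \<pi> \<alpha> (crossed_elem \<pi> \<alpha> a s) b = crossed_elem \<pi> \<alpha> (a * \<alpha> s b) s"
proof -
  have "crossed_entry a s u v * \<alpha> (- sum_list v) b = crossed_entry (a * \<alpha> s b) s u v" for u v
    by (auto simp: crossed_entry_def alpha_mult alpha_comp[symmetric] minus_add add.assoc simp del: add_uminus_conv_diff)
  then show ?thesis by (simp add: crossed_elem_ampl matrix_module_ampl)
qed

lemma matrix_module_add:
  "x \<in> blockwise \<Longrightarrow> y \<in> blockwise \<Longrightarrow> matrix_module \<pi> \<alpha> (x + y) b = matrix_module \<pi> \<alpha> x b + matrix_module \<pi> \<alpha> y b"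
  by (auto simp: blockwise_def ampl_UNIV_add matrix_module_ampl distrib_right)

lemma matrix_module_scale:
  "x \<in> blockwise \<Longrightarrow> matrix_module \<pi> \<alpha> (op_scale c x) b = op_scale c (matrix_module \<pi> \<alpha> x b)"
  by (auto simp: blockwise_def ampl_UNIV_scale matrix_module_ampl mult_scaleC_left)

lemma matrix_module_zero: "matrix_module \<pi> \<alpha> 0 b = 0"
  by (simp add: ampl_UNIV_zero[symmetric] matrix_module_ampl)

lemma matrix_module_sum:
  "(\<And>i. i \<in> I \<Longrightarrow> f i \<in> blockwise) \<Longrightarrow> matrix_module \<pi> \<alpha> (sum f I) b = (\<Sum>i\<in>I. matrix_module \<pi> \<alpha> (f i) b)"
proof (induction I rule: infinite_finite_induct)
  case (insert i I)
  have fi: "f i \<in> blockwise" by (rule insert.prems) simp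
  have fI: "sum f I \<in> blockwise"
    by (intro oper.subspace_sum[OF blockwise_subspace] insert.prems) simp
  show ?case
    unfolding sum.insert[OF insert.hyps] matrix_module_add[OF fi fI]
    by (subst insert.IH) (auto intro: insert.prems)
qed (simp_all only: sum.infinite sum.empty matrix_module_zero not_False_eq_True)

lemma crossed_module_in:
  assumes "x \<in> \<A>" shows "crossed_module \<pi> \<alpha> x b \<in> \<A>"
  unfolding crossed_product_def
proof (rule op_closure_map[OF assms[unfolded crossed_product_def], of "\<lambda>x. crossed_module \<pi> \<alpha> x b" _ "norm b"])
  fix S e assume S: "S \<in> op_span {crossed_elem \<pi> \<alpha> a s |a s. True}"
  have bd: "S \<in> bounded_ops singles"
    by (rule span_crossed_induct[OF S bounded_ops_subspace crossed_elem_bounded])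
  have "S \<in> {S\<in>blockwise. matrix_module \<pi> \<alpha> S b \<in> \<A>}"
  proof (rule span_crossed_induct[OF S])
    show "oper.subspace {S\<in>blockwise. matrix_module \<pi> \<alpha> S b \<in> \<A>}"
      by (rule oper.subspaceI)
        (simp_all add: matrix_module_add matrix_module_scale matrix_module_zero opsys_on_zero[OF opsys_crossed]
          opsys_on_add[OF opsys_crossed] opsys_on_scale[OF opsys_crossed] oper.subspace_add[OF blockwise_subspace]
          oper.subspace_scale[OF blockwise_subspace] oper.subspace_0[OF blockwise_subspace])
    show "crossed_elem \<pi> \<alpha> a s \<in> {S\<in>blockwise. matrix_module \<pi> \<alpha> S b \<in> \<A>}" for a s
      using crossed_blockwise crossed_elem_in by (auto simp: matrix_module_crossed_elem)
  qed
  then show "crossed_module \<pi> \<alpha> S b \<in> op_closure (op_span {crossed_elem \<pi> \<alpha> a s |a s. True})"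
    by (simp add: crossed_module_eq[OF bd] crossed_product_def)
  show "op_bound (norm b * e) (crossed_module \<pi> \<alpha> x b - crossed_module \<pi> \<alpha> S b)" if "op_bound e (x - S)"
  proof -
    obtain C where C: "op_bound C x"
      using opsys_on_bounded[OF opsys_crossed assms] by (auto simp: bounded_ops_def)
    obtain D where D: "op_bound D S" using bd by (auto simp: bounded_ops_def)
    show ?thesis
      using op_bound_mult[OF that crossed_elem_bound[of b 0]]
      unfolding crossed_module_def op_mult_diff_left[OF C D crossed_elem_bound] by (simp add: mult.commute)
  qed
qed simp

lemma crossed_module_eq':
  "x \<in> \<A> \<Longrightarrow> crossed_module \<pi> \<alpha> x b = matrix_module \<pi> \<alpha> x b"
  by (intro crossed_module_eq opsys_on_bounded[OF opsys_crossed])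

lemma right_module_crossed: "right_module \<A> (crossed_module \<pi> \<alpha>)"
  by (rule right_module_blockwise[OF crossed_blockwise crossed_module_eq' crossed_module_in
        opsys_on_add[OF opsys_crossed] opsys_on_scale[OF opsys_crossed]])

subsection \<open>The matrix algebras\<close>

lemma matrix_algebra_eq:
  "\<M> F = range (ampl \<pi> F)"
proof (intro equalityI subsetI)
  fix x assume x: "x \<in> \<M> F"
  have "x \<in> blockwise"
    unfolding blockwise_iff
  proof (intro allI)
    fix s t
    show "(\<lambda>h k. x (s, h) (t, k)) \<in> range \<pi>"
    proof (cases "s \<in> F \<and> t \<in> F")
      case True
      then show ?thesis using x by (auto simp: matrix_algebra_def)
    next
      case False
      then have "x (s, h) (t, k) = 0" for h k
        using x unfolding matrix_algebra_def by blast
      then have "(\<lambda>h k. x (s, h) (t, k)) = \<pi> 0"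
        by (simp add: rep_zero[OF rep] fun_eq_iff)
      then show ?thesis by auto
    qed
  qed
  then obtain c where c: "x = ampl \<pi> UNIV c" by (auto simp: blockwise_def)
  have "x = ampl \<pi> F c"
  proof (intro ext, clarify)
    fix s h t k
    show "x (s, h) (t, k) = ampl \<pi> F c (s, h) (t, k)"
    proof (cases "s \<in> F \<and> t \<in> F")
      case False
      then have "x (s, h) (t, k) = 0" using x unfolding matrix_algebra_def by blast
      with False show ?thesis by (auto simp: ampl_apply)
    qed (simp add: c ampl_apply)
  qed
  then show "x \<in> range (ampl \<pi> F)" by simp
next
  fix x assume "x \<in> range (ampl \<pi> F)"
  then show "x \<in> \<M> F"
    by (auto simp: matrix_algebra_def ampl_apply split: if_splits)
qed

lemma matrix_algebra_blockwise: "\<M> F \<subseteq> blockwise"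
  by (auto simp: matrix_algebra_eq ampl_in_blockwise)

lemma matrix_algebra_iff:
  "x \<in> \<M> F \<longleftrightarrow> x \<in> blockwise \<and> (\<forall>z w. fst z \<notin> F \<or> fst w \<notin> F \<longrightarrow> x z w = 0)"
proof
  assume x: "x \<in> \<M> F"
  then obtain c where "x = ampl \<pi> F c" by (auto simp: matrix_algebra_eq)
  then have "x z w = 0" if "fst z \<notin> F \<or> fst w \<notin> F" for z w
    using that by (cases z; cases w) (auto simp: ampl_apply)
  with x matrix_algebra_blockwise show "x \<in> blockwise \<and> (\<forall>z w. fst z \<notin> F \<or> fst w \<notin> F \<longrightarrow> x z w = 0)"
    by blast
next
  assume x: "x \<in> blockwise \<and> (\<forall>z w. fst z \<notin> F \<or> fst w \<notin> F \<longrightarrow> x z w = 0)"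
  then have "x (s, h) (t, k) = 0" if "s \<notin> F \<or> t \<notin> F" for s t h k
    using that by simp
  with x show "x \<in> \<M> F"
    unfolding matrix_algebra_def blockwise_iff by blast
qed

lemma matrix_algebra_ampl_entry: "x \<in> \<M> F \<Longrightarrow> ampl \<pi> F (entry x) = x"
  unfolding matrix_algebra_eq
  by (elim imageE, hypsubst, intro ext, clarify) (simp add: ampl_apply entry_ampl_finite)

lemma op_adj_blockwise: "x \<in> blockwise \<Longrightarrow> op_adj x \<in> blockwise"
proof -
  assume "x \<in> blockwise"
  then obtain c where c: "x = ampl \<pi> UNIV c" by (auto simp: blockwise_def)
  have 1: "cnj (\<pi> b k h) = \<pi> (star b) h k" for b h k
    unfolding rep_star[OF rep] op_adj_def ..
  have "op_adj x = ampl \<pi> UNIV (\<lambda>s t. star (c t s))"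
    by (auto simp: c op_adj_def ampl_def 1 fun_eq_iff)
  then show ?thesis by (simp add: ampl_in_blockwise)
qed

lemma opsys_matrix:
  assumes F: "finite F" shows "opsys_on (F \<times> UNIV) (\<M> F)"
  unfolding opsys_on_def
proof (intro conjI ballI allI)
  show "\<M> F \<subseteq> bounded_ops (F \<times> UNIV)"
    using ampl_bound[OF rep F] unfolding bounded_ops_def matrix_algebra_eq
    by (auto simp: ampl_apply split: if_splits)
  show "op_id (F \<times> UNIV) \<in> \<M> F"
    by (simp add: ampl_one[OF rep F, symmetric] matrix_algebra_eq)
  show "S + T \<in> \<M> F" if "S \<in> \<M> F" "T \<in> \<M> F" for S T
    using that unfolding matrix_algebra_iff by (simp add: oper.subspace_add[OF blockwise_subspace])
  show "op_scale c T \<in> \<M> F" if "T \<in> \<M> F" for c T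
    using that oper.subspace_scale[OF blockwise_subspace] unfolding matrix_algebra_iff op_scale_def by simp
  show "op_adj T \<in> \<M> F" if "T \<in> \<M> F" for T
    using that op_adj_blockwise unfolding matrix_algebra_iff by (auto simp: op_adj_def)
  show "op_closure (\<M> F) \<subseteq> \<M> F"
  proof
    fix T assume T: "T \<in> op_closure (\<M> F)"
    have "T \<in> bounded_ops (F \<times> UNIV)"
      using op_closure_bounded_ops[OF \<open>\<M> F \<subseteq> bounded_ops (F \<times> UNIV)\<close>] T by blast
    moreover have "T \<in> blockwise"
      using op_closure_mono[OF matrix_algebra_blockwise] blockwise_closed T by blast
    ultimately show "T \<in> \<M> F"
      unfolding matrix_algebra_iff bounded_ops_iff by (auto simp: mem_Times_iff)
  qed
qed

lemma diag_part_blockwise: "x \<in> blockwise \<Longrightarrow> diag_part r x \<in> blockwise"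
  and entry_diag_part: "x \<in> blockwise \<Longrightarrow> entry (diag_part r x) s t = (if sum_list s - sum_list t = r then entry x s t else 0)"
proof -
  assume "x \<in> blockwise"
  then obtain c where c: "x = ampl \<pi> UNIV c" by (auto simp: blockwise_def)
  have *: "diag_part r x = ampl \<pi> UNIV (\<lambda>s t. if sum_list s - sum_list t = r then c s t else 0)"
    by (auto simp: c diag_part_def ampl_def rep_zero[OF rep] fun_eq_iff)
  show "diag_part r x \<in> blockwise" by (simp add: * ampl_in_blockwise)
  show "entry (diag_part r x) s t = (if sum_list s - sum_list t = r then entry x s t else 0)"
    unfolding * entry_ampl by (simp add: c entry_ampl)
qed

lemma diag_part_matrix: "x \<in> \<M> F \<Longrightarrow> diag_part r x \<in> \<M> F"
  by (simp add: matrix_algebra_iff diag_part_blockwise) (simp add: diag_part_def)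

lemma matrix_elem_in: "s \<in> F \<Longrightarrow> t \<in> F \<Longrightarrow> matrix_elem \<pi> a s t \<in> \<M> F"
proof -
  assume "s \<in> F" "t \<in> F"
  then have "matrix_elem \<pi> a s t = ampl \<pi> F (\<lambda>u v. if u = s \<and> v = t then a else 0)"
    by (auto simp: matrix_elem_def ampl_def rep_zero[OF rep] fun_eq_iff)
  then show ?thesis by (simp add: matrix_algebra_eq)
qed

lemma twist_matrix:
  assumes F: "finite F" and x: "x \<in> \<M> F"
  shows "twist x \<in> min_tensor (\<M> F) reduced_group_algebra"
proof -
  obtain c where c: "x = ampl \<pi> F c" using x by (auto simp: matrix_algebra_eq)
  have elem: "(\<lambda>z w. if fst z = s \<and> fst w = t then \<pi> a (snd z) (snd w) else 0) = matrix_elem \<pi> a s t" for a s t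
    by (auto simp: matrix_elem_def fun_eq_iff)
  have x_sum: "x = (\<Sum>s\<in>F. \<Sum>t\<in>F. matrix_elem \<pi> (c s t) s t)"
    unfolding c ampl_eq_sum[OF F] elem ..
  let ?G = "{op_tensor v w |v w. v \<in> \<M> F \<and> w \<in> reduced_group_algebra}"
  have "oper.subspace {y. twist y \<in> op_span ?G}"
  proof -
    have "twist 0 = (0 :: (('g list \<times> 'h) \<times> 'g) oper)" by (auto simp: twist_def fun_eq_iff)
    then show ?thesis
      unfolding op_span_eq_span
      by (intro oper.subspaceI)
        (simp_all only: mem_Collect_eq twist_add twist_scale oper.span_zero oper.span_add oper.span_scale)
  qed
  moreover have "matrix_elem \<pi> (c s t) s t \<in> {y. twist y \<in> op_span ?G}" if "s \<in> F" "t \<in> F" for s t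
    unfolding mem_Collect_eq twist_matrix_elem
    by (rule min_tensor_gen[OF matrix_elem_in[OF that] left_regular_in])
  ultimately have "x \<in> {y. twist y \<in> op_span ?G}"
    unfolding x_sum by (intro oper.subspace_sum) auto
  then show ?thesis by (simp add: min_tensor_def op_closure_incl)
qed

lemma coaction_matrix: "finite F \<Longrightarrow> coaction (\<M> F) (matrix_coaction \<pi> F)"
  unfolding matrix_coaction_def
  by (rule coaction_twist[OF opsys_matrix diag_part_matrix twist_matrix])

lemma matrix_module_in: "x \<in> \<M> F \<Longrightarrow> matrix_module \<pi> \<alpha> x b \<in> \<M> F"
proof -
  assume "x \<in> \<M> F"
  then obtain c where c: "x = ampl \<pi> F c" by (auto simp: matrix_algebra_eq)
  have "matrix_module \<pi> \<alpha> x b = ampl \<pi> F (\<lambda>s t. c s t * \<alpha> (- sum_list t) b)"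
    unfolding c ampl_eq_UNIV[of F] matrix_module_ampl by (rule arg_cong[of _ _ "ampl \<pi> UNIV"]) (auto simp: fun_eq_iff)
  then show ?thesis by (simp add: matrix_algebra_eq)
qed

lemma right_module_matrix:
  assumes "finite F" shows "right_module (\<M> F) (matrix_module \<pi> \<alpha>)"
  by (rule right_module_blockwise[OF matrix_algebra_blockwise refl matrix_module_in
        opsys_on_add[OF opsys_matrix[OF assms]] opsys_on_scale[OF opsys_matrix[OF assms]]])

end

lemma ampl_cong: "(\<And>i j. i \<in> I \<Longrightarrow> j \<in> I \<Longrightarrow> Z i j = W i j) \<Longrightarrow> ampl \<rho> I Z = ampl \<rho> I W"
  by (auto simp: ampl_def fun_eq_iff)

lemma op_conj_diagonal:
  fixes \<rho> :: "'a::unital_cstar_algebra \<Rightarrow> 'h oper" and I :: "'i set"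
  assumes \<rho>: "star_rep \<rho>" and I: "finite I"
  shows "op_conj (ampl \<rho> I (\<lambda>i j. if i = j then e i else 0)) (ampl \<rho> I Z) =
    ampl \<rho> I (\<lambda>i j. e i * Z i j * star (e j))"
proof -
  have adj: "op_adj (ampl \<rho> I (\<lambda>i j. if i = j then e i else 0)) = ampl \<rho> I (\<lambda>i j. if i = j then star (e j) else 0)"
  proof (intro ext, clarify)
    fix i h j k
    have "cnj (\<rho> b k h) = \<rho> (star b) h k" for b
      unfolding rep_star[OF \<rho>] op_adj_def ..
    then show "op_adj (ampl \<rho> I (\<lambda>i j. if i = j then e i else 0)) (i, h) (j, k) =
        ampl \<rho> I (\<lambda>i j. if i = j then star (e j) else 0) (i, h) (j, k)"
      by (simp add: op_adj_def ampl_apply)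
  qed
  have left: "mat_mult I (\<lambda>i j. if i = j then e i else 0) W i j = e i * W i j" if "i \<in> I" for W i j
  proof -
    have "mat_mult I (\<lambda>i j. if i = j then e i else 0) W i j = (\<Sum>k\<in>I. if i = k then e i * W k j else 0)"
      unfolding mat_mult_def by (intro sum.cong) auto
    then show ?thesis using that I by (simp add: sum.delta')
  qed
  have right: "mat_mult I W (\<lambda>i j. if i = j then star (e j) else 0) i j = W i j * star (e j)" if "j \<in> I" for W i j
  proof -
    have "mat_mult I W (\<lambda>i j. if i = j then star (e j) else 0) i j = (\<Sum>k\<in>I. if k = j then W i k * star (e j) else 0)"
      unfolding mat_mult_def by (intro sum.cong) auto
    then show ?thesis using that I by (simp add: sum.delta)
  qed
  show ?thesis
    unfolding op_conj_def adj ampl_mult[OF \<rho> I]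
    by (rule ampl_cong) (simp only: left right)
qed

context covariant
begin

lemma entry_apply: "x \<in> blockwise \<Longrightarrow> \<pi> (entry x s t) h k = x (s, h) (t, k)"
  using ampl_UNIV_entry[of x] by (metis ampl_apply UNIV_I)

lemma coadmissible_single:
  assumes B: "opsys_on X B" "right_module B m" "coaction B (restrict twist B)"
    and D: "opsys_on Y D" "right_module D n" "coaction D (restrict twist D)"
    and f: "cp_map B D f" "\<And>x a. x \<in> B \<Longrightarrow> f (m x a) = n (f x) a"
      "\<And>x r. x \<in> B \<Longrightarrow> f (diag_part r x) = diag_part r (f x)"
  shows "coadmissible_family B m (restrict twist B) D n (restrict twist D) {(B, f)}"
  unfolding coadmissible_family_def
proof
  show "gamma_coadmissible B (restrict twist B) D (restrict twist D) {(B, f)}"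
    by (rule gamma_coadmissible.cofamily[OF B(3) D(3)]) (rule cofamily_single[OF B(1,3) f(1,3)])
  have "admissible B m D n f"
    by (rule admissible.module_map) (use B D f in \<open>auto simp: opsys_def\<close>)
  then show "\<forall>(V, \<psi>)\<in>{(B, f)}. admissible V m D n \<psi>" by simp
qed

text \<open>An n by n matrix over M_F(A) is a matrix over the algebra with index set
  \<open>{..<n} \<times> F\<close>. In this form complete positivity becomes a statement about
  \<open>ampl\<close>, to which transfer between representations applies.\<close>

lemma block_matrix_pos_iff:
  assumes A: "\<And>i j. i < n \<Longrightarrow> j < n \<Longrightarrow> A i j \<in> \<M> F"
  shows "op_pos (block n A) \<longleftrightarrow>
    op_pos (ampl \<pi> ({..<n} \<times> F) (\<lambda>z w. entry (A (fst z) (fst w)) (snd z) (snd w)))" (is "_ \<longleftrightarrow> op_pos ?Z")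
proof
  have A': "\<pi> (entry (A i j) s t) h k = A i j (s, h) (t, k)" if "i < n" "j < n" for i j s t h k
    by (rule entry_apply) (use A[OF that] matrix_algebra_blockwise in blast)
  have A0: "A i j (s, h) (t, k) = 0" if "i < n" "j < n" "s \<notin> F \<or> t \<notin> F" for i j s t h k
    using A[OF that(1,2)] that(3) by (simp add: matrix_algebra_iff)
  show "op_pos ?Z" if "op_pos (block n A)"
  proof -
    let ?Y = "({..<n} \<times> F) \<times> (UNIV :: 'h set)"
    let ?f = "\<lambda>z :: (nat \<times> 'g list) \<times> 'h. (fst (fst z), (snd (fst z), snd z))"
    have "op_pos (\<lambda>z w. if z \<in> ?Y \<and> w \<in> ?Y then block n A (?f z) (?f w) else 0)"
      by (rule compression_pos[OF that]) (auto simp: inj_on_def)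
    also have "(\<lambda>z w. if z \<in> ?Y \<and> w \<in> ?Y then block n A (?f z) (?f w) else 0) = ?Z"
      by (auto simp: fun_eq_iff ampl_apply block_def A')
    finally show ?thesis .
  qed
  show "op_pos (block n A)" if "op_pos ?Z"
  proof -
    let ?Y = "{..<n} \<times> F \<times> (UNIV :: 'h set)"
    let ?f = "\<lambda>z :: nat \<times> 'g list \<times> 'h. ((fst z, fst (snd z)), snd (snd z))"
    have "op_pos (\<lambda>z w. if z \<in> ?Y \<and> w \<in> ?Y then ?Z (?f z) (?f w) else 0)"
      by (rule compression_pos[OF that]) (auto simp: inj_on_def)
    also have "(\<lambda>z w. if z \<in> ?Y \<and> w \<in> ?Y then ?Z (?f z) (?f w) else 0) = block n A"
      by (auto simp: fun_eq_iff ampl_apply block_def A' A0)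
    finally show ?thesis .
  qed
qed

subsection \<open>The compression to a finite set\<close>

definition compress :: "'g list set \<Rightarrow> ('g list \<times> 'h) oper \<Rightarrow> ('g list \<times> 'h) oper" where
  "compress F x = (\<lambda>z w. if fst z \<in> F \<and> fst w \<in> F then x z w else 0)"

lemma compress_ampl: "compress F (ampl \<pi> UNIV c) = ampl \<pi> F c"
  by (auto simp: compress_def ampl_def fun_eq_iff)

lemma compress_in: "x \<in> blockwise \<Longrightarrow> compress F x \<in> \<M> F"
  by (auto simp: blockwise_def compress_ampl matrix_algebra_eq)

lemma entry_compress:
  "x \<in> blockwise \<Longrightarrow> s \<in> F \<Longrightarrow> t \<in> F \<Longrightarrow> entry (compress F x) s t = entry x s t"
  by (auto simp: blockwise_def compress_ampl entry_ampl entry_ampl_finite)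

lemma compress_bound: "op_bound C x \<Longrightarrow> op_bound C (compress F x)"
  using compression_bound[of C x "\<lambda>z. z" "{z. fst z \<in> F}" "\<lambda>z. z" "{z. fst z \<in> F}"]
  by (simp add: compress_def)

lemma compress_cp: "cp_map \<A> (\<M> F) (restrict (compress F) \<A>)"
proof (rule cp_map_restrict[OF opsys_crossed])
  show "compress F x \<in> \<M> F" if "x \<in> \<A>" for x
    using that crossed_blockwise by (intro compress_in) blast
  show "compress F (x + y) = compress F x + compress F y" for x y
    by (auto simp: compress_def fun_eq_iff)
  show "compress F (op_scale c x) = op_scale c (compress F x)" for c x
    by (auto simp: compress_def op_scale_def fun_eq_iff)
  fix n and A :: "nat \<Rightarrow> nat \<Rightarrow> ('g list \<times> 'h) oper"
  assume "op_pos (block n A)"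
  from compression_pos[OF this, of "\<lambda>z. z" "{z. fst (snd z) \<in> F}"]
  have "op_pos (\<lambda>z w. if z \<in> {z. fst (snd z) \<in> F} \<and> w \<in> {z. fst (snd z) \<in> F} then block n A z w else 0)"
    by simp
  also have "(\<lambda>z w. if z \<in> {z. fst (snd z) \<in> F} \<and> w \<in> {z. fst (snd z) \<in> F} then block n A z w else 0)
      = block n (\<lambda>i j. compress F (A i j))"
    by (auto simp: block_def compress_def fun_eq_iff)
  finally show "op_pos (block n (\<lambda>i j. compress F (A i j)))" .
qed

lemma compress_ccp: "ccp_map \<A> (\<M> F) (restrict (compress F) \<A>)"
  unfolding ccp_map_def
proof (intro conjI compress_cp ballI)
  fix x assume x: "x \<in> \<A>"
  then obtain C where "op_bound C x"
    using opsys_on_bounded[OF opsys_crossed x] by (auto simp: bounded_ops_def)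
  then have "op_bound (op_norm x) (compress F x)" by (intro compress_bound op_bound_op_norm)
  with x show "op_norm (restrict (compress F) \<A> x) \<le> op_norm x" by (simp add: op_norm_le)
qed

lemma compress_coadmissible:
  assumes F: "finite F"
  shows "coadmissible_map \<A> (crossed_module \<pi> \<alpha>) (crossed_coaction \<pi> \<alpha>)
    (\<M> F) (matrix_module \<pi> \<alpha>) (matrix_coaction \<pi> F) (restrict (compress F) \<A>)"
  unfolding coadmissible_map_def
proof (intro exI conjI)
  show "coadmissible_family \<A> (crossed_module \<pi> \<alpha>) (crossed_coaction \<pi> \<alpha>)
    (\<M> F) (matrix_module \<pi> \<alpha>) (matrix_coaction \<pi> F) {(\<A>, restrict (compress F) \<A>)}"
    unfolding crossed_coaction_def matrix_coaction_def
  proof (rule coadmissible_single[OF opsys_crossed right_module_crossed _ opsys_matrix[OF F] right_module_matrix[OF F] _ compress_cp])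
    show "coaction \<A> (restrict twist \<A>)" using coaction_crossed by (simp add: crossed_coaction_def)
    show "coaction (\<M> F) (restrict twist (\<M> F))" using coaction_matrix[OF F] by (simp add: matrix_coaction_def)
    fix x assume x: "x \<in> \<A>"
    then obtain c where c: "x = ampl \<pi> UNIV c" using crossed_blockwise by (auto simp: blockwise_def)
    show "restrict (compress F) \<A> (crossed_module \<pi> \<alpha> x a) = matrix_module \<pi> \<alpha> (restrict (compress F) \<A> x) a" for a
    proof -
      have "compress F (matrix_module \<pi> \<alpha> x a) = matrix_module \<pi> \<alpha> (compress F x) a"
        unfolding c matrix_module_ampl compress_ampl ampl_eq_UNIV[of F]
        by (rule arg_cong[of _ _ "ampl \<pi> UNIV"]) (auto simp: fun_eq_iff)
      then show ?thesis using x crossed_module_in[OF x] by (simp add: crossed_module_eq')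
    qed
    show "restrict (compress F) \<A> (diag_part r x) = diag_part r (restrict (compress F) \<A> x)" for r
      using x diag_part_crossed[OF x] by (auto simp: compress_def diag_part_def fun_eq_iff)
  qed
qed simp

subsection \<open>The map back to the crossed product\<close>

text \<open>The map \<open>a \<otimes> e\<^sub>s\<^sub>t \<mapsto> s a t\<^sup>-\<^sup>1\<close>, with \<open>s\<close> and \<open>t\<close> standing for the group elements they
  represent.\<close>

definition theta :: "'g list set \<Rightarrow> ('g list \<times> 'h) oper \<Rightarrow> ('g list \<times> 'h) oper" where
  "theta F x = (\<Sum>s\<in>F. \<Sum>t\<in>F. crossed_elem \<pi> \<alpha> (\<alpha> (sum_list s) (entry x s t)) (sum_list s - sum_list t))"

lemma theta_in: "theta F x \<in> \<A>"
  unfolding theta_def by (intro opsys_on_sum[OF opsys_crossed] crossed_elem_in)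

lemma theta_add:
  "x \<in> blockwise \<Longrightarrow> y \<in> blockwise \<Longrightarrow> theta F (x + y) = theta F x + theta F y"
  by (simp only: theta_def entry_add alpha_add crossed_elem_add sum.distrib)

lemma theta_scale: "x \<in> blockwise \<Longrightarrow> theta F (op_scale c x) = op_scale c (theta F x)"
  by (simp only: theta_def entry_scale alpha_scaleC crossed_elem_scaleC oper.scale_sum_right)

lemma theta_module:
  assumes "x \<in> blockwise"
  shows "theta F (matrix_module \<pi> \<alpha> x b) = matrix_module \<pi> \<alpha> (theta F x) b"
proof -
  obtain c where c: "x = ampl \<pi> UNIV c" using assms by (auto simp: blockwise_def)
  have bw: "crossed_elem \<pi> \<alpha> a s \<in> blockwise" for a s by (simp add: crossed_elem_ampl ampl_in_blockwise)
  show ?thesis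
    unfolding theta_def
    by (simp only: c matrix_module_ampl entry_ampl matrix_module_sum bw oper.subspace_sum[OF blockwise_subspace]
        matrix_module_crossed_elem alpha_mult alpha_comp[symmetric] add_uminus_conv_diff)
qed

lemma theta_diag_part:
  assumes "x \<in> blockwise" shows "theta F (diag_part r x) = diag_part r (theta F x)"
  unfolding theta_def diag_part_sum
  by (intro sum.cong refl) (auto simp: entry_diag_part[OF assms] diag_part_crossed_elem crossed_elem_zero)

text \<open>The matrix \<open>\<theta>(x)\<close> at \<open>u, v\<close> is the sum over \<open>w\<close> of the entries of \<open>\<alpha>\<^sub>w(x)\<close> at \<open>uw, vw\<close>.
  Hence \<open>\<theta>\<close> arises from the direct sum over \<open>w\<close> of the maps \<open>\<alpha>\<^sub>w\<close>, which are completely positive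
  on matrices.\<close>

lemma theta_pos:
  fixes A :: "nat \<Rightarrow> nat \<Rightarrow> ('g list \<times> 'h) oper"
  assumes F: "finite F" and A: "\<And>i j. i < n \<Longrightarrow> j < n \<Longrightarrow> A i j \<in> \<M> F" and pos: "op_pos (block n A)"
  shows "op_pos (block n (\<lambda>i j. theta F (A i j)))"
proof -
  let ?I = "{..<n} \<times> F"
  define Z where "Z = (\<lambda>z w. entry (A (fst z) (fst w)) (snd z) (snd w) :: 'a)"
  have I: "finite ?I" using F by simp
  have "op_pos (ampl \<pi> ?I Z)" using pos block_matrix_pos_iff[OF A] by (simp add: Z_def)
  then have posw: "op_pos (ampl (\<lambda>a. \<pi> (\<alpha> w a)) ?I Z)" for w
    by (rule ampl_pos_transfer[OF faithful rep_alpha I])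
  \<comment> \<open>An index couples a basis vector (i, [p], h) on the side of the crossed product
    with some s in \<open>F\<close>. It belongs to the summand w = p^-1 s given by \<open>l\<close>,
    and is the basis vector ((i, s), h) there, given by \<open>f\<close>.\<close>
  define Y where "Y = {z :: (nat \<times> ('g list \<times> 'h)) \<times> 'g list.
      fst (fst z) < n \<and> snd z \<in> F \<and> (\<exists>p. fst (snd (fst z)) = [p])}"
  define l where "l z = - hd (fst (snd (fst z))) + sum_list (snd z)" for z :: "(nat \<times> ('g list \<times> 'h)) \<times> 'g list"
  define f where "f z = ((fst (fst z), snd z), snd (snd (fst z)))" for z :: "(nat \<times> ('g list \<times> 'h)) \<times> 'g list"
  define D where "D z w = (if z \<in> Y \<and> w \<in> Y \<and> l z = l w then ampl (\<lambda>a. \<pi> (\<alpha> (l z) a)) ?I Z (f z) (f w) else 0)" for z w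
  have "inj_on (\<lambda>z. (l z, f z)) Y"
    by (auto simp: inj_on_def Y_def l_def f_def)
  then have "op_pos D" unfolding D_def by (rule direct_sum_pos[OF posw])
  \<comment> \<open>Summation over s and t compresses the direct sum back to the basis vectors (i,
    [p], h), producing the double sum in \<open>theta\<close>.\<close>
  then have "op_pos (\<lambda>z w. \<Sum>s\<in>F. \<Sum>t\<in>F. D (z, s) (w, t))" by (rule op_pos_fibre_sum[OF _ F])
  also have "(\<lambda>z w. \<Sum>s\<in>F. \<Sum>t\<in>F. D (z, s) (w, t)) = block n (\<lambda>i j. theta F (A i j))"
  proof (intro ext, clarify)
    fix i u h j v k
    have lab: "p = s - t + q \<longleftrightarrow> - p + s = - q + t" for p q s t :: 'g
      unfolding group_label_iff by (metis minus_add minus_minus)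
    have "D ((i, u, h), s) ((j, v, k), t) = (if i < n \<and> j < n then
        crossed_elem \<pi> \<alpha> (\<alpha> (sum_list s) (entry (A i j) s t)) (sum_list s - sum_list t) (u, h) (v, k) else 0)"
      if "s \<in> F" "t \<in> F" for s t
    proof (cases "\<exists>p q. u = [p] \<and> v = [q]")
      case True
      then obtain p q where "u = [p]" "v = [q]" by blast
      then show ?thesis using that
        by (simp add: D_def Y_def l_def f_def ampl_apply Z_def crossed_elem_def lab alpha_comp[symmetric])
    next
      case False
      then show ?thesis by (auto simp: D_def Y_def crossed_elem_def)
    qed
    then show "(\<Sum>s\<in>F. \<Sum>t\<in>F. D ((i, u, h), s) ((j, v, k), t)) = block n (\<lambda>i j. theta F (A i j)) (i, u, h) (j, v, k)"
      by (cases "i < n"; cases "j < n") (simp_all add: block_def theta_def sum_fun2_apply)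
  qed
  finally show ?thesis .
qed

lemma theta_cp: "finite F \<Longrightarrow> cp_map (\<M> F) \<A> (restrict (theta F) (\<M> F))"
  by (rule cp_map_restrict[OF opsys_matrix theta_in theta_add theta_scale theta_pos])
    (use matrix_algebra_blockwise in blast)+

section \<open>The unital map into the crossed product\<close>

definition diag_elem :: "'g list set \<Rightarrow> ('g list \<Rightarrow> 'a) \<Rightarrow> ('g list \<times> 'h) oper" where
  "diag_elem F e = ampl \<pi> F (\<lambda>s t. if s = t then e s else 0)"

text \<open>\<open>theta\<close> after conjugation by \<open>diag_elem F e\<close>, written out in
  entries. In this form it also applies to elements of the crossed product, where it includes the
  compression to \<open>F\<close> by \<open>psi_compress\<close>.\<close>

definition psi :: "'g list set \<Rightarrow> ('g list \<Rightarrow> 'a) \<Rightarrow> ('g list \<times> 'h) oper \<Rightarrow> ('g list \<times> 'h) oper" where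
  "psi F e x = (\<Sum>s\<in>F. \<Sum>t\<in>F. crossed_elem \<pi> \<alpha>
     (\<alpha> (sum_list s) (e s * entry x s t * star (e t))) (sum_list s - sum_list t))"

lemma psi_add: "x \<in> blockwise \<Longrightarrow> y \<in> blockwise \<Longrightarrow> psi F e (x + y) = psi F e x + psi F e y"
  by (simp only: psi_def entry_add alpha_add distrib_left distrib_right crossed_elem_add sum.distrib)

lemma psi_scale: "x \<in> blockwise \<Longrightarrow> psi F e (op_scale c x) = op_scale c (psi F e x)"
  by (simp only: psi_def entry_scale mult_scaleC_left mult_scaleC_right alpha_scaleC crossed_elem_scaleC oper.scale_sum_right)

lemma psi_compress: "x \<in> blockwise \<Longrightarrow> psi F e (compress F x) = psi F e x"
  unfolding psi_def by (intro sum.cong refl) (simp add: entry_compress)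

context
  fixes F :: "'g list set" and e :: "'g list \<Rightarrow> 'a"
  assumes F: "finite F" and unit: "(\<Sum>s\<in>F. \<alpha> (sum_list s) (e s * star (e s))) = 1"
begin

lemma conj_diag_elem: "x \<in> \<M> F \<Longrightarrow> op_conj (diag_elem F e) x = ampl \<pi> F (\<lambda>s t. e s * entry x s t * star (e t))"
  using op_conj_diagonal[OF rep F, of e "entry x"] by (simp add: diag_elem_def matrix_algebra_ampl_entry)

lemma conj_diag_elem_in: "x \<in> \<M> F \<Longrightarrow> op_conj (diag_elem F e) x \<in> \<M> F"
  by (simp add: conj_diag_elem matrix_algebra_eq)

lemma theta_conj: "x \<in> \<M> F \<Longrightarrow> theta F (op_conj (diag_elem F e) x) = psi F e x"
  by (simp add: conj_diag_elem theta_def psi_def entry_ampl_finite)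

lemma conj_diag_elem_pos:
  assumes A: "\<And>i j. i < n \<Longrightarrow> j < n \<Longrightarrow> A i j \<in> \<M> F" and pos: "op_pos (block n A)"
  shows "op_pos (block n (\<lambda>i j. op_conj (diag_elem F e) (A i j)))"
proof -
  let ?I = "{..<n} \<times> F"
  let ?Z = "\<lambda>z w. entry (A (fst z) (fst w)) (snd z) (snd w)"
  have I: "finite ?I" using F by simp
  have "op_pos (ampl \<pi> ?I ?Z)" using pos block_matrix_pos_iff[OF A] by simp
  then have "op_pos (op_conj (ampl \<pi> ?I (\<lambda>z w. if z = w then e (snd z) else 0)) (ampl \<pi> ?I ?Z))"
    by (rule op_pos_conj[OF _ ampl_bound[OF rep I] ampl_bound[OF rep I]])
  also have "op_conj (ampl \<pi> ?I (\<lambda>z w. if z = w then e (snd z) else 0)) (ampl \<pi> ?I ?Z) =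
      ampl \<pi> ?I (\<lambda>z w. e (snd z) * ?Z z w * star (e (snd w)))"
    by (rule op_conj_diagonal[OF rep I])
  also have "\<dots> = ampl \<pi> ?I (\<lambda>z w. entry (op_conj (diag_elem F e) (A (fst z) (fst w))) (snd z) (snd w))"
    by (rule ampl_cong) (auto simp: conj_diag_elem[OF A] entry_ampl_finite)
  finally show ?thesis
    using block_matrix_pos_iff[of n "\<lambda>i j. op_conj (diag_elem F e) (A i j)" F] A conj_diag_elem_in by simp
qed

lemma psi_cp: "cp_map (\<M> F) \<A> (restrict (psi F e) (\<M> F))"
proof (rule cp_map_restrict[OF opsys_matrix[OF F]])
  show "psi F e x \<in> \<A>" if "x \<in> \<M> F" for x
    using theta_in[of F] theta_conj[OF that] by metis
  show "psi F e (x + y) = psi F e x + psi F e y" if "x \<in> \<M> F" "y \<in> \<M> F" for x y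
    using that matrix_algebra_blockwise by (intro psi_add) blast+
  show "psi F e (op_scale c x) = op_scale c (psi F e x)" if "x \<in> \<M> F" for x c
    using that matrix_algebra_blockwise by (intro psi_scale) blast
  fix n and A :: "nat \<Rightarrow> nat \<Rightarrow> ('g list \<times> 'h) oper"
  assume A: "\<And>i j. i < n \<Longrightarrow> j < n \<Longrightarrow> A i j \<in> \<M> F" and "op_pos (block n A)"
  then have "op_pos (block n (\<lambda>i j. theta F (op_conj (diag_elem F e) (A i j))))"
    by (intro theta_pos[OF F] conj_diag_elem_pos conj_diag_elem_in) auto
  also have "block n (\<lambda>i j. theta F (op_conj (diag_elem F e) (A i j))) = block n (\<lambda>i j. psi F e (A i j))"
    by (auto simp: block_def theta_conj[OF A] fun_eq_iff)
  finally show "op_pos (block n (\<lambda>i j. psi F e (A i j)))" .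
qed

lemma psi_unital: "psi F e (op_id (F \<times> UNIV)) = op_id singles"
proof -
  have "entry (op_id (F \<times> UNIV)) s t = (if s = t then 1 else 0)" if "s \<in> F" "t \<in> F" for s t
    unfolding ampl_one[OF rep F, symmetric] entry_ampl_finite using that by simp
  then have "psi F e (op_id (F \<times> UNIV)) =
      (\<Sum>s\<in>F. \<Sum>t\<in>F. if t = s then crossed_elem \<pi> \<alpha> (\<alpha> (sum_list s) (e s * star (e s))) 0 else 0)"
    unfolding psi_def by (intro sum.cong refl) (auto simp: crossed_elem_zero)
  also have "\<dots> = (\<Sum>s\<in>F. crossed_elem \<pi> \<alpha> (\<alpha> (sum_list s) (e s * star (e s))) 0)"
    by (intro sum.cong refl, subst sum.delta) (auto simp: F)
  also have "\<dots> = op_id singles"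
    unfolding crossed_elem_sum[symmetric] unit by (rule crossed_elem_one)
  finally show ?thesis .
qed

lemma psi_bound: "x \<in> \<M> F \<Longrightarrow> op_bound C x \<Longrightarrow> op_bound C (psi F e x)"
  using unital_cp_bound[OF opsys_matrix[OF F] opsys_crossed psi_cp, of x C]
    opsys_on_id[OF opsys_matrix[OF F]] by (simp add: psi_unital)

lemma psi_ccp: "ccp_map (\<M> F) \<A> (restrict (psi F e) (\<M> F))"
  unfolding ccp_map_def
proof (intro conjI psi_cp ballI)
  fix x assume x: "x \<in> \<M> F"
  then obtain C where "op_bound C x"
    using opsys_on_bounded[OF opsys_matrix[OF F] x] by (auto simp: bounded_ops_def)
  then have "op_bound (op_norm x) (psi F e x)" by (intro psi_bound x op_bound_op_norm)
  with x show "op_norm (restrict (psi F e) (\<M> F) x) \<le> op_norm x" by (simp add: op_norm_le)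
qed

text \<open>\<open>theta\<close> is a module map and a comap. Conjugation of the argument by an
  element of M_F(A) is permitted both for admissible maps and for coadmissible families, so no such
  property of \<open>psi\<close> itself has to be checked.\<close>

lemma psi_coadmissible:
  "coadmissible_map (\<M> F) (matrix_module \<pi> \<alpha>) (matrix_coaction \<pi> F)
    \<A> (crossed_module \<pi> \<alpha>) (crossed_coaction \<pi> \<alpha>) (restrict (psi F e) (\<M> F))"
proof -
  let ?\<theta> = "restrict (theta F) (\<M> F)"
  let ?d = "diag_elem F e"
  have fam: "coadmissible_family (\<M> F) (matrix_module \<pi> \<alpha>) (matrix_coaction \<pi> F)
    \<A> (crossed_module \<pi> \<alpha>) (crossed_coaction \<pi> \<alpha>) {(\<M> F, ?\<theta>)}"
    unfolding crossed_coaction_def matrix_coaction_def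
  proof (rule coadmissible_single[OF opsys_matrix[OF F] right_module_matrix[OF F] _ opsys_crossed right_module_crossed _ theta_cp[OF F]])
    show "coaction \<A> (restrict twist \<A>)" using coaction_crossed by (simp add: crossed_coaction_def)
    show "coaction (\<M> F) (restrict twist (\<M> F))" using coaction_matrix[OF F] by (simp add: matrix_coaction_def)
    fix x assume x: "x \<in> \<M> F"
    then have bw: "x \<in> blockwise" using matrix_algebra_blockwise by blast
    show "?\<theta> (matrix_module \<pi> \<alpha> x a) = crossed_module \<pi> \<alpha> (?\<theta> x) a" for a
      using x matrix_module_in[OF x] theta_module[OF bw] theta_in by (simp add: crossed_module_eq')
    show "?\<theta> (diag_part r x) = diag_part r (?\<theta> x)" for r
      using x diag_part_matrix[OF x] theta_diag_part[OF bw] by simp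
  qed
  have d: "?d \<in> \<M> F" by (simp add: diag_elem_def matrix_algebra_eq)
  have eq: "(\<lambda>x\<in>\<M> F. ?\<theta> (op_conj ?d x)) = restrict (psi F e) (\<M> F)"
    by (auto simp: conj_diag_elem_in theta_conj)
  have gam: "gamma_coadmissible (\<M> F) (matrix_coaction \<pi> F) \<A> (crossed_coaction \<pi> \<alpha>) {(\<M> F, ?\<theta>)}"
    and adm: "admissible (\<M> F) (matrix_module \<pi> \<alpha>) \<A> (crossed_module \<pi> \<alpha>) ?\<theta>"
    using fam unfolding coadmissible_family_def by blast+
  have "gamma_coadmissible (\<M> F) (matrix_coaction \<pi> F) \<A> (crossed_coaction \<pi> \<alpha>)
      (insert (\<M> F, \<lambda>x\<in>\<M> F. ?\<theta> (op_conj ?d x)) {(\<M> F, ?\<theta>)})"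
    by (rule gamma_coadmissible.conj_domain[OF gam singletonI d conj_diag_elem_in])
  moreover have "admissible (\<M> F) (matrix_module \<pi> \<alpha>) \<A> (crossed_module \<pi> \<alpha>) (\<lambda>x\<in>\<M> F. ?\<theta> (op_conj ?d x))"
    by (rule admissible.conj_domain[OF adm d conj_diag_elem_in])
  ultimately show ?thesis
    unfolding coadmissible_map_def coadmissible_family_def eq using fam
    by (intro exI[of _ "insert (\<M> F, restrict (psi F e) (\<M> F)) {(\<M> F, ?\<theta>)}"])
      (auto simp: coadmissible_family_def)
qed

end

subsection \<open>The approximation\<close>

text \<open>The set \<open>F\<close> is \<open>supp_lists T\<close>, and \<open>weight T\<close> is the diagonal of the matrix \<open>d\<close>.\<close>

definition supp_lists :: "('g \<Rightarrow> 'a) \<Rightarrow> 'g list set" where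
  "supp_lists T = (\<lambda>p. [p]) ` {p. T p \<noteq> 0}"

definition weight :: "('g \<Rightarrow> 'a) \<Rightarrow> 'g list \<Rightarrow> 'a" where
  "weight T s = \<alpha> (- sum_list s) (T (sum_list s))"

definition amenable_mean :: "('g \<Rightarrow> 'a) \<Rightarrow> bool" where
  "amenable_mean T \<longleftrightarrow> finite {s. T s \<noteq> 0} \<and> (\<forall>s. T s \<in> central_positive) \<and>
     (\<Sum>s | T s \<noteq> 0. (T s)\<^sup>2) = 1"

definition defect :: "('g \<Rightarrow> 'a) \<Rightarrow> 'g \<Rightarrow> 'a" where
  "defect T t = (\<Sum>s | T s \<noteq> 0 \<or> T (- t + s) \<noteq> 0.
     star (T s - \<alpha> t (T (- t + s))) * (T s - \<alpha> t (T (- t + s))))"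

definition correlation :: "('g \<Rightarrow> 'a) \<Rightarrow> 'g \<Rightarrow> 'a" where
  "correlation T t = (\<Sum>s | T s \<noteq> 0. T s * \<alpha> t (T (- t + s)))"

abbreviation "approx T \<equiv> psi (supp_lists T) (weight T)"

context
  fixes T :: "'g \<Rightarrow> 'a" assumes T: "amenable_mean T"
begin

lemma mean_finite: "finite {s. T s \<noteq> 0}"
  and mean_central: "T s * a = a * T s"
  and mean_star: "star (T s) = T s"
  and mean_sum: "(\<Sum>s | T s \<noteq> 0. T s * T s) = 1"
proof -
  have c: "T s \<in> central_positive" for s using T by (simp add: amenable_mean_def)
  show "finite {s. T s \<noteq> 0}" "(\<Sum>s | T s \<noteq> 0. T s * T s) = 1"
    using T by (simp_all add: amenable_mean_def power2_eq_square)
  show "T s * a = a * T s" using c[of s] by (simp add: central_positive_def)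
  obtain b where "T s = star b * b" using c[of s] by (auto simp: central_positive_def)
  then show "star (T s) = T s" by (simp add: star_mult star_star)
qed

lemma alpha_mean_central: "\<alpha> t (T s) * a = a * \<alpha> t (T s)"
proof -
  have "\<alpha> t (T s) * \<alpha> t (\<alpha> (- t) a) = \<alpha> t (\<alpha> (- t) a) * \<alpha> t (T s)"
    unfolding alpha_mult[symmetric] by (simp only: mean_central)
  then show ?thesis by simp
qed

lemma supp_lists_finite: "finite (supp_lists T)"
  by (simp add: supp_lists_def mean_finite)

lemma sum_supp_lists: "(\<Sum>s\<in>supp_lists T. f s) = (\<Sum>p | T p \<noteq> 0. f [p])"
  unfolding supp_lists_def by (subst sum.reindex) (auto simp: inj_on_def)

lemma weight_unit: "(\<Sum>s\<in>supp_lists T. \<alpha> (sum_list s) (weight T s * star (weight T s))) = 1"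
  unfolding sum_supp_lists weight_def
  by (simp add: alpha_mult alpha_star mean_star mean_sum)

text \<open>T(s) and \<alpha>_t(T(t^-1 s)) are self-adjoint and commute, so each square expands like
  a square of real numbers. Both sums of squares are 1, the second after translating the index,
  since \<alpha>_t is unital; the mixed terms add up to the correlation.\<close>

lemma defect_correlation: "defect T t = 2 *\<^sub>R (1 - correlation T t)"
proof -
  define x where "x s = \<alpha> t (T (- t + s))" for s
  let ?P = "{s. T s \<noteq> 0}" and ?Q = "{s. T (- t + s) \<noteq> 0}"
  have Q: "?Q = (\<lambda>s. t + s) ` ?P"
    by (auto simp: image_iff) (metis add_minus_cancel)
  have P: "finite ?P" by (rule mean_finite)
  then have fin: "finite (?P \<union> ?Q)" unfolding Q by simp
  have star: "star (x s) = x s" for s by (simp add: x_def alpha_star[symmetric] mean_star)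
  have "star (T s - x s) * (T s - x s) = T s * T s + x s * x s - 2 *\<^sub>R (T s * x s)" for s
    using mean_central[of s "x s"] by (simp add: star_diff mean_star star algebra_simps scaleR_2)
  then have "defect T t = (\<Sum>s\<in>?P \<union> ?Q. T s * T s + x s * x s - 2 *\<^sub>R (T s * x s))"
    unfolding defect_def x_def[symmetric] Collect_disj_eq by simp
  also have "\<dots> = (\<Sum>s\<in>?P \<union> ?Q. T s * T s) + (\<Sum>s\<in>?P \<union> ?Q. x s * x s) - 2 *\<^sub>R (\<Sum>s\<in>?P \<union> ?Q. T s * x s)"
    by (simp add: sum_subtractf sum.distrib scaleR_right.sum)
  also have "(\<Sum>s\<in>?P \<union> ?Q. T s * T s) = (\<Sum>s\<in>?P. T s * T s)"
    by (rule sum.mono_neutral_right) (use fin in auto)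
  also have "\<dots> = 1" by (rule mean_sum)
  also have "(\<Sum>s\<in>?P \<union> ?Q. x s * x s) = (\<Sum>s\<in>?Q. x s * x s)"
    by (rule sum.mono_neutral_right) (use fin in \<open>auto simp: x_def\<close>)
  also have "\<dots> = (\<Sum>s\<in>?P. x (t + s) * x (t + s))"
    unfolding Q by (subst sum.reindex) (auto simp: inj_on_def)
  also have "\<dots> = \<alpha> t (\<Sum>s\<in>?P. T s * T s)"
    by (simp add: x_def alpha_sum alpha_mult)
  also have "\<dots> = 1" by (simp add: mean_sum)
  also have "(\<Sum>s\<in>?P \<union> ?Q. T s * x s) = correlation T t"
    unfolding correlation_def x_def by (rule sum.mono_neutral_right) (use fin in auto)
  finally show ?thesis by (simp add: algebra_simps scaleR_2)
qed

text \<open>The entry of \<open>a t\<close> at p, q vanishes unless q = t^-1 p. In the remaining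
  terms \<alpha>_p undoes the twist in the weight of p and turns the weight of q into
  \<alpha>_t(T(q)), which is central and moves past \<open>a\<close>.\<close>

lemma approx_crossed_elem:
  "approx T (crossed_elem \<pi> \<alpha> a t) = crossed_elem \<pi> \<alpha> (correlation T t * a) t"
proof -
  let ?P = "{s. T s \<noteq> 0}"
  have "approx T (crossed_elem \<pi> \<alpha> a t) = (\<Sum>p\<in>?P. \<Sum>q\<in>?P. if q = - t + p
      then crossed_elem \<pi> \<alpha> (T p * \<alpha> t (T (- t + p)) * a) t else 0)"
    unfolding psi_def sum_supp_lists
  proof (intro sum.cong refl)
    fix p q
    show "crossed_elem \<pi> \<alpha> (\<alpha> (sum_list [p]) (weight T [p] * entry (crossed_elem \<pi> \<alpha> a t) [p] [q] * star (weight T [q])))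
        (sum_list [p] - sum_list [q]) =
      (if q = - t + p then crossed_elem \<pi> \<alpha> (T p * \<alpha> t (T (- t + p)) * a) t else 0)"
    proof (cases "q = - t + p")
      case True
      then have pq: "p = t + q" by simp
      have "\<alpha> p (weight T [p] * entry (crossed_elem \<pi> \<alpha> a t) [p] [q] * star (weight T [q])) = T p * a * \<alpha> (p + - q) (T q)"
        by (simp add: weight_def crossed_elem_ampl entry_ampl crossed_entry_def pq alpha_mult alpha_star[symmetric] mean_star
            alpha_comp[symmetric] alpha_0 add.assoc minus_add del: add_uminus_conv_diff)
      also have "p + - q = t" by (simp add: pq add.assoc)
      also have "T p * a * \<alpha> t (T q) = T p * \<alpha> t (T q) * a" by (simp only: mult.assoc alpha_mean_central[of t q a])
      finally have 1: "\<alpha> p (weight T [p] * entry (crossed_elem \<pi> \<alpha> a t) [p] [q] * star (weight T [q]))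
          = T p * \<alpha> t (T q) * a" .
      have "- t + p = q" "p - q = t" unfolding pq by (simp_all add: add.assoc[symmetric])
      with 1 show ?thesis by simp
    next
      case False
      then have "p \<noteq> t + q" by auto
      then have "entry (crossed_elem \<pi> \<alpha> a t) [p] [q] = 0"
        by (simp add: crossed_elem_ampl entry_ampl crossed_entry_def)
      with False show ?thesis by (simp add: crossed_elem_zero)
    qed
  qed
  also have "\<dots> = (\<Sum>p\<in>?P. if - t + p \<in> ?P then crossed_elem \<pi> \<alpha> (T p * \<alpha> t (T (- t + p)) * a) t else 0)"
    by (intro sum.cong refl, subst sum.delta) (simp_all add: mean_finite)
  also have "\<dots> = (\<Sum>p\<in>?P. crossed_elem \<pi> \<alpha> (T p * \<alpha> t (T (- t + p)) * a) t)"
    by (intro sum.cong refl) (auto simp: crossed_elem_zero)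
  also have "\<dots> = crossed_elem \<pi> \<alpha> (correlation T t * a) t"
    by (simp only: crossed_elem_sum correlation_def sum_distrib_right)
  finally show ?thesis .
qed

lemma approx_crossed_elem_bound:
  "op_bound (norm (defect T t) * norm a) (approx T (crossed_elem \<pi> \<alpha> a t) - crossed_elem \<pi> \<alpha> a t)"
proof -
  have "norm ((correlation T t - 1) * a) \<le> norm (1 - correlation T t) * norm a"
    by (metis norm_mult_ineq norm_minus_commute)
  also have "\<dots> \<le> norm (defect T t) * norm a"
    by (intro mult_right_mono) (simp_all add: defect_correlation)
  finally have "op_bound (norm (defect T t) * norm a) (crossed_elem \<pi> \<alpha> ((correlation T t - 1) * a) t)"
    by (rule op_bound_mono[OF crossed_elem_bound])
  then show ?thesis
    by (simp add: approx_crossed_elem crossed_elem_diff left_diff_distrib)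
qed

end

text \<open>The estimate on a generator depends on its coefficient and its group element, so
  convergence is obtained on the algebraic span only. The passage to the closure is left to
  contractivity in \<open>nuclear\<close>.\<close>

lemma approx_converges:
  assumes mean: "\<forall>\<^sub>F T in N. amenable_mean T"
    and lim: "\<And>t. ((\<lambda>T. defect T t) \<longlongrightarrow> 0) N"
    and y: "y \<in> op_span {crossed_elem \<pi> \<alpha> a s |a s. True}" and \<eta>: "0 < \<eta>"
  shows "\<forall>\<^sub>F T in N. op_bound \<eta> (approx T y - y)"
proof -
  let ?V = "{y\<in>blockwise. \<forall>\<eta>>0. \<forall>\<^sub>F T in N. op_bound \<eta> (approx T y - y)}"
  have "y \<in> ?V"
  proof (rule span_crossed_induct[OF y])
    show "oper.subspace ?V"
    proof (rule oper.subspaceI)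
      have "approx T 0 = 0" for T using psi_scale[OF oper.subspace_0[OF blockwise_subspace], of _ _ 0] by simp
      then show "0 \<in> ?V"
        by (auto simp: oper.subspace_0[OF blockwise_subspace] intro!: always_eventually op_bound_mono[OF op_bound_0])
    next
      fix y z assume y: "y \<in> ?V" and z: "z \<in> ?V"
      have "\<forall>\<^sub>F T in N. op_bound \<eta> (approx T (y + z) - (y + z))" if "0 < \<eta>" for \<eta>
      proof -
        have "\<forall>\<^sub>F T in N. op_bound (\<eta> / 2) (approx T y - y)" "\<forall>\<^sub>F T in N. op_bound (\<eta> / 2) (approx T z - z)"
          using y z that by auto
        then show ?thesis
        proof eventually_elim
          case (elim T)
          have "op_bound (\<eta> / 2 + \<eta> / 2) ((approx T y - y) + (approx T z - z))"
            by (intro op_bound_add elim)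
          also have "(approx T y - y) + (approx T z - z) = approx T (y + z) - (y + z)"
            using y z by (simp add: psi_add)
          finally show ?case by (simp only: field_sum_of_halves)
        qed
      qed
      then show "y + z \<in> ?V" using y z oper.subspace_add[OF blockwise_subspace, of y z] by simp
    next
      fix c y assume y: "y \<in> ?V"
      have "\<forall>\<^sub>F T in N. op_bound \<eta> (approx T (op_scale c y) - op_scale c y)" if \<eta>: "0 < \<eta>" for \<eta>
      proof -
        define \<eta>' where "\<eta>' = \<eta> / (cmod c + 1)"
        have c1: "0 < cmod c + 1" by (simp add: add_nonneg_pos)
        then have "0 < \<eta>'" using \<eta> by (simp add: \<eta>'_def)
        with y have "\<forall>\<^sub>F T in N. op_bound \<eta>' (approx T y - y)" by auto
        then show ?thesis
        proof eventually_elim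
          case (elim T)
          have "op_bound (cmod c * \<eta>') (op_scale c (approx T y) - op_scale c y)"
            by (rule op_bound_scale_diff[OF elim])
          moreover have "cmod c * \<eta>' \<le> \<eta>" using c1 \<eta> by (simp add: \<eta>'_def field_simps)
          ultimately show ?case using y by (simp add: psi_scale op_bound_mono)
        qed
      qed
      then show "op_scale c y \<in> ?V" using y oper.subspace_scale[OF blockwise_subspace, of y c] by simp
    qed
  next
    fix a s
    have "\<forall>\<^sub>F T in N. op_bound \<eta> (approx T (crossed_elem \<pi> \<alpha> a s) - crossed_elem \<pi> \<alpha> a s)" if \<eta>: "0 < \<eta>" for \<eta>
    proof -
      have "((\<lambda>T. norm (defect T s) * norm a) \<longlongrightarrow> norm (0::'a) * norm a) N"
        by (intro tendsto_intros lim)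
      then have "\<forall>\<^sub>F T in N. norm (defect T s) * norm a < \<eta>"
        using \<eta> by (intro order_tendstoD(2)) auto
      with mean show ?thesis
      proof eventually_elim
        case (elim T)
        show ?case by (rule op_bound_mono[OF approx_crossed_elem_bound[OF elim(1)]]) (use elim(2) in simp)
      qed
    qed
    then show "crossed_elem \<pi> \<alpha> a s \<in> ?V" by (simp add: crossed_elem_ampl ampl_in_blockwise)
  qed
  with \<eta> show ?thesis by blast
qed

lemma nuclear:
  assumes "amenable_action \<alpha>"
  shows "comodule_nuclear \<pi> \<alpha> \<A> (crossed_module \<pi> \<alpha>) (crossed_coaction \<pi> \<alpha>)"
  unfolding comodule_nuclear_def
proof (intro allI impI)
  fix \<epsilon> :: real and S :: "('g list \<times> 'h) oper set"
  assume \<epsilon>: "0 < \<epsilon>" and S: "finite S \<and> S \<subseteq> \<A>"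
  obtain N :: "('g \<Rightarrow> 'a) filter" where N: "N \<noteq> bot" "\<forall>\<^sub>F T in N. amenable_mean T"
    "\<And>t. ((\<lambda>T. defect T t) \<longlongrightarrow> 0) N"
    using assms unfolding amenable_action_def amenable_mean_def defect_def by blast
  let ?G = "op_span {crossed_elem \<pi> \<alpha> a s |a s. True}"
  have "\<exists>y\<in>?G. op_bound (\<epsilon> / 3) (b - y)" if "b \<in> S" for b
  proof -
    have "b \<in> op_closure ?G" using S that by (auto simp: crossed_product_def)
    then show ?thesis using op_closureE[of b ?G "\<epsilon> / 3"] \<epsilon> by auto
  qed
  then have "\<forall>b\<in>S. \<exists>y. y \<in> ?G \<and> op_bound (\<epsilon> / 3) (b - y)" by blast
  from bchoice[OF this] obtain y
    where y: "\<And>b. b \<in> S \<Longrightarrow> y b \<in> ?G" "\<And>b. b \<in> S \<Longrightarrow> op_bound (\<epsilon> / 3) (b - y b)"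
    by auto
  have "\<forall>\<^sub>F T in N. \<forall>b\<in>S. op_bound (\<epsilon> / 3) (approx T (y b) - y b)"
    using S \<epsilon> approx_converges[OF N(2,3) y(1)] by (intro eventually_ball_finite) auto
  with N(2) have "\<forall>\<^sub>F T in N. amenable_mean T \<and> (\<forall>b\<in>S. op_bound (\<epsilon> / 3) (approx T (y b) - y b))"
    by eventually_elim simp
  \<comment> \<open>\<open>S\<close> is finite, so one condition covers all its elements, and an
    eventual property holds somewhere because the filter is proper.\<close>
  from eventually_happens'[OF N(1) this] obtain T
    where T: "amenable_mean T" "\<And>b. b \<in> S \<Longrightarrow> op_bound (\<epsilon> / 3) (approx T (y b) - y b)"
    by blast
  let ?F = "supp_lists T"
  let ?\<phi> = "restrict (compress ?F) \<A>" and ?\<psi> = "restrict (approx T) (\<M> ?F)"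
  note F = supp_lists_finite[OF T(1)] and unit = weight_unit[OF T(1)]
  show "\<exists>F \<phi> \<psi>. finite F \<and> F \<subseteq> {t. t \<noteq> []} \<and> ccp_map \<A> (\<M> F) \<phi> \<and>
      coadmissible_map \<A> (crossed_module \<pi> \<alpha>) (crossed_coaction \<pi> \<alpha>)
        (\<M> F) (matrix_module \<pi> \<alpha>) (matrix_coaction \<pi> F) \<phi> \<and>
      ccp_map (\<M> F) \<A> \<psi> \<and>
      coadmissible_map (\<M> F) (matrix_module \<pi> \<alpha>) (matrix_coaction \<pi> F)
        \<A> (crossed_module \<pi> \<alpha>) (crossed_coaction \<pi> \<alpha>) \<psi> \<and>
      (\<forall>b\<in>S. op_norm (\<psi> (\<phi> b) - b) \<le> \<epsilon>)"
  proof (intro exI conjI ballI)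
    show "finite ?F" by (rule F)
    show "?F \<subseteq> {t. t \<noteq> []}" by (auto simp: supp_lists_def)
    show "ccp_map \<A> (\<M> ?F) ?\<phi>" by (rule compress_ccp)
    show "coadmissible_map \<A> (crossed_module \<pi> \<alpha>) (crossed_coaction \<pi> \<alpha>)
        (\<M> ?F) (matrix_module \<pi> \<alpha>) (matrix_coaction \<pi> ?F) ?\<phi>" by (rule compress_coadmissible[OF F])
    show "ccp_map (\<M> ?F) \<A> ?\<psi>" by (rule psi_ccp[OF F unit])
    show "coadmissible_map (\<M> ?F) (matrix_module \<pi> \<alpha>) (matrix_coaction \<pi> ?F)
        \<A> (crossed_module \<pi> \<alpha>) (crossed_coaction \<pi> \<alpha>) ?\<psi>" by (rule psi_coadmissible[OF F unit])
    fix b assume b: "b \<in> S"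
    have bA: "b \<in> \<A>" using S b by blast
    have yA: "y b \<in> \<A>" unfolding crossed_product_def by (rule op_closure_incl[OF y(1)[OF b]])
    have dA: "b - y b \<in> \<A>" by (rule opsys_on_diff[OF opsys_crossed bA yA])
    note bw = subsetD[OF crossed_blockwise]
    \<comment> \<open>The first of three thirds: contractivity holds on M_F(A), so it is applied to
      the compression of b - y, which \<open>psi\<close> does not distinguish from b - y. The other
      thirds are convergence at y and the distance of y from b.\<close>
    have "op_bound (\<epsilon> / 3) (approx T (compress ?F (b - y b)))"
      by (intro psi_bound[OF F unit] compress_in bw dA compress_bound y(2)[OF b])
    then have 1: "op_bound (\<epsilon> / 3) (approx T (b - y b))"
      by (simp add: psi_compress bw[OF dA])
    have "approx T b = approx T (b - y b) + approx T (y b)"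
      using psi_add[OF bw[OF dA] bw[OF yA], of ?F "weight T"] by simp
    then have eq: "approx T b - b = approx T (b - y b) + (approx T (y b) - y b) - (b - y b)"
      by (simp add: algebra_simps)
    have 2: "op_bound (\<epsilon> / 3 + \<epsilon> / 3 + \<epsilon> / 3) (approx T (b - y b) + (approx T (y b) - y b) - (b - y b))"
      by (intro op_bound_add op_bound_diff 1 T(2) y(2) b)
    have "op_bound \<epsilon> (approx T b - b)" unfolding eq by (rule op_bound_mono[OF 2]) simp
    then show "op_norm (?\<psi> (?\<phi> b) - b) \<le> \<epsilon>"
      using bA by (simp add: compress_in bw psi_compress op_norm_le)
  qed
qed

end

theorem theorem3p3:
  fixes \<alpha> :: "'g::group_add \<Rightarrow> 'a::unital_cstar_algebra \<Rightarrow> 'a"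
    and \<pi> :: "'a \<Rightarrow> 'h oper"
  assumes "cstar_action \<alpha>"
    and "faithful_rep \<pi>"
    and "amenable_action \<alpha>"
  shows "comodule_nuclear \<pi> \<alpha>
    (crossed_product \<pi> \<alpha>) (crossed_module \<pi> \<alpha>) (crossed_coaction \<pi> \<alpha>)"
proof -
  interpret covariant \<alpha> \<pi> by unfold_locales (rule assms)+
  show ?thesis using assms(3) by (rule nuclear)
qed

end
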